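(* Let $\mathcal{M}$ be a Bregman manifold and let $(\mu_t)_{0\le t\le1}\subset\mathcal{P}^\infty(\mathcal{M})$. If $(\mu_t)$ is a primal displacement interpolation, then $\dot\mu_t$ is a primal parallel transport along $\mu_t$. If, alternatively, $(\mu_t)$ is a dual displacement interpolation, then $\dot\mu_t$ is a dual parallel transport along $\mu_t$.
   Context: Bregman manifold: let $\Omega$ be a smooth convex function on an open convex set $\mathcal{X}\subset\mathbb{R}^d$ with $D^2\Omega$ positive definite everywhere and $\mathcal{Y}:=D\Omega(\mathcal{X})$ convex; $\Omega^*(y)=x\cdot y-\Omega(x)$ for $y=D\Omega(x)$, and $(D\Omega)^{-1}=D\Omega^*$. $\mathcal{M}$ is the smooth manifold with global charts $\iota:\mathcal{M}\to\mathcal{X}$ (coordinates $x$) and $\iota^*=D\Omega\circ\iota:\mathcal{M}\to\mathcal{Y}$ (coordinates $y$). The metric $g=\langle\cdot,\cdot\rangle$ is given by $g(\partial_{x^i},\partial_{x^j})=D_{ij}\Omega(x)$. $\nabla$ (resp. $\nabla^*$) is the flat torsion-free affine connection on $\mathcal{M}$ whose Christoffel symbols vanish in the $x$-coordinates (resp. $y$-coordinates). $\operatorname{grad}$, $\operatorname{div}$, $\mathrm{vol}$ are the Riemannian gradient, divergence and volume of $g$. For $\mu\in\mathcal{P}(\mathcal{M})$ (Borel probability measures on $\mathcal{M}$), $\mu^{\mathcal{X}}=\iota_\#\mu$, $\mu^{\mathcal{Y}}=(\iota^* )_\#\mu$. A curve $(\mu_t)_{0\le t\le1}$ is a primal displacement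 interpolation if there is a convex function $h$ on $\mathcal{Y}$ with $Dh:\mathcal{Y}\to\mathcal{X}$ and $\mu_t^{\mathcal{X}}=((1-t)D\Omega^*+tDh)_\#\mu_0^{\mathcal{Y}}$; it is a dual displacement interpolation if there is a convex function $f$ on $\mathcal{X}$ with $Df:\mathcal{X}\to\mathcal{Y}$ and $\mu_t^{\mathcal{Y}}=((1-t)D\Omega+tDf)_\#\mu_0^{\mathcal{X}}$. $\mathcal{P}^\infty(\mathcal{M})$ is the space of probability measures $\rho\,d\mathrm{vol}$ with positive smooth densities $\rho$, such that $\rho$ decays sufficiently fast that all integrals involved converge and that all required operations (such as differentiation under the integral sign and integration by parts) can be carried out. $\Pi_\rho$ is the $L^2_\rho$-orthogonal projection of vector fields onto the tangent space $T_\rho\mathcal{P}^\infty(\mathcal{M})=\overline{\{\operatorname{grad}\phi:\phi\in C_c^\infty(\mathcal{M})\}}^{L^2_\rho}$. For a vector field $v$ on $\mathcal{M}$, $\mathcal{V}_v$ is the tangent vector at $\rho$ acting on functionals $F$ by $(\mathcal{V}_vF)(\rho)=\frac{d}{d\epsilon}|_{\epsilon=0}F(\rho-\epsilon\operatorname{div}(\rho\,\Pi_\rho(v)))$. The primal and dual connections on $\mathcal{P}^\infty(\mathcal{M})$ are $\boldsymbol{\nabla}_{\mathcal{V}_v}\mathcal{V}_w:=\mathcal{V}_{\nabla_vw}$ and $\boldsymbol{\nabla}^*_{\mathcal{V}_v}\mathcal{V}_w:=\mathcal{V}_{\nabla^*_vw}$ for vector fields $v,w$ on $\mathcal{M}$.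 Parallel transport: let $\mu_t=\rho_t\,d\mathrm{vol}$ be a curve in $\mathcal{P}^\infty(\mathcal{M})$ with velocity $\dot\mu_t=\mathcal{V}_{v_t}$ (so that $\partial_t\rho_t=-\operatorname{div}(\rho_tv_t)$), and let $\mathcal{V}_{w_t}$ be a vector field along $\mu_t$; here, for each $t$, $v_t$ and $w_t$ are vector fields on $\mathcal{M}$ satisfying $\Pi_{\rho_t}(v_t)=v_t$ and $\Pi_{\rho_t}(w_t)=w_t$. $\mathcal{V}_{w_t}$ is a primal parallel transport along $\mu_t$ if $\mathcal{V}_{\partial_tw_t}+\boldsymbol{\nabla}_{\mathcal{V}_{v_t}}\mathcal{V}_{w_t}=0$, and a dual parallel transport along $\mu_t$ if $\mathcal{V}_{\partial_tw_t}+\boldsymbol{\nabla}^*_{\mathcal{V}_{v_t}}\mathcal{V}_{w_t}=0$.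
   Formalization: The parallel transport equation is proved for the particle velocity v_t of the interpolation, assumed smooth with v_t and its time derivative in L², without requiring Π(v_t)=v_t; with the projected velocity the claim is false in dimension at least 2. *)

theory Defs
  imports "HOL-Probability.Probability"
begin

section \<open>Calculus in coordinates\<close>

text \<open>Continuous differentiability of order \<open>k\<close> on an open set, by recursion on directional
  derivatives.\<close>

fun Ck_on :: "nat \<Rightarrow> 'a::euclidean_space set \<Rightarrow> ('a \<Rightarrow> 'b::real_normed_vector) \<Rightarrow> bool" where
  "Ck_on 0 S f \<longleftrightarrow> continuous_on S f"
| "Ck_on (Suc k) S f \<longleftrightarrow>
     (\<forall>x\<in>S. f differentiable (at x)) \<and> (\<forall>e. Ck_on k S (\<lambda>x. frechet_derivative f (at x) e))"

definition smooth_on :: "'a::euclidean_space set \<Rightarrow> ('a \<Rightarrow> 'b::real_normed_vector) \<Rightarrow> bool" where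
  "smooth_on S f \<longleftrightarrow> open S \<and> (\<forall>k. Ck_on k S f)"

definition pd :: "'d::finite \<Rightarrow> (real^'d \<Rightarrow> real) \<Rightarrow> real^'d \<Rightarrow> real" where
  "pd i f x = frechet_derivative f (at x) (axis i 1)"

definition D :: "(real^'d::finite \<Rightarrow> real) \<Rightarrow> real^'d \<Rightarrow> real^'d" where
  "D f x = (\<chi> i. pd i f x)"

definition D2 :: "(real^'d::finite \<Rightarrow> real) \<Rightarrow> real^'d \<Rightarrow> real^'d^'d" where
  "D2 f x = (\<chi> i j. pd i (pd j f) x)"

text \<open>\<open>\<Omega>\<^sup>*(y) = x \<cdot> y - \<Omega>(x)\<close> for \<open>y = D \<Omega> x\<close>; it is meant for \<open>y \<in> D \<Omega> ` X\<close> only.\<close>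

definition conjugate ::
  "(real^'d::finite) set \<Rightarrow> (real^'d \<Rightarrow> real) \<Rightarrow> real^'d \<Rightarrow> real" where
  "conjugate X \<Omega> y = (let x = inv_into X (D \<Omega>) y in x \<bullet> y - \<Omega> x)"


section \<open>Bregman manifolds\<close>

text \<open>The manifold is the whole topological space \<open>'m\<close>; its smooth structure is the one for which
  the global chart \<open>\<iota>\<close> is a diffeomorphism onto \<open>X\<close>.\<close>

locale bregman_manifold =
  fixes X :: "(real^'d::finite) set"
    and \<Omega> :: "real^'d \<Rightarrow> real"
    and \<iota> :: "'m::topological_space \<Rightarrow> real^'d"
  assumes open_X: "open X"
    and convex_X: "convex X"
    and smooth_Omega: "smooth_on X \<Omega>"
    and convex_Omega: "convex_on X \<Omega>"
    and hessian_pos_def: "\<And>x u. x \<in> X \<Longrightarrow> u \<noteq> 0 \<Longrightarrow> 0 < u \<bullet> (D2 \<Omega> x *v u)"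
    and convex_Y: "convex (D \<Omega> ` X)"
    and chart: "homeomorphism UNIV X \<iota> (inv \<iota>)"

definition dual_chart ::
  "(real^'d::finite \<Rightarrow> real) \<Rightarrow> ('m \<Rightarrow> real^'d) \<Rightarrow> 'm \<Rightarrow> real^'d" where
  "dual_chart \<Omega> \<iota> = D \<Omega> \<circ> \<iota>"

text \<open>A vector field is given by its components in the frame of the \<open>x\<close>-coordinates, as a function
  \<open>'m \<Rightarrow> real^'d\<close>; \<open>to_dual\<close> converts to components in the frame of the \<open>y\<close>-coordinates.\<close>

type_synonym ('m, 'd) vfield = "'m \<Rightarrow> real^'d"

definition smooth_map ::
  "(real^'d::finite) set \<Rightarrow> ('m \<Rightarrow> real^'d) \<Rightarrow> ('m \<Rightarrow> 'b::real_normed_vector) \<Rightarrow> bool" where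
  "smooth_map X \<iota> f \<longleftrightarrow> smooth_on X (f \<circ> inv \<iota>)"

definition test_function ::
  "(real^'d::finite) set \<Rightarrow> ('m::topological_space \<Rightarrow> real^'d) \<Rightarrow> ('m \<Rightarrow> real) \<Rightarrow> bool" where
  "test_function X \<iota> \<phi> \<longleftrightarrow>
     smooth_map X \<iota> \<phi> \<and> (\<exists>K. compact K \<and> (\<forall>p. p \<notin> K \<longrightarrow> \<phi> p = 0))"

definition to_dual ::
  "(real^'d::finite \<Rightarrow> real) \<Rightarrow> ('m \<Rightarrow> real^'d) \<Rightarrow> ('m, 'd) vfield \<Rightarrow> ('m, 'd) vfield" where
  "to_dual \<Omega> \<iota> v p = D2 \<Omega> (\<iota> p) *v v p"

definition from_dual ::
  "(real^'d::finite \<Rightarrow> real) \<Rightarrow> ('m \<Rightarrow> real^'d) \<Rightarrow> ('m, 'd) vfield \<Rightarrow> ('m, 'd) vfield" where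
  "from_dual \<Omega> \<iota> v p = matrix_inv (D2 \<Omega> (\<iota> p)) *v v p"

definition metric ::
  "(real^'d::finite \<Rightarrow> real) \<Rightarrow> ('m \<Rightarrow> real^'d) \<Rightarrow> 'm \<Rightarrow> real^'d \<Rightarrow> real^'d \<Rightarrow> real" where
  "metric \<Omega> \<iota> p u w = u \<bullet> (D2 \<Omega> (\<iota> p) *v w)"

definition grad ::
  "(real^'d::finite \<Rightarrow> real) \<Rightarrow> ('m \<Rightarrow> real^'d) \<Rightarrow> ('m \<Rightarrow> real) \<Rightarrow> ('m, 'd) vfield" where
  "grad \<Omega> \<iota> \<phi> p = matrix_inv (D2 \<Omega> (\<iota> p)) *v D (\<phi> \<circ> inv \<iota>) (\<iota> p)"

definition vol ::
  "(real^'d::finite) set \<Rightarrow> (real^'d \<Rightarrow> real) \<Rightarrow> ('m::topological_space \<Rightarrow> real^'d) \<Rightarrow> 'm measure"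
  where
  "vol X \<Omega> \<iota> =
     distr (density (restrict_space lborel X) (\<lambda>x. ennreal (sqrt (det (D2 \<Omega> x))))) borel (inv \<iota>)"

definition divergence ::
  "(real^'d::finite \<Rightarrow> real) \<Rightarrow> ('m \<Rightarrow> real^'d) \<Rightarrow> ('m, 'd) vfield \<Rightarrow> 'm \<Rightarrow> real" where
  "divergence \<Omega> \<iota> w p =
     (\<Sum>i\<in>UNIV. pd i (\<lambda>x. sqrt (det (D2 \<Omega> x)) * w (inv \<iota> x) $ i) (\<iota> p)) / sqrt (det (D2 \<Omega> (\<iota> p)))"

text \<open>The covariant derivative, for fields given by components in the frame of a global chart \<open>c\<close>, of
  the connection whose Christoffel symbols vanish in the chart \<open>c\<close>.\<close>

definition chart_connection ::
  "('m \<Rightarrow> real^'d::finite) \<Rightarrow> ('m, 'd) vfield \<Rightarrow> ('m, 'd) vfield \<Rightarrow> ('m, 'd) vfield" where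
  "chart_connection c v w p =
     (\<chi> k. \<Sum>i\<in>UNIV. v p $ i * pd i (\<lambda>z. w (inv c z) $ k) (c p))"

definition primal_nabla ::
  "('m \<Rightarrow> real^'d::finite) \<Rightarrow> ('m, 'd) vfield \<Rightarrow> ('m, 'd) vfield \<Rightarrow> ('m, 'd) vfield" where
  "primal_nabla \<iota> v w = chart_connection \<iota> v w"

definition dual_nabla ::
  "(real^'d::finite \<Rightarrow> real) \<Rightarrow> ('m \<Rightarrow> real^'d) \<Rightarrow>
   ('m, 'd) vfield \<Rightarrow> ('m, 'd) vfield \<Rightarrow> ('m, 'd) vfield" where
  "dual_nabla \<Omega> \<iota> v w =
     from_dual \<Omega> \<iota> (chart_connection (dual_chart \<Omega> \<iota>) (to_dual \<Omega> \<iota> v) (to_dual \<Omega> \<iota> w))"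


section \<open>Displacement interpolations\<close>

definition displacement_potential ::
  "(real^'d::finite) set \<Rightarrow> (real^'d) set \<Rightarrow> (real^'d \<Rightarrow> real) \<Rightarrow> bool" where
  "displacement_potential S T h \<longleftrightarrow>
     convex_on S h \<and> (\<forall>y\<in>S. h differentiable (at y)) \<and> D h ` S \<subseteq> T"

definition primal_displacement ::
  "(real^'d::finite) set \<Rightarrow> (real^'d \<Rightarrow> real) \<Rightarrow> (real^'d \<Rightarrow> real) \<Rightarrow> real \<Rightarrow> real^'d \<Rightarrow> real^'d" where
  "primal_displacement X \<Omega> h t y = (1 - t) *\<^sub>R D (conjugate X \<Omega>) y + t *\<^sub>R D h y"

definition dual_displacement ::
  "(real^'d::finite \<Rightarrow> real) \<Rightarrow> (real^'d \<Rightarrow> real) \<Rightarrow> real \<Rightarrow> real^'d \<Rightarrow> real^'d" where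
  "dual_displacement \<Omega> f t x = (1 - t) *\<^sub>R D \<Omega> x + t *\<^sub>R D f x"

text \<open>The displacement maps are only defined on \<open>Y = D \<Omega> ` X\<close> (resp. \<open>X\<close>), hence \<open>restrict_space\<close>.\<close>

definition primal_displacement_interpolation ::
  "(real^'d::finite) set \<Rightarrow> (real^'d \<Rightarrow> real) \<Rightarrow> ('m::topological_space \<Rightarrow> real^'d) \<Rightarrow>
   (real^'d \<Rightarrow> real) \<Rightarrow> (real \<Rightarrow> 'm measure) \<Rightarrow> bool" where
  "primal_displacement_interpolation X \<Omega> \<iota> h \<mu> \<longleftrightarrow>
     displacement_potential (D \<Omega> ` X) X h \<and>
     (\<forall>t\<in>{0..1}. distr (\<mu> t) borel \<iota> =
        distr (restrict_space (distr (\<mu> 0) borel (dual_chart \<Omega> \<iota>)) (D \<Omega> ` X)) borel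
          (primal_displacement X \<Omega> h t))"

definition dual_displacement_interpolation ::
  "(real^'d::finite) set \<Rightarrow> (real^'d \<Rightarrow> real) \<Rightarrow> ('m::topological_space \<Rightarrow> real^'d) \<Rightarrow>
   (real^'d \<Rightarrow> real) \<Rightarrow> (real \<Rightarrow> 'm measure) \<Rightarrow> bool" where
  "dual_displacement_interpolation X \<Omega> \<iota> f \<mu> \<longleftrightarrow>
     displacement_potential X (D \<Omega> ` X) f \<and>
     (\<forall>t\<in>{0..1}. distr (\<mu> t) borel (dual_chart \<Omega> \<iota>) =
        distr (restrict_space (distr (\<mu> 0) borel \<iota>) X) borel (dual_displacement \<Omega> f t))"

definition integral_curve ::
  "('m \<Rightarrow> real^'d::finite) \<Rightarrow> (real \<Rightarrow> ('m, 'd) vfield) \<Rightarrow> (real \<Rightarrow> 'm) \<Rightarrow> bool" where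
  "integral_curve \<iota> v \<gamma> \<longleftrightarrow>
     (\<forall>t\<in>{0..1}. ((\<lambda>s. \<iota> (\<gamma> s)) has_vector_derivative v t (\<gamma> t)) (at t within {0..1}))"

text \<open>\<open>v\<close> is the velocity field of the particles transported by the interpolation.\<close>

definition primal_displacement_velocity ::
  "(real^'d::finite) set \<Rightarrow> (real^'d \<Rightarrow> real) \<Rightarrow> ('m \<Rightarrow> real^'d) \<Rightarrow>
   (real^'d \<Rightarrow> real) \<Rightarrow> (real \<Rightarrow> ('m, 'd) vfield) \<Rightarrow> bool" where
  "primal_displacement_velocity X \<Omega> \<iota> h v \<longleftrightarrow>
     (\<forall>y\<in>D \<Omega> ` X. integral_curve \<iota> v (\<lambda>t. inv \<iota> (primal_displacement X \<Omega> h t y)))"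

definition dual_displacement_velocity ::
  "(real^'d::finite) set \<Rightarrow> (real^'d \<Rightarrow> real) \<Rightarrow> ('m \<Rightarrow> real^'d) \<Rightarrow>
   (real^'d \<Rightarrow> real) \<Rightarrow> (real \<Rightarrow> ('m, 'd) vfield) \<Rightarrow> bool" where
  "dual_displacement_velocity X \<Omega> \<iota> f v \<longleftrightarrow>
     (\<forall>x\<in>X. integral_curve \<iota> v (\<lambda>t. inv (dual_chart \<Omega> \<iota>) (dual_displacement \<Omega> f t x)))"


section \<open>Smooth densities, projection and tangent vectors\<close>

text \<open>Smoothness on \<open>[0,1] \<times> 'm\<close> up to the boundary: existence of a smooth extension.\<close>

definition smooth_family ::
  "(real^'d::finite) set \<Rightarrow> ('m \<Rightarrow> real^'d) \<Rightarrow> (real \<Rightarrow> 'm \<Rightarrow> 'b::real_normed_vector) \<Rightarrow> bool" where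
  "smooth_family X \<iota> f \<longleftrightarrow>
     (\<exists>U G. {0..1} \<times> X \<subseteq> U \<and> smooth_on U G \<and> (\<forall>t\<in>{0..1}. \<forall>p. f t p = G (t, \<iota> p)))"

definition time_derivative ::
  "(real \<Rightarrow> 'm \<Rightarrow> 'b::real_normed_vector) \<Rightarrow> real \<Rightarrow> 'm \<Rightarrow> 'b" where
  "time_derivative f t p = vector_derivative (\<lambda>s. f s p) (at t within {0..1})"

text \<open>The decay requirement on elements of \<open>\<P>\<^sup>\<infinity>\<close> is not part of this predicate; it enters as
  explicit square integrability of the fields involved (see \<open>field_along\<close>).\<close>

definition smooth_density ::
  "(real^'d::finite) set \<Rightarrow> (real^'d \<Rightarrow> real) \<Rightarrow> ('m::topological_space \<Rightarrow> real^'d) \<Rightarrow>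
   ('m \<Rightarrow> real) \<Rightarrow> bool" where
  "smooth_density X \<Omega> \<iota> \<rho> \<longleftrightarrow>
     smooth_map X \<iota> \<rho> \<and> (\<forall>p. 0 < \<rho> p) \<and> prob_space (density (vol X \<Omega> \<iota>) (\<lambda>p. ennreal (\<rho> p)))"

definition density_curve ::
  "(real^'d::finite) set \<Rightarrow> (real^'d \<Rightarrow> real) \<Rightarrow> ('m::topological_space \<Rightarrow> real^'d) \<Rightarrow>
   (real \<Rightarrow> 'm measure) \<Rightarrow> (real \<Rightarrow> 'm \<Rightarrow> real) \<Rightarrow> bool" where
  "density_curve X \<Omega> \<iota> \<mu> \<rho> \<longleftrightarrow>
     smooth_family X \<iota> \<rho> \<and>
     (\<forall>t\<in>{0..1}. smooth_density X \<Omega> \<iota> (\<rho> t) \<and> \<mu> t = density (vol X \<Omega> \<iota>) (\<lambda>p. ennreal (\<rho> t p)))"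

definition L2_inner ::
  "(real^'d::finite) set \<Rightarrow> (real^'d \<Rightarrow> real) \<Rightarrow> ('m::topological_space \<Rightarrow> real^'d) \<Rightarrow>
   ('m \<Rightarrow> real) \<Rightarrow> ('m, 'd) vfield \<Rightarrow> ('m, 'd) vfield \<Rightarrow> real" where
  "L2_inner X \<Omega> \<iota> \<rho> u w = (\<integral>p. \<rho> p * metric \<Omega> \<iota> p (u p) (w p) \<partial>vol X \<Omega> \<iota>)"

definition L2_field ::
  "(real^'d::finite) set \<Rightarrow> (real^'d \<Rightarrow> real) \<Rightarrow> ('m::topological_space \<Rightarrow> real^'d) \<Rightarrow>
   ('m \<Rightarrow> real) \<Rightarrow> ('m, 'd) vfield \<Rightarrow> bool" where
  "L2_field X \<Omega> \<iota> \<rho> u \<longleftrightarrow>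
     u \<in> borel_measurable borel \<and>
     integrable (vol X \<Omega> \<iota>) (\<lambda>p. \<rho> p * metric \<Omega> \<iota> p (u p) (u p))"

definition tangent_space ::
  "(real^'d::finite) set \<Rightarrow> (real^'d \<Rightarrow> real) \<Rightarrow> ('m::topological_space \<Rightarrow> real^'d) \<Rightarrow>
   ('m \<Rightarrow> real) \<Rightarrow> ('m, 'd) vfield set" where
  "tangent_space X \<Omega> \<iota> \<rho> =
     {u. L2_field X \<Omega> \<iota> \<rho> u \<and>
         (\<forall>\<epsilon>>0. \<exists>\<phi>. test_function X \<iota> \<phi> \<and>
            (let r = (\<lambda>p. u p - grad \<Omega> \<iota> \<phi> p) in L2_inner X \<Omega> \<iota> \<rho> r r < \<epsilon>))}"

text \<open>\<open>\<Pi>\<^sub>\<rho>(v)\<close> is an \<open>L\<^sup>2\<close> class, of which we take the smooth representative, so that the divergence in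
  \<open>tangent_vector\<close> is the classical one. For smooth square integrable \<open>v\<close> it exists, since
  \<open>\<Pi>\<^sub>\<rho>(v)\<close> is the gradient of a weak solution of an elliptic equation with smooth coefficients, and it
  is unique, since \<open>\<rho>\<close> is positive. The value \<open>0\<close> is only for totality.\<close>

definition is_projection ::
  "(real^'d::finite) set \<Rightarrow> (real^'d \<Rightarrow> real) \<Rightarrow> ('m::topological_space \<Rightarrow> real^'d) \<Rightarrow>
   ('m \<Rightarrow> real) \<Rightarrow> ('m, 'd) vfield \<Rightarrow> ('m, 'd) vfield \<Rightarrow> bool" where
  "is_projection X \<Omega> \<iota> \<rho> v w \<longleftrightarrow>
     smooth_map X \<iota> w \<and> w \<in> tangent_space X \<Omega> \<iota> \<rho> \<and>
     (\<forall>u\<in>tangent_space X \<Omega> \<iota> \<rho>. L2_inner X \<Omega> \<iota> \<rho> (\<lambda>p. v p - w p) u = 0)"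

definition projection ::
  "(real^'d::finite) set \<Rightarrow> (real^'d \<Rightarrow> real) \<Rightarrow> ('m::topological_space \<Rightarrow> real^'d) \<Rightarrow>
   ('m \<Rightarrow> real) \<Rightarrow> ('m, 'd) vfield \<Rightarrow> ('m, 'd) vfield" where
  "projection X \<Omega> \<iota> \<rho> v =
     (if \<exists>w. is_projection X \<Omega> \<iota> \<rho> v w then SOME w. is_projection X \<Omega> \<iota> \<rho> v w else (\<lambda>p. 0))"

text \<open>Functionals on densities which are Gateaux differentiable at \<open>\<rho>\<close> in all smooth directions, with
  linear derivative; for instance \<open>\<rho> \<mapsto> \<integral> \<phi> \<rho> d vol\<close> for test functions \<open>\<phi>\<close>.\<close>

definition differentiable_functional ::
  "(real^'d::finite) set \<Rightarrow> ('m \<Rightarrow> real^'d) \<Rightarrow> (('m \<Rightarrow> real) \<Rightarrow> real) \<Rightarrow> ('m \<Rightarrow> real) \<Rightarrow> bool" where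
  "differentiable_functional X \<iota> F \<rho> \<longleftrightarrow>
     (\<exists>L. (\<forall>s. smooth_map X \<iota> s \<longrightarrow>
             ((\<lambda>\<epsilon>. F (\<lambda>p. \<rho> p + \<epsilon> * s p)) has_real_derivative L s) (at 0)) \<and>
          (\<forall>a b s r. smooth_map X \<iota> s \<longrightarrow> smooth_map X \<iota> r \<longrightarrow>
             L (\<lambda>p. a * s p + b * r p) = a * L s + b * L r))"

text \<open>\<open>\<V>\<^sub>v\<close> at \<open>\<rho>\<close>, as an operator on functionals.\<close>

definition tangent_vector ::
  "(real^'d::finite) set \<Rightarrow> (real^'d \<Rightarrow> real) \<Rightarrow> ('m::topological_space \<Rightarrow> real^'d) \<Rightarrow>
   ('m \<Rightarrow> real) \<Rightarrow> ('m, 'd) vfield \<Rightarrow> (('m \<Rightarrow> real) \<Rightarrow> real) \<Rightarrow> real" where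
  "tangent_vector X \<Omega> \<iota> \<rho> v F =
     deriv (\<lambda>\<epsilon>. F (\<lambda>p. \<rho> p - \<epsilon> * divergence \<Omega> \<iota> (\<lambda>q. \<rho> q *\<^sub>R projection X \<Omega> \<iota> \<rho> v q) p)) 0"

text \<open>The connections on \<open>\<P>\<^sup>\<infinity>\<close> are defined through the vector fields representing tangent
  vectors, so they take these representatives as arguments.\<close>

definition primal_connection ::
  "(real^'d::finite) set \<Rightarrow> (real^'d \<Rightarrow> real) \<Rightarrow> ('m::topological_space \<Rightarrow> real^'d) \<Rightarrow>
   ('m \<Rightarrow> real) \<Rightarrow> ('m, 'd) vfield \<Rightarrow> ('m, 'd) vfield \<Rightarrow> (('m \<Rightarrow> real) \<Rightarrow> real) \<Rightarrow> real" where
  "primal_connection X \<Omega> \<iota> \<rho> v w = tangent_vector X \<Omega> \<iota> \<rho> (primal_nabla \<iota> v w)"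

definition dual_connection ::
  "(real^'d::finite) set \<Rightarrow> (real^'d \<Rightarrow> real) \<Rightarrow> ('m::topological_space \<Rightarrow> real^'d) \<Rightarrow>
   ('m \<Rightarrow> real) \<Rightarrow> ('m, 'd) vfield \<Rightarrow> ('m, 'd) vfield \<Rightarrow> (('m \<Rightarrow> real) \<Rightarrow> real) \<Rightarrow> real" where
  "dual_connection X \<Omega> \<iota> \<rho> v w = tangent_vector X \<Omega> \<iota> \<rho> (dual_nabla \<Omega> \<iota> v w)"


section \<open>Velocity and parallel transport along a curve of densities\<close>

definition field_along ::
  "(real^'d::finite) set \<Rightarrow> (real^'d \<Rightarrow> real) \<Rightarrow> ('m::topological_space \<Rightarrow> real^'d) \<Rightarrow>
   (real \<Rightarrow> 'm \<Rightarrow> real) \<Rightarrow> (real \<Rightarrow> ('m, 'd) vfield) \<Rightarrow> bool" where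
  "field_along X \<Omega> \<iota> \<rho> v \<longleftrightarrow>
     smooth_family X \<iota> v \<and>
     (\<forall>t\<in>{0..1}. L2_field X \<Omega> \<iota> (\<rho> t) (v t) \<and> L2_field X \<Omega> \<iota> (\<rho> t) (time_derivative v t))"

definition has_velocity ::
  "(real^'d::finite \<Rightarrow> real) \<Rightarrow> ('m \<Rightarrow> real^'d) \<Rightarrow>
   (real \<Rightarrow> 'm \<Rightarrow> real) \<Rightarrow> (real \<Rightarrow> ('m, 'd) vfield) \<Rightarrow> bool" where
  "has_velocity \<Omega> \<iota> \<rho> v \<longleftrightarrow>
     (\<forall>t\<in>{0..1}. \<forall>p. ((\<lambda>s. \<rho> s p) has_real_derivative
        - divergence \<Omega> \<iota> (\<lambda>q. \<rho> t q *\<^sub>R v t q) p) (at t within {0..1}))"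

text \<open>The representatives \<open>v\<close>, \<open>w\<close> are not required to be fixed by \<open>\<Pi>\<^sub>\<rho>\<close>: the velocity field of a
  displacement interpolation is in general not a \<open>g\<close>-gradient for \<open>t > 0\<close>.\<close>

definition primal_parallel_transport ::
  "(real^'d::finite) set \<Rightarrow> (real^'d \<Rightarrow> real) \<Rightarrow> ('m::topological_space \<Rightarrow> real^'d) \<Rightarrow>
   (real \<Rightarrow> 'm \<Rightarrow> real) \<Rightarrow> (real \<Rightarrow> ('m, 'd) vfield) \<Rightarrow> (real \<Rightarrow> ('m, 'd) vfield) \<Rightarrow> bool" where
  "primal_parallel_transport X \<Omega> \<iota> \<rho> v w \<longleftrightarrow>
     (\<forall>t\<in>{0..1}. \<forall>F. differentiable_functional X \<iota> F (\<rho> t) \<longrightarrow>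
        tangent_vector X \<Omega> \<iota> (\<rho> t) (time_derivative w t) F +
        primal_connection X \<Omega> \<iota> (\<rho> t) (v t) (w t) F = 0)"

definition dual_parallel_transport ::
  "(real^'d::finite) set \<Rightarrow> (real^'d \<Rightarrow> real) \<Rightarrow> ('m::topological_space \<Rightarrow> real^'d) \<Rightarrow>
   (real \<Rightarrow> 'm \<Rightarrow> real) \<Rightarrow> (real \<Rightarrow> ('m, 'd) vfield) \<Rightarrow> (real \<Rightarrow> ('m, 'd) vfield) \<Rightarrow> bool" where
  "dual_parallel_transport X \<Omega> \<iota> \<rho> v w \<longleftrightarrow>
     (\<forall>t\<in>{0..1}. \<forall>F. differentiable_functional X \<iota> F (\<rho> t) \<longrightarrow>
        tangent_vector X \<Omega> \<iota> (\<rho> t) (time_derivative w t) F +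
        dual_connection X \<Omega> \<iota> (\<rho> t) (v t) (w t) F = 0)"

end

theory Submission
  imports Defs
begin

text \<open>
  Both statements are about particles on straight lines. In a primal displacement interpolation a
  particle that starts at \<open>p\<close> moves in the \<open>x\<close>-chart along the segment from \<open>\<iota> p\<close> to
  \<open>D h (D \<Omega> (\<iota> p))\<close> with constant speed; in a dual one the same happens in the \<open>y\<close>-chart. Hence the
  velocity field, expressed in that chart, is constant along every trajectory, and its material
  derivative \<open>\<partial>\<^sub>t v + \<nabla>\<^sub>v v\<close> vanishes at all points that are reached at time \<open>t\<close>; here \<open>\<nabla>\<close> is the
  connection that is the plain directional derivative in that chart. The map from initial to current
  positions is not known to be onto, but \<open>\<rho>\<^sub>t\<close> is positive, so the points reached at time \<open>t\<close> are dense
  (\<open>eq_0_if_eq_0_along\<close>). By continuity \<open>\<nabla>\<^sub>v v = - \<partial>\<^sub>t v\<close> holds on the whole manifold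
  (\<open>primal_acceleration_0\<close>, \<open>dual_acceleration_0\<close>). As \<open>v \<mapsto> \<V>\<^sub>v\<close> is odd, the two tangent vectors in the
  equation of parallel transport cancel (\<open>tangent_vector_uminus\<close>). Oddness is not purely formal, since
  \<open>\<Pi>\<^sub>\<rho>\<close> is a choice of a smooth representative: it rests on the uniqueness of that representative
  (\<open>is_projection_unique\<close>) and on the smoothness of the direction in which a functional is
  differentiated (\<open>smooth_map_divergence\<close>).

  That \<open>v\<close> is the velocity of \<open>\<mu>\<close>, i.e. the continuity equation \<open>\<partial>\<^sub>t \<rho> = - div (\<rho> v)\<close>, is proved in weak
  form. The integral of a bump function \<open>\<phi>\<close> against \<open>\<mu>\<^sub>t\<close> is differentiated in \<open>t\<close> in two ways: through
  the density, and through the trajectories, which gives the integral of \<open>D \<phi> \<bullet> v\<^sub>t\<close> against \<open>\<mu>\<^sub>t\<close>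
  (\<open>bump_continuity_equation\<close>). Integration by parts moves the derivative away from \<open>\<phi>\<close>, and since \<open>\<phi>\<close> is
  an arbitrary bump function, the equation holds pointwise (\<open>continuity_equation\<close>). Only
  the facts that particles follow \<open>v\<close> and carry \<open>\<mu>\<^sub>0\<close> to \<open>\<mu>\<^sub>t\<close> enter here, so the primal and the dual
  case are treated at once (locale \<open>transported_density\<close>).

  To see that the trajectories are as described, one has to know that \<open>D \<Omega>\<close> is a diffeomorphism onto
  its image, whose inverse is \<open>D \<Omega>\<^sup>*\<close> (\<open>D_inv_has_derivative\<close>, \<open>D_conjugate\<close>). The potentials \<open>h\<close> and \<open>f\<close> are
  only assumed to be differentiable, but their gradients are determined by the velocity at time \<open>0\<close>
  and therefore continuous; this makes the displacement maps measurable (\<open>primal_transport\<close>,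
  \<open>dual_transport\<close>).
\<close>

section \<open>Calculus on open sets\<close>

lemma Ck_on_cong:
  assumes "open S" "\<And>x. x \<in> S \<Longrightarrow> f x = g x" "Ck_on k S f"
  shows "Ck_on k S g"
  using assms(2,3)
proof (induction k arbitrary: f g)
  case 0
  then show ?case by (simp cong: continuous_on_cong)
next
  case (Suc k)
  have der: "(g has_derivative frechet_derivative f (at x)) (at x)" if "x \<in> S" for x
  proof (rule has_derivative_transform_within_open[OF _ \<open>open S\<close> that])
    show "(f has_derivative frechet_derivative f (at x)) (at x)"
      using Suc.prems(2) that by (simp add: frechet_derivative_works)
  qed (use Suc.prems(1) in auto)
  have "frechet_derivative f (at x) e = frechet_derivative g (at x) e" if "x \<in> S" for x e
    using frechet_derivative_at[OF der[OF that]] by simp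
  moreover have "g differentiable (at x)" if "x \<in> S" for x
    using der[OF that] by (auto simp: differentiable_def)
  ultimately show ?case
    using Suc.IH[of "\<lambda>x. frechet_derivative f (at x) e" "\<lambda>x. frechet_derivative g (at x) e" for e]
      Suc.prems(2) by auto
qed

lemma Ck_on_SucI:
  assumes "open S" "\<And>x. x \<in> S \<Longrightarrow> (f has_derivative f' x) (at x)"
    "\<And>e. Ck_on k S (\<lambda>x. f' x e)"
  shows "Ck_on (Suc k) S f"
proof -
  have "Ck_on k S (\<lambda>x. frechet_derivative f (at x) e)" for e
    by (rule Ck_on_cong[OF assms(1) _ assms(3)[of e]])
       (use frechet_derivative_at[OF assms(2)] in simp)
  then show ?thesis
    using assms(2) by (auto simp: differentiable_def)
qed

lemma Ck_on_SucD:
  assumes "Ck_on (Suc k) S f"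
  shows "x \<in> S \<Longrightarrow> (f has_derivative frechet_derivative f (at x)) (at x)"
    and "Ck_on k S (\<lambda>x. frechet_derivative f (at x) e)"
  using assms by (auto simp: frechet_derivative_works)

lemma Ck_on_SucD_lower: "Ck_on (Suc k) S f \<Longrightarrow> Ck_on k S f"
proof (induction k arbitrary: f)
  case 0
  then show ?case
    by (auto intro!: continuous_at_imp_continuous_on differentiable_imp_continuous_within)
qed auto

lemma Ck_on_continuous: "Ck_on k S f \<Longrightarrow> continuous_on S f"
  by (induction k) (use Ck_on_SucD_lower in \<open>auto simp del: Ck_on.simps(2)\<close>)

lemma Ck_on_const: "Ck_on k S (\<lambda>x. c)"
  by (induction k arbitrary: c) auto

lemma Ck_on_linear:
  assumes "open S" "bounded_linear L" "Ck_on k S f"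
  shows "Ck_on k S (\<lambda>x. L (f x))"
  using assms(3)
proof (induction k arbitrary: f)
  case 0
  then show ?case by (simp add: bounded_linear.continuous_on[OF assms(2)])
next
  case (Suc k)
  show ?case
    by (rule Ck_on_SucI[OF assms(1), where f' = "\<lambda>x e. L (frechet_derivative f (at x) e)"])
       (use bounded_linear.has_derivative[OF assms(2)] Ck_on_SucD[OF Suc.prems] Suc.IH in auto)
qed

lemma Ck_on_add:
  assumes "open S" "Ck_on k S f" "Ck_on k S g"
  shows "Ck_on k S (\<lambda>x. f x + g x)"
  using assms(2,3)
proof (induction k arbitrary: f g)
  case 0
  then show ?case by (auto intro: continuous_intros)
next
  case (Suc k)
  show ?case
    by (rule Ck_on_SucI[OF assms(1), where f' = "\<lambda>x e. frechet_derivative f (at x) e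
        + frechet_derivative g (at x) e"])
       (use Ck_on_SucD[OF Suc.prems(1)] Ck_on_SucD[OF Suc.prems(2)] Suc.IH
         in \<open>auto intro: has_derivative_add\<close>)
qed

lemma Ck_on_sum:
  assumes "open S" "\<And>i. i \<in> I \<Longrightarrow> Ck_on k S (f i)"
  shows "Ck_on k S (\<lambda>x. \<Sum>i\<in>I. f i x)"
  using assms(2) by (induction I rule: infinite_finite_induct) (auto intro: Ck_on_const Ck_on_add[OF assms(1)])

lemma Ck_on_mult:
  fixes f g :: "'a::euclidean_space \<Rightarrow> real"
  assumes "open S" "Ck_on k S f" "Ck_on k S g"
  shows "Ck_on k S (\<lambda>x. f x * g x)"
  using assms(2,3)
proof (induction k arbitrary: f g)
  case 0
  then show ?case by (auto intro: continuous_intros)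
next
  case (Suc k)
  show ?case
  proof (rule Ck_on_SucI[OF assms(1)])
    show "((\<lambda>x. f x * g x) has_derivative
        (\<lambda>e. f x * frechet_derivative g (at x) e + frechet_derivative f (at x) e * g x)) (at x)"
      if "x \<in> S" for x
      using Ck_on_SucD(1)[OF Suc.prems(1) that] Ck_on_SucD(1)[OF Suc.prems(2) that]
      by (rule has_derivative_mult)
    show "Ck_on k S (\<lambda>x. f x * frechet_derivative g (at x) e + frechet_derivative f (at x) e * g x)"
      for e
      using Ck_on_SucD(2)[OF Suc.prems(1)] Ck_on_SucD(2)[OF Suc.prems(2)]
        Suc.prems[THEN Ck_on_SucD_lower]
      by (intro Ck_on_add[OF assms(1)] Suc.IH) auto
  qed
qed

lemma Ck_on_prod:
  fixes f :: "'i \<Rightarrow> 'a::euclidean_space \<Rightarrow> real"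
  assumes "open S" "\<And>i. i \<in> I \<Longrightarrow> Ck_on k S (f i)"
  shows "Ck_on k S (\<lambda>x. \<Prod>i\<in>I. f i x)"
  using assms(2) by (induction I rule: infinite_finite_induct) (auto intro: Ck_on_const Ck_on_mult[OF assms(1)])

text \<open>This one induction covers square roots and reciprocals together: the derivative of a power is again
  a power times \<open>f'\<close>.\<close>

lemma Ck_on_powr:
  fixes f :: "'a::euclidean_space \<Rightarrow> real"
  assumes "open S" "Ck_on k S f" "\<And>x. x \<in> S \<Longrightarrow> 0 < f x"
  shows "Ck_on k S (\<lambda>x. f x powr a)"
  using assms(2)
proof (induction k arbitrary: a)
  case 0
  then show ?case using assms(3) by (fastforce intro!: continuous_intros)
next
  case (Suc k)
  show ?case
  proof (rule Ck_on_SucI[OF assms(1)])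
    show "((\<lambda>x. f x powr a) has_derivative
        (\<lambda>e. a * f x powr (a - 1) * frechet_derivative f (at x) e)) (at x)" if "x \<in> S" for x
    proof -
      have "((\<lambda>y. y powr a) has_derivative (\<lambda>e. a * f x powr (a - 1) * e)) (at (f x))"
        using has_real_derivative_powr[OF assms(3)[OF that], of a]
        by (simp add: has_field_derivative_def)
      from diff_chain_at[OF Ck_on_SucD(1)[OF Suc.prems that] this] show ?thesis
        by (simp add: o_def)
    qed
    show "Ck_on k S (\<lambda>x. a * f x powr (a - 1) * frechet_derivative f (at x) e)" for e
      using Ck_on_SucD(2)[OF Suc.prems] Suc.prems[THEN Ck_on_SucD_lower] Suc.IH
      by (intro Ck_on_mult[OF assms(1)] Ck_on_const) auto
  qed
qed

lemma Ck_on_slice: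
  fixes G :: "real \<times> 'a::euclidean_space \<Rightarrow> 'b::real_normed_vector"
  assumes "open S" "{t} \<times> S \<subseteq> U" "Ck_on k U G"
  shows "Ck_on k S (\<lambda>x. G (t, x))"
  using assms(3)
proof (induction k arbitrary: G)
  case 0
  then have "continuous_on U G" by simp
  moreover have "(\<lambda>x. (t, x)) ` S \<subseteq> U" using assms(2) by auto
  ultimately show ?case
    by (auto intro!: continuous_on_compose2[of U G S "\<lambda>x. (t, x)"] continuous_intros)
next
  case (Suc k)
  show ?case
  proof (rule Ck_on_SucI[OF assms(1)])
    show "((\<lambda>x. G (t, x)) has_derivative (\<lambda>e. frechet_derivative G (at (t, x)) (0, e))) (at x)"
      if "x \<in> S" for x
    proof -
      have "((\<lambda>x. (t, x)) has_derivative (\<lambda>e. (0, e))) (at x)"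
        by (auto intro!: derivative_eq_intros)
      moreover have "(G has_derivative frechet_derivative G (at (t, x))) (at (t, x))"
        using that assms(2) by (intro Ck_on_SucD(1)[OF Suc.prems]) auto
      ultimately show ?thesis
        using diff_chain_at[of "\<lambda>x. (t, x)" "\<lambda>e. (0, e)" x G] by (simp add: o_def)
    qed
    show "Ck_on k S (\<lambda>x. frechet_derivative G (at (t, x)) (0, e))" for e
      using Ck_on_SucD(2)[OF Suc.prems] by (rule Suc.IH)
  qed
qed

lemma has_real_derivative_along_line:
  fixes f :: "'a::euclidean_space \<Rightarrow> real"
  assumes "(f has_derivative f') (at (a + s *\<^sub>R u))"
  shows "((\<lambda>s. f (a + s *\<^sub>R u)) has_real_derivative f' u) (at s)"
proof -
  have "((\<lambda>s. a + s *\<^sub>R u) has_derivative (\<lambda>h. h *\<^sub>R u)) (at s)"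
    by (auto intro!: derivative_eq_intros)
  from diff_chain_at[OF this assms]
  have "((\<lambda>s. f (a + s *\<^sub>R u)) has_derivative (\<lambda>h. f' (h *\<^sub>R u))) (at s)"
    by (simp add: o_def)
  moreover have "(\<lambda>h. f' (h *\<^sub>R u)) = (*) (f' u)"
    using linear_scale[OF has_derivative_linear[OF assms]] by (auto simp: fun_eq_iff mult.commute)
  ultimately show ?thesis by (simp add: has_field_derivative_def)
qed

text \<open>Two applications of the mean value theorem express the second difference by a value of one
  mixed second derivative; the second difference is symmetric in the two directions.\<close>

lemma second_difference:
  fixes f :: "'a::euclidean_space \<Rightarrow> real"
  assumes f: "Ck_on 2 S f" and "0 < h"
    and sub: "\<And>\<sigma> \<tau>. 0 \<le> \<sigma> \<Longrightarrow> \<sigma> \<le> h \<Longrightarrow> 0 \<le> \<tau> \<Longrightarrow> \<tau> \<le> h \<Longrightarrow> x + \<sigma> *\<^sub>R u + \<tau> *\<^sub>R w \<in> S"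
  obtains \<sigma> \<tau> where "0 \<le> \<sigma>" "\<sigma> \<le> h" "0 \<le> \<tau>" "\<tau> \<le> h"
    "f (x + h *\<^sub>R u + h *\<^sub>R w) - f (x + h *\<^sub>R u) - f (x + h *\<^sub>R w) + f x =
       h * h * frechet_derivative (\<lambda>y. frechet_derivative f (at y) u) (at (x + \<sigma> *\<^sub>R u + \<tau> *\<^sub>R w)) w"
proof -
  let ?f1 = "\<lambda>y. frechet_derivative f (at y) u"
  have f2: "Ck_on (Suc (Suc 0)) S f" using f by (simp add: numeral_2_eq_2)
  note d1 = Ck_on_SucD(1)[OF f2] and d2 = Ck_on_SucD(1)[OF Ck_on_SucD(2)[OF f2, of u]]
  define p where "p s = f (x + h *\<^sub>R w + s *\<^sub>R u) - f (x + s *\<^sub>R u)" for s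
  have dp: "(p has_real_derivative ?f1 (x + h *\<^sub>R w + s *\<^sub>R u) - ?f1 (x + s *\<^sub>R u)) (at s)"
    if "0 \<le> s" "s \<le> h" for s
    unfolding p_def
    using that sub[of s h] sub[of s 0] \<open>0 < h\<close>
    by (intro DERIV_diff has_real_derivative_along_line d1) (auto simp: algebra_simps)
  obtain s where s: "0 < s" "s < h"
    and ps: "p h - p 0 = (h - 0) * (?f1 (x + h *\<^sub>R w + s *\<^sub>R u) - ?f1 (x + s *\<^sub>R u))"
    using MVT2[OF \<open>0 < h\<close>, of p "\<lambda>s. ?f1 (x + h *\<^sub>R w + s *\<^sub>R u) - ?f1 (x + s *\<^sub>R u)"] dp by blast
  have dq: "((\<lambda>r. ?f1 (x + s *\<^sub>R u + r *\<^sub>R w)) has_real_derivative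
      frechet_derivative ?f1 (at (x + s *\<^sub>R u + r *\<^sub>R w)) w) (at r)" if "0 \<le> r" "r \<le> h" for r
    using that s sub[of s r] by (intro has_real_derivative_along_line d2) auto
  obtain r where r: "0 < r" "r < h" and
    qr: "?f1 (x + s *\<^sub>R u + h *\<^sub>R w) - ?f1 (x + s *\<^sub>R u + 0 *\<^sub>R w)
      = (h - 0) * frechet_derivative ?f1 (at (x + s *\<^sub>R u + r *\<^sub>R w)) w"
    using MVT2[OF \<open>0 < h\<close> dq] by blast
  show ?thesis
  proof (rule that[of s r])
    show "f (x + h *\<^sub>R u + h *\<^sub>R w) - f (x + h *\<^sub>R u) - f (x + h *\<^sub>R w) + f x =
       h * h * frechet_derivative ?f1 (at (x + s *\<^sub>R u + r *\<^sub>R w)) w"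
      using ps qr by (simp add: p_def algebra_simps)
  qed (use s r in auto)
qed

text \<open>Second differences over small squares approximate both mixed derivatives, which are continuous.\<close>

lemma second_derivative_symmetric:
  fixes f :: "'a::euclidean_space \<Rightarrow> real"
  assumes f: "Ck_on 2 S f" and "open S" "x \<in> S"
  shows "frechet_derivative (\<lambda>y. frechet_derivative f (at y) u) (at x) w =
         frechet_derivative (\<lambda>y. frechet_derivative f (at y) w) (at x) u"
proof -
  let ?f2 = "\<lambda>u w y. frechet_derivative (\<lambda>y. frechet_derivative f (at y) u) (at y) w"
  have f2: "Ck_on (Suc (Suc 0)) S f" using f by (simp add: numeral_2_eq_2)
  have cont: "isCont (?f2 u w) x" for u w
    using Ck_on_SucD(2)[OF Ck_on_SucD(2)[OF f2, of u], of w] \<open>open S\<close> \<open>x \<in> S\<close>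
    by (simp add: continuous_on_eq_continuous_at)
  obtain \<delta> where \<delta>: "0 < \<delta>" "ball x \<delta> \<subseteq> S"
    using \<open>open S\<close> \<open>x \<in> S\<close> by (meson open_contains_ball)
  have close: "\<bar>?f2 u w x - ?f2 w u x\<bar> < 2 * e" if "0 < e" for e :: real
  proof -
    obtain d1 where d1: "0 < d1" "\<And>y. dist y x < d1 \<Longrightarrow> dist (?f2 u w y) (?f2 u w x) < e"
      using cont[of u w] \<open>0 < e\<close> unfolding continuous_at_eps_delta by meson
    obtain d2 where d2: "0 < d2" "\<And>y. dist y x < d2 \<Longrightarrow> dist (?f2 w u y) (?f2 w u x) < e"
      using cont[of w u] \<open>0 < e\<close> unfolding continuous_at_eps_delta by meson
    define d where "d = min \<delta> (min d1 d2)"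
    \<comment> \<open>A square of this side, spanned by \<open>u\<close> and \<open>w\<close>, fits into the ball of radius \<open>d\<close>.\<close>
    define h where "h = d / (2 * (norm u + norm w + 1))"
    have "0 < d" using \<delta> d1 d2 by (simp add: d_def)
    then have "0 < h" by (auto simp: h_def intro!: divide_pos_pos add_nonneg_pos)
    have near: "dist (x + \<sigma> *\<^sub>R a + \<tau> *\<^sub>R b) x < d"
      if "0 \<le> \<sigma>" "\<sigma> \<le> h" "0 \<le> \<tau>" "\<tau> \<le> h" "norm a + norm b = norm u + norm w" for \<sigma> \<tau> a b
    proof -
      have "norm (\<sigma> *\<^sub>R a + \<tau> *\<^sub>R b) \<le> \<sigma> * norm a + \<tau> * norm b"
        using norm_triangle_ineq[of "\<sigma> *\<^sub>R a" "\<tau> *\<^sub>R b"] that by simp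
      also have "\<dots> \<le> h * norm a + h * norm b"
        using that by (intro add_mono mult_right_mono) auto
      also have "\<dots> = h * (norm u + norm w)" using that by (metis distrib_left)
      also have "\<dots> < h * (2 * (norm u + norm w + 1))"
        using \<open>0 < h\<close> by (intro mult_strict_left_mono) (simp_all add: add_nonneg_pos)
      also have "\<dots> = d"
      proof -
        have "0 < norm u + norm w + 1" by (simp add: add_nonneg_pos)
        then show ?thesis unfolding h_def by simp
      qed
      finally show ?thesis by (simp add: dist_norm add.assoc)
    qed
    have S: "y \<in> S" if "dist y x < d" for y
      using \<delta>(2) that by (auto simp: d_def dist_commute)
    have S1: "x + \<sigma> *\<^sub>R u + \<tau> *\<^sub>R w \<in> S" and S2: "x + \<sigma> *\<^sub>R w + \<tau> *\<^sub>R u \<in> S"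
      if "0 \<le> \<sigma>" "\<sigma> \<le> h" "0 \<le> \<tau>" "\<tau> \<le> h" for \<sigma> \<tau>
      using S[OF near[OF that, of u w]] S[OF near[OF that, of w u]] by simp_all
    obtain s1 r1 where 1: "0 \<le> s1" "s1 \<le> h" "0 \<le> r1" "r1 \<le> h"
      "f (x + h *\<^sub>R u + h *\<^sub>R w) - f (x + h *\<^sub>R u) - f (x + h *\<^sub>R w) + f x =
        h * h * ?f2 u w (x + s1 *\<^sub>R u + r1 *\<^sub>R w)"
      by (rule second_difference[OF f \<open>0 < h\<close> S1])
    obtain s2 r2 where 2: "0 \<le> s2" "s2 \<le> h" "0 \<le> r2" "r2 \<le> h"
      "f (x + h *\<^sub>R w + h *\<^sub>R u) - f (x + h *\<^sub>R w) - f (x + h *\<^sub>R u) + f x =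
        h * h * ?f2 w u (x + s2 *\<^sub>R w + r2 *\<^sub>R u)"
      by (rule second_difference[OF f \<open>0 < h\<close> S2])
    have comm: "x + h *\<^sub>R w + h *\<^sub>R u = x + h *\<^sub>R u + h *\<^sub>R w" by (simp add: add_ac)
    have "h * h * ?f2 u w (x + s1 *\<^sub>R u + r1 *\<^sub>R w) = h * h * ?f2 w u (x + s2 *\<^sub>R w + r2 *\<^sub>R u)"
      using 1(5) 2(5) unfolding comm by linarith
    then have "?f2 u w (x + s1 *\<^sub>R u + r1 *\<^sub>R w) = ?f2 w u (x + s2 *\<^sub>R w + r2 *\<^sub>R u)"
      using \<open>0 < h\<close> by simp
    moreover have "dist (x + s1 *\<^sub>R u + r1 *\<^sub>R w) x < d1" "dist (x + s2 *\<^sub>R w + r2 *\<^sub>R u) x < d2"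
      using near[of s1 r1 u w] near[of s2 r2 w u] 1 2 by (auto simp: d_def)
    ultimately show ?thesis
      using d1(2)[of "x + s1 *\<^sub>R u + r1 *\<^sub>R w"] d2(2)[of "x + s2 *\<^sub>R w + r2 *\<^sub>R u"]
      by (simp add: dist_real_def)
  qed
  show ?thesis
  proof (rule ccontr)
    assume "\<not> ?thesis"
    then show False
      using close[of "\<bar>?f2 u w x - ?f2 w u x\<bar> / 2"] by simp
  qed
qed

section \<open>Integration against bump functions\<close>

lemma integrable_compact_support:
  fixes f :: "'a::euclidean_space \<Rightarrow> real"
  assumes "continuous_on (cball a r) f" "\<And>x. x \<notin> cball a r \<Longrightarrow> f x = 0"
  shows "integrable lborel f"
proof -
  have "(\<lambda>x. indicator (cball a r) x *\<^sub>R f x) = f"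
    using assms(2) by (fastforce simp: indicator_def)
  then show ?thesis
    using borel_integrable_compact[OF compact_cball assms(1)] by simp
qed

lemma integral_translate:
  fixes f :: "'a::euclidean_space \<Rightarrow> real"
  assumes "f \<in> borel_measurable borel"
  shows "(\<integral>x. f (x + c) \<partial>lborel) = (\<integral>x. f x \<partial>lborel)"
proof -
  have "(\<integral>x. f x \<partial>lborel) = (\<integral>x. f x \<partial>distr lborel borel ((+) c))"
    by (simp add: lborel_distr_plus)
  also have "\<dots> = (\<integral>x. f (c + x) \<partial>lborel)"
    by (rule integral_distr) (use assms in auto)
  finally show ?thesis by (simp add: add.commute)
qed

text \<open>The integral of \<open>x \<mapsto> \<psi> (x + s e)\<close> does not depend on \<open>s\<close>, so the difference quotients of
  \<open>\<psi>\<close> in direction \<open>e\<close> integrate to zero; so does their limit, by dominated convergence.\<close>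

lemma integral_derivative_eq_0:
  fixes \<psi> :: "'a::euclidean_space \<Rightarrow> real"
  assumes der: "\<And>x. (\<psi> has_derivative \<psi>' x) (at x)"
    and cont: "continuous_on UNIV (\<lambda>x. \<psi>' x e)"
    and supp: "\<And>x. x \<notin> cball a r \<Longrightarrow> \<psi> x = 0"
  shows "(\<integral>x. \<psi>' x e \<partial>lborel) = 0"
proof -
  have supp': "\<psi>' x e = 0" if "x \<notin> cball a r" for x
  proof -
    have "((\<lambda>x. 0) has_derivative \<psi>' x) (at x)"
    proof (rule has_derivative_transform_within_open[OF der])
      show "open (- cball a r)" "x \<in> - cball a r" using that by (auto simp: open_Compl)
    qed (use supp in auto)
    from has_derivative_unique[OF this has_derivative_const] show ?thesis by simp
  qed
  have cont\<psi>: "continuous_on UNIV \<psi>"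
    using der by (meson continuous_at_imp_continuous_on has_derivative_continuous)
  then have [measurable]: "\<psi> \<in> borel_measurable borel"
    by (rule borel_measurable_continuous_onI)
  have [measurable]: "(\<lambda>x. \<psi>' x e) \<in> borel_measurable borel"
    using cont by (rule borel_measurable_continuous_onI)
  have "bounded ((\<lambda>x. \<psi>' x e) ` cball a r)"
    by (intro compact_imp_bounded compact_continuous_image continuous_on_subset[OF cont]) auto
  then obtain C where C: "0 < C" "\<And>x. x \<in> cball a r \<Longrightarrow> norm (\<psi>' x e) \<le> C"
    by (auto simp: bounded_pos)
  have C': "\<bar>\<psi>' x e\<bar> \<le> C" for x
    using C supp'[of x] by (cases "x \<in> cball a r") auto
  define h where "h n = 1 / real (Suc n)" for n
  have h: "0 < h n" "h n \<le> 1" for n by (auto simp: h_def)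
  have h0: "h \<longlonglongrightarrow> 0" unfolding h_def by (rule LIMSEQ_Suc[OF lim_1_over_n])
  define q where "q n x = (\<psi> (x + h n *\<^sub>R e) - \<psi> x) / h n" for n x
  have [measurable]: "q n \<in> borel_measurable borel" for n unfolding q_def by measurable
  let ?R = "r + norm e"
  have lim: "(\<lambda>n. \<integral>x. q n x \<partial>lborel) \<longlonglongrightarrow> (\<integral>x. \<psi>' x e \<partial>lborel)"
  proof (rule integral_dominated_convergence[where w = "\<lambda>x. C * indicator (cball a ?R) x"])
    show "integrable lborel (\<lambda>x. C * indicator (cball a ?R) x)"
      using emeasure_lborel_cball_finite[of a ?R]
      by (intro integrable_mult_right integrable_real_indicator) auto
    show "AE x in lborel. (\<lambda>n. q n x) \<longlonglongrightarrow> \<psi>' x e"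
    proof (rule AE_I2)
      fix x
      have "((\<lambda>s. \<psi> (x + s *\<^sub>R e)) has_real_derivative \<psi>' x e) (at 0)"
        by (rule has_real_derivative_along_line) (use der in simp)
      then have "(\<lambda>s. (\<psi> (x + s *\<^sub>R e) - \<psi> x) / s) \<midarrow>0\<rightarrow> \<psi>' x e"
        by (simp add: DERIV_def)
      moreover have "filterlim h (at 0) sequentially"
      proof -
        have "h n \<noteq> 0" for n using h(1)[of n] by simp
        then show ?thesis using h0 by (simp add: filterlim_at)
      qed
      ultimately show "(\<lambda>n. q n x) \<longlonglongrightarrow> \<psi>' x e"
        unfolding q_def by (rule filterlim_compose)
    qed
    show "AE x in lborel. norm (q n x) \<le> C * indicator (cball a ?R) x" for n
    proof (rule AE_I2)
      fix x
      show "norm (q n x) \<le> C * indicator (cball a ?R) x"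
      proof (cases "x \<in> cball a ?R")
        case True
        have along: "((\<lambda>s. \<psi> (x + s *\<^sub>R e)) has_real_derivative \<psi>' (x + s *\<^sub>R e) e) (at s)" for s
          by (rule has_real_derivative_along_line[OF der])
        obtain s where "\<psi> (x + h n *\<^sub>R e) - \<psi> (x + 0 *\<^sub>R e) = (h n - 0) * \<psi>' (x + s *\<^sub>R e) e"
          using MVT2[OF h(1)[of n] along] by blast
        then have "q n x = \<psi>' (x + s *\<^sub>R e) e" using h(1)[of n] by (simp add: q_def)
        then show ?thesis using True C' by simp
      next
        case False
        have "dist a x \<le> dist a (x + h n *\<^sub>R e) + norm (h n *\<^sub>R e)"
          by (metis dist_triangle add_diff_cancel_left' dist_norm)
        moreover have "norm (h n *\<^sub>R e) \<le> norm e"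
          using h[of n] by (simp add: mult_left_le_one_le)
        ultimately have "x + h n *\<^sub>R e \<notin> cball a r" "x \<notin> cball a r"
          using False norm_ge_zero[of e] by (auto simp: not_le simp del: norm_ge_zero)
        then show ?thesis using False supp by (simp add: q_def)
      qed
    qed
  qed auto
  have int: "integrable lborel \<psi>"
    by (rule integrable_compact_support[OF continuous_on_subset[OF cont\<psi>]]) (use supp in auto)
  have int': "integrable lborel (\<lambda>x. \<psi> (x + h n *\<^sub>R e))" for n
  proof (rule integrable_compact_support[where a = a and r = ?R])
    show "continuous_on (cball a ?R) (\<lambda>x. \<psi> (x + h n *\<^sub>R e))"
      by (intro continuous_on_compose2[OF cont\<psi>] continuous_intros) auto
    fix x assume "x \<notin> cball a ?R"
    moreover have "dist a x \<le> dist a (x + h n *\<^sub>R e) + norm (h n *\<^sub>R e)"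
      by (metis dist_triangle add_diff_cancel_left' dist_norm)
    moreover have "norm (h n *\<^sub>R e) \<le> norm e"
      using h[of n] by (simp add: mult_left_le_one_le)
    ultimately show "\<psi> (x + h n *\<^sub>R e) = 0" by (intro supp) auto
  qed
  have "(\<integral>x. q n x \<partial>lborel) = 0" for n
    unfolding q_def using int int'[of n] integral_translate[of \<psi> "h n *\<^sub>R e"] by simp
  with lim show ?thesis by (simp add: LIMSEQ_const_iff)
qed

text \<open>Balls are not Lebesgue null sets.\<close>

lemma AE_lborel_ball_nonempty:
  fixes a :: "'a::euclidean_space"
  assumes "AE x in lborel. P x" "0 < r"
  obtains x where "x \<in> ball a r" "P x"
proof -
  have "\<exists>x\<in>ball a r. P x"
  proof (rule ccontr)
    assume none: "\<not> (\<exists>x\<in>ball a r. P x)"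
    have "AE x in lborel. x \<notin> ball a r"
      using assms(1) by (rule eventually_mono) (use none in blast)
    moreover have "{x \<in> space lborel. \<not> x \<notin> ball a r} = ball a r" by auto
    ultimately have "emeasure lborel (ball a r) = 0"
      using AE_iff_measurable[of "ball a r" lborel "\<lambda>x. x \<notin> ball a r"] by simp
    then show False using content_ball_pos[OF \<open>0 < r\<close>, of a] by (simp add: measure_def)
  qed
  then show ?thesis using that by blast
qed

lemma continuous_AE_eq_0:
  fixes f :: "'a::euclidean_space \<Rightarrow> 'b::real_normed_vector"
  assumes "open S" "continuous_on S f" "AE x in lborel. x \<in> S \<longrightarrow> f x = 0" "a \<in> S"
  shows "f a = 0"
proof (rule ccontr)
  assume "f a \<noteq> 0"
  have "open (S \<inter> f -` (- {0}))"
    using assms by (intro continuous_open_preimage) auto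
  moreover have "a \<in> S \<inter> f -` (- {0})" using \<open>a \<in> S\<close> \<open>f a \<noteq> 0\<close> by simp
  ultimately obtain r where "0 < r" "ball a r \<subseteq> S \<inter> f -` (- {0})"
    by (rule openE)
  moreover obtain x where "x \<in> ball a r" "x \<in> S \<longrightarrow> f x = 0"
    by (rule AE_lborel_ball_nonempty[OF assms(3) \<open>0 < r\<close>])
  ultimately show False by blast
qed

text \<open>A continuously differentiable test function is enough below; the square makes this one
  differentiable across the boundary of the ball.\<close>

definition bump :: "'a::euclidean_space \<Rightarrow> real \<Rightarrow> 'a \<Rightarrow> real" where
  "bump a r x = (max 0 (r\<^sup>2 - (x - a) \<bullet> (x - a)))\<^sup>2"

text \<open>The derivative of \<open>bump a r\<close> at \<open>x\<close> in direction \<open>h\<close>.\<close>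

definition bump' :: "'a::euclidean_space \<Rightarrow> real \<Rightarrow> 'a \<Rightarrow> 'a \<Rightarrow> real" where
  "bump' a r x h = - 4 * max 0 (r\<^sup>2 - (x - a) \<bullet> (x - a)) * ((x - a) \<bullet> h)"

lemma has_real_derivative_max0_square:
  "((\<lambda>s::real. (max 0 s)\<^sup>2) has_real_derivative 2 * max 0 s) (at s)"
proof (cases "s = 0")
  case True
  have "(\<lambda>h::real. (max 0 h)\<^sup>2 / h) \<midarrow>0\<rightarrow> 0"
  proof (rule Lim_null_comparison[where g = "\<lambda>h. \<bar>h\<bar>"])
    show "\<forall>\<^sub>F h in at 0. norm ((max 0 h)\<^sup>2 / h) \<le> \<bar>h::real\<bar>"
      by (rule always_eventually) (auto simp: max_def power2_eq_square abs_mult)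
    show "(\<lambda>h::real. \<bar>h\<bar>) \<midarrow>0\<rightarrow> 0" by (rule tendsto_rabs_zero) (rule tendsto_ident_at)
  qed
  then show ?thesis using True by (simp add: DERIV_def)
next
  case False
  show ?thesis
  proof (cases "0 < s")
    case True
    have "((\<lambda>s::real. s\<^sup>2) has_real_derivative 2 * max 0 s) (at s)"
      using True by (auto intro!: derivative_eq_intros)
    then show ?thesis
      by (rule has_field_derivative_transform_within_open[of _ _ _ "{0<..}"]) (use True in auto)
  next
    case False
    with \<open>s \<noteq> 0\<close> have "s < 0" by simp
    have "((\<lambda>s::real. 0) has_real_derivative 2 * max 0 s) (at s)"
      using \<open>s < 0\<close> by (auto intro!: derivative_eq_intros)
    then show ?thesis
      by (rule has_field_derivative_transform_within_open[of _ _ _ "{..<0}"]) (use \<open>s < 0\<close> in auto)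
  qed
qed

lemma bump_has_derivative: "(bump a r has_derivative bump' a r x) (at x)"
proof -
  let ?s = "r\<^sup>2 - (x - a) \<bullet> (x - a)"
  have 1: "((\<lambda>x. r\<^sup>2 - (x - a) \<bullet> (x - a)) has_derivative (\<lambda>h. - 2 * ((x - a) \<bullet> h))) (at x)"
    by (auto intro!: derivative_eq_intros simp: inner_commute)
  have 2: "((\<lambda>s. (max 0 s)\<^sup>2) has_derivative (\<lambda>h. 2 * max 0 ?s * h)) (at ?s)"
    using has_real_derivative_max0_square[of ?s] by (simp add: has_field_derivative_def)
  from diff_chain_at[OF 1 2] show ?thesis
    by (simp add: o_def bump_def[abs_def] bump'_def[abs_def] mult_ac)
qed

lemma continuous_on_bump [continuous_intros]: "continuous_on S (bump a r)"
  unfolding bump_def by (intro continuous_intros)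

lemma continuous_on_bump' [continuous_intros]:
  "continuous_on S f \<Longrightarrow> continuous_on S g \<Longrightarrow> continuous_on S (\<lambda>x. bump' a r (f x) (g x))"
  unfolding bump'_def by (intro continuous_intros)

lemma bump_nonneg: "0 \<le> bump a r x" by (simp add: bump_def)

lemma bump_pos: "x \<in> ball a r \<Longrightarrow> 0 < bump a r x"
proof -
  assume "x \<in> ball a r"
  then have "norm (x - a) < r" by (simp add: dist_norm norm_minus_commute)
  then have "(norm (x - a))\<^sup>2 < r\<^sup>2" by (intro power_strict_mono) auto
  then show ?thesis by (simp add: bump_def power2_norm_eq_inner)
qed

lemma bump_outside: "0 < r \<Longrightarrow> x \<notin> ball a r \<Longrightarrow> bump a r x = 0 \<and> bump' a r x h = 0"
proof -
  assume "0 < r" "x \<notin> ball a r"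
  then have "r\<^sup>2 \<le> (norm (x - a))\<^sup>2"
    by (intro power_mono) (auto simp: dist_norm norm_minus_commute)
  then show ?thesis by (simp add: bump_def bump'_def power2_norm_eq_inner max_def)
qed

text \<open>The fundamental lemma of the calculus of variations at a single point. For \<open>E a \<noteq> 0\<close> the product
  \<open>E a * E x\<close> is positive near \<open>a\<close>, so a bump function of small support detects it.\<close>

lemma eq_0_if_bump_integrals_eq_0:
  fixes E :: "'a::euclidean_space \<Rightarrow> real"
  assumes "open S" "continuous_on S E" "a \<in> S"
    and zero: "\<And>r. 0 < r \<Longrightarrow> cball a r \<subseteq> S \<Longrightarrow> (\<integral>x. bump a r x * E x \<partial>lborel) = 0"
  shows "E a = 0"
proof (rule ccontr)
  assume "E a \<noteq> 0"
  have "open (S \<inter> (\<lambda>x. E a * E x) -` {0<..})"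
    using assms by (intro continuous_open_preimage continuous_intros) auto
  moreover have "a \<in> S \<inter> (\<lambda>x. E a * E x) -` {0<..}"
    using \<open>E a \<noteq> 0\<close> \<open>a \<in> S\<close> by (auto simp: zero_less_mult_iff)
  ultimately obtain r where r: "0 < r" "cball a r \<subseteq> S \<inter> (\<lambda>x. E a * E x) -` {0<..}"
    using open_contains_cball_eq by blast
  let ?f = "\<lambda>x. bump a r x * E x * E a"
  have out: "bump a r x = 0" if "x \<notin> cball a r" for x
    using bump_outside[OF \<open>0 < r\<close>, of x a] that by auto
  have int: "integrable lborel ?f"
    by (rule integrable_compact_support[of a r])
       (use out r assms(2) in \<open>auto intro!: continuous_intros elim: continuous_on_subset\<close>)
  have "0 \<le> ?f x" for x
    using r(2) out[of x] bump_nonneg[of a r x] mult_nonneg_nonneg[of "bump a r x" "E a * E x"]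
    by (cases "x \<in> cball a r") (auto simp: mult_ac subset_iff less_imp_le)
  moreover have "(\<integral>x. ?f x \<partial>lborel) = 0" using zero r by auto
  ultimately have "AE x in lborel. ?f x = 0"
    using integral_nonneg_eq_0_iff_AE[OF int] by simp
  from AE_lborel_ball_nonempty[OF this \<open>0 < r\<close>, of a] obtain x where "x \<in> ball a r" "?f x = 0" .
  moreover have "0 < E a * E x" using r(2) \<open>x \<in> ball a r\<close> by (auto simp: subset_iff)
  ultimately show False using bump_pos[of x a r] by auto
qed


(* The recursion equation stays folded: Ck_on_SucI and Ck_on_SucD are used instead. *)
declare Ck_on.simps(2) [simp del]

section \<open>Partial derivatives and Hessians\<close>

lemma has_derivative_vecI:
  fixes f :: "'a::real_normed_vector \<Rightarrow> real^'d::finite"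
  assumes "\<And>i. ((\<lambda>x. f x $ i) has_derivative (\<lambda>h. f' h $ i)) (at x within S)"
  shows "(f has_derivative f') (at x within S)"
proof (rule has_derivative_componentwise_within[THEN iffD2], rule ballI)
  fix b :: "real^'d" assume "b \<in> Basis"
  then obtain i where "b = axis i 1" by (auto simp: Basis_vec_def)
  then show "((\<lambda>x. f x \<bullet> b) has_derivative (\<lambda>h. f' h \<bullet> b)) (at x within S)"
    using assms[of i] by (simp add: inner_axis)
qed

lemma has_derivative_eq_pd:
  fixes f :: "real^'d::finite \<Rightarrow> real"
  assumes "(f has_derivative f') (at x)"
  shows "pd i f x = f' (axis i 1)" "f' h = (\<Sum>i\<in>UNIV. h $ i * pd i f x)" "f' h = D f x \<bullet> h"
proof -
  show pd: "pd i f x = f' (axis i 1)" for i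
    using frechet_derivative_at[OF assms] by (simp add: pd_def)
  note lin = has_derivative_linear[OF assms]
  have "f' h = f' (\<Sum>i\<in>UNIV. (h $ i) *\<^sub>R axis i 1)"
    using basis_expansion[of h] by (simp add: scalar_mult_eq_scaleR)
  also have "\<dots> = (\<Sum>i\<in>UNIV. h $ i * f' (axis i 1))"
    by (simp add: linear_sum[OF lin] linear_scale[OF lin])
  finally show h: "f' h = (\<Sum>i\<in>UNIV. h $ i * pd i f x)" by (simp add: pd)
  then show "f' h = D f x \<bullet> h" by (simp add: D_def inner_vec_def mult.commute)
qed

lemma Ck_on_pd: "Ck_on (Suc k) S f \<Longrightarrow> Ck_on k S (pd i f)"
  using Ck_on_SucD(2)[of k S f "axis i 1"] by (simp add: pd_def[abs_def])

lemma smooth_on_Ck: "smooth_on S f \<Longrightarrow> Ck_on k S f"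
  by (simp add: smooth_on_def)

lemma smooth_on_pd: "smooth_on S f \<Longrightarrow> smooth_on S (pd i f)"
  using Ck_on_pd[of _ S f i] by (simp add: smooth_on_def)

lemma smooth_on_has_derivative:
  assumes "smooth_on S f" "x \<in> S"
  shows "(f has_derivative frechet_derivative f (at x)) (at x)"
  using Ck_on_SucD(1)[OF smooth_on_Ck[OF assms(1)] assms(2)] .

lemma smooth_on_continuous: "smooth_on S f \<Longrightarrow> continuous_on S f"
  using Ck_on_continuous smooth_on_Ck by blast

lemma smooth_on_mult:
  fixes f g :: "'a::euclidean_space \<Rightarrow> real"
  shows "smooth_on S f \<Longrightarrow> smooth_on S g \<Longrightarrow> smooth_on S (\<lambda>x. f x * g x)"
  by (simp add: smooth_on_def Ck_on_mult)

lemma smooth_on_sum: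
  "open S \<Longrightarrow> (\<And>i. i \<in> I \<Longrightarrow> smooth_on S (f i)) \<Longrightarrow> smooth_on S (\<lambda>x. \<Sum>i\<in>I. f i x)"
  by (simp add: smooth_on_def Ck_on_sum)

lemma smooth_on_powr:
  fixes f :: "'a::euclidean_space \<Rightarrow> real"
  shows "smooth_on S f \<Longrightarrow> (\<And>x. x \<in> S \<Longrightarrow> 0 < f x) \<Longrightarrow> smooth_on S (\<lambda>x. f x powr a)"
  by (simp add: smooth_on_def Ck_on_powr)

lemma smooth_on_linear:
  "smooth_on S f \<Longrightarrow> bounded_linear L \<Longrightarrow> smooth_on S (\<lambda>x. L (f x))"
  by (simp add: smooth_on_def Ck_on_linear)

lemma smooth_on_nth:
  fixes f :: "'a::euclidean_space \<Rightarrow> real^'d::finite"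
  shows "smooth_on S f \<Longrightarrow> smooth_on S (\<lambda>x. f x $ i)"
  by (rule smooth_on_linear) auto

lemma smooth_on_cong:
  "smooth_on S f \<Longrightarrow> (\<And>x. x \<in> S \<Longrightarrow> f x = g x) \<Longrightarrow> smooth_on S g"
  unfolding smooth_on_def using Ck_on_cong[of S f g] by blast

lemma smooth_on_slice:
  fixes G :: "real \<times> 'a::euclidean_space \<Rightarrow> 'b::real_normed_vector"
  assumes "open S" "{t} \<times> S \<subseteq> U" "smooth_on U G"
  shows "smooth_on S (\<lambda>x. G (t, x))"
  using Ck_on_slice[OF assms(1,2)] assms by (auto simp: smooth_on_def)

lemma continuous_on_det:
  fixes A :: "'a::topological_space \<Rightarrow> real^'d^'d::finite"
  assumes "\<And>i j. continuous_on S (\<lambda>x. A x $ i $ j)"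
  shows "continuous_on S (\<lambda>x. det (A x))"
  unfolding det_def by (intro continuous_intros assms)

lemma smooth_on_det:
  fixes A :: "'a::euclidean_space \<Rightarrow> real^'d^'d::finite"
  assumes "open S" "\<And>i j. smooth_on S (\<lambda>x. A x $ i $ j)"
  shows "smooth_on S (\<lambda>x. det (A x))"
proof -
  have "Ck_on k S (\<lambda>x. A x $ i $ j)" for k i j by (rule smooth_on_Ck[OF assms(2)])
  then show ?thesis
    unfolding det_def smooth_on_def
    by (intro conjI allI assms(1) Ck_on_sum Ck_on_mult Ck_on_const Ck_on_prod)
qed

text \<open>The segment from the identity matrix to \<open>A\<close> consists of positive definite, hence
  nonsingular, matrices, so the determinant does not change sign along it.\<close>

lemma det_pos_if_pos_def:
  fixes A :: "real^'d^'d::finite"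
  assumes pos: "\<And>u. u \<noteq> 0 \<Longrightarrow> 0 < u \<bullet> (A *v u)"
  shows "0 < det A"
proof (rule ccontr)
  assume "\<not> 0 < det A"
  define B where "B s = (1 - s) *\<^sub>R mat 1 + s *\<^sub>R A" for s :: real
  have cont: "continuous_on {0..1} (\<lambda>s. det (B s))"
    unfolding B_def by (rule continuous_on_det) (auto intro!: continuous_intros)
  have "det (B 1) \<le> 0" "0 \<le> det (B 0)" using \<open>\<not> 0 < det A\<close> by (auto simp: B_def)
  then obtain s where s: "0 \<le> s" "s \<le> 1" "det (B s) = 0"
    using IVT2'[of "\<lambda>s. det (B s)" 1 0 0] cont by auto
  have Bv: "B s *v u = (1 - s) *\<^sub>R u + s *\<^sub>R (A *v u)" for u
    by (simp add: B_def matrix_vector_mult_add_rdistrib scaleR_matrix_vector_assoc[symmetric])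
  have "B s *v u = 0 \<Longrightarrow> u = 0" for u
  proof (rule ccontr)
    assume "B s *v u = 0" "u \<noteq> 0"
    then have "0 = (1 - s) * (u \<bullet> u) + s * (u \<bullet> (A *v u))"
      using Bv[of u] by (metis inner_add_right inner_scaleR_right inner_zero_right)
    moreover have "0 < u \<bullet> u" "0 < u \<bullet> (A *v u)" using \<open>u \<noteq> 0\<close> pos by auto
    ultimately show False
      using s mult_nonneg_nonneg[of "1 - s" "u \<bullet> u"] mult_nonneg_nonneg[of s "u \<bullet> (A *v u)"]
      by (cases "s = 0") (auto simp: add_nonneg_eq_0_iff)
  qed
  then have "invertible (B s)"
    by (simp add: invertible_left_inverse matrix_left_invertible_ker)
  then show False using s(3) by (simp add: invertible_det_nz)
qed

lemma matrix_inv_mult: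
  fixes A :: "real^'d^'d::finite"
  assumes "invertible A"
  shows "A *v (matrix_inv A *v u) = u" "matrix_inv A *v (A *v u) = u"
proof -
  have "A ** matrix_inv A = mat 1 \<and> matrix_inv A ** A = mat 1"
    using assms unfolding invertible_def matrix_inv_def by (rule someI_ex)
  then show "A *v (matrix_inv A *v u) = u" "matrix_inv A *v (A *v u) = u"
    by (simp_all add: matrix_vector_mul_assoc)
qed


section \<open>The Legendre transform and the charts of a Bregman manifold\<close>

context bregman_manifold
begin

lemma D2_nth: "D2 \<Omega> x $ i $ j = pd i (pd j \<Omega>) x"
  by (simp add: D2_def)

lemma D2_smooth: "smooth_on X (\<lambda>x. D2 \<Omega> x $ i $ j)"
  unfolding D2_nth using smooth_Omega by (intro smooth_on_pd)

text \<open>By definition \<open>D2 \<Omega> x\<close> is an array of iterated partial derivatives. Its symmetry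
  makes it the derivative of \<open>D \<Omega>\<close> and makes the metric a symmetric form.\<close>

lemma D2_sym: "x \<in> X \<Longrightarrow> D2 \<Omega> x $ i $ j = D2 \<Omega> x $ j $ i"
  using second_derivative_symmetric[OF smooth_on_Ck[OF smooth_Omega] open_X]
  by (simp add: D2_def pd_def[abs_def])

lemma D2_self_adjoint: "x \<in> X \<Longrightarrow> u \<bullet> (D2 \<Omega> x *v w) = w \<bullet> (D2 \<Omega> x *v u)"
proof -
  assume x: "x \<in> X"
  have "u \<bullet> (D2 \<Omega> x *v w) = (\<Sum>i\<in>UNIV. \<Sum>j\<in>UNIV. u $ i * (D2 \<Omega> x $ i $ j * w $ j))"
    by (simp add: inner_vec_def matrix_vector_mult_def sum_distrib_left)
  also have "\<dots> = (\<Sum>j\<in>UNIV. \<Sum>i\<in>UNIV. u $ i * (D2 \<Omega> x $ i $ j * w $ j))"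
    by (rule sum.swap)
  also have "\<dots> = w \<bullet> (D2 \<Omega> x *v u)"
    using D2_sym[OF x]
    by (simp add: inner_vec_def matrix_vector_mult_def sum_distrib_left mult_ac)
  finally show ?thesis .
qed

lemma D2_invertible: "x \<in> X \<Longrightarrow> invertible (D2 \<Omega> x)"
  using det_pos_if_pos_def[OF hessian_pos_def, of x] by (simp add: invertible_det_nz)

lemmas D2_inv = matrix_inv_mult[OF D2_invertible]

lemma D_has_derivative: "x \<in> X \<Longrightarrow> (D \<Omega> has_derivative (\<lambda>h. D2 \<Omega> x *v h)) (at x)"
proof (rule has_derivative_vecI)
  fix i assume x: "x \<in> X"
  note d = smooth_on_has_derivative[OF smooth_on_pd[OF smooth_Omega] x, of i]
  have "frechet_derivative (pd i \<Omega>) (at x) = (\<lambda>h. (D2 \<Omega> x *v h) $ i)"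
    using D2_sym[OF x, of i] has_derivative_eq_pd(2)[OF d]
    by (simp add: fun_eq_iff matrix_vector_mult_def D2_nth mult.commute)
  with d show "((\<lambda>x. D \<Omega> x $ i) has_derivative (\<lambda>h. (D2 \<Omega> x *v h) $ i)) (at x)"
    by (simp add: D_def)
qed

lemma continuous_on_D: "continuous_on X (D \<Omega>)"
  using D_has_derivative by (meson continuous_at_imp_continuous_on has_derivative_continuous)

text \<open>\<open>D \<Omega>\<close> is strictly monotone along segments, by positivity of the Hessian.\<close>

lemma inj_on_D: "inj_on (D \<Omega>) X"
proof (rule inj_onI, rule ccontr)
  fix x y assume x: "x \<in> X" and y: "y \<in> X" and eq: "D \<Omega> x = D \<Omega> y" and "x \<noteq> y"
  define u where "u = y - x"
  have "u \<noteq> 0" using \<open>x \<noteq> y\<close> by (simp add: u_def)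
  have X: "x + s *\<^sub>R u \<in> X" if "0 \<le> s" "s \<le> 1" for s
    using convexD_alt[OF convex_X x y that] by (simp add: u_def algebra_simps)
  have "((\<lambda>s. u \<bullet> D \<Omega> (x + s *\<^sub>R u)) has_real_derivative u \<bullet> (D2 \<Omega> (x + s *\<^sub>R u) *v u)) (at s)"
    if "0 \<le> s" "s \<le> 1" for s
    by (rule has_real_derivative_along_line)
       (intro has_derivative_inner_right D_has_derivative X that)
  then have "\<exists>s>0. s < 1 \<and> u \<bullet> D \<Omega> (x + 1 *\<^sub>R u) - u \<bullet> D \<Omega> (x + 0 *\<^sub>R u) =
      (1 - 0) * (u \<bullet> (D2 \<Omega> (x + s *\<^sub>R u) *v u))"
    by (intro MVT2) auto
  then obtain s where "0 < s" "s < 1"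
    "u \<bullet> D \<Omega> (x + 1 *\<^sub>R u) - u \<bullet> D \<Omega> (x + 0 *\<^sub>R u) = (1 - 0) * (u \<bullet> (D2 \<Omega> (x + s *\<^sub>R u) *v u))"
    by auto
  moreover have "u \<bullet> D \<Omega> (x + 1 *\<^sub>R u) = u \<bullet> D \<Omega> (x + 0 *\<^sub>R u)"
    using eq by (simp add: u_def)
  ultimately show False
    using hessian_pos_def[OF X[of s] \<open>u \<noteq> 0\<close>] by simp
qed

abbreviation (input) Y where "Y \<equiv> D \<Omega> ` X"

definition D_inv where "D_inv = inv_into X (D \<Omega>)"

lemma D_inv_D [simp]: "x \<in> X \<Longrightarrow> D_inv (D \<Omega> x) = x"
  by (simp add: D_inv_def inv_into_f_f[OF inj_on_D])

lemma D_inv_in: "y \<in> Y \<Longrightarrow> D_inv y \<in> X" and D_D_inv [simp]: "y \<in> Y \<Longrightarrow> D \<Omega> (D_inv y) = y"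
  by auto

lemma open_Y: "open Y"
  by (rule invariance_of_domain[OF continuous_on_D open_X inj_on_D])

lemma continuous_on_D_inv: "continuous_on Y D_inv"
  by (rule continuous_on_inverse_open[OF open_X continuous_on_D]) auto

text \<open>Since \<open>D_inv\<close> is a left inverse of the continuous map \<open>D \<Omega>\<close> on all of \<open>X\<close>, invertibility of the Hessian
  at the single point \<open>x\<close> is enough for the inverse function theorem.\<close>

lemma D_inv_has_derivative:
  assumes "x \<in> X"
  shows "(D_inv has_derivative (\<lambda>h. matrix_inv (D2 \<Omega> x) *v h)) (at (D \<Omega> x))"
  by (rule has_derivative_inverse_strong[OF open_X assms continuous_on_D D_inv_D D_has_derivative])
     (use D2_inv[OF assms] assms in \<open>auto simp: fun_eq_iff\<close>)

text \<open>Differentiating \<open>D_inv y \<bullet> y - \<Omega> (D_inv y)\<close>, the two terms with a derivative of \<open>D_inv\<close> cancel, since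
  \<open>D \<Omega> (D_inv y) = y\<close>.\<close>

lemma D_conjugate:
  assumes "y \<in> Y"
  shows "D (conjugate X \<Omega>) y = D_inv y"
proof -
  obtain x where x: "x \<in> X" "y = D \<Omega> x" using assms by auto
  let ?g' = "\<lambda>h. matrix_inv (D2 \<Omega> x) *v h"
  have g': "(D_inv has_derivative ?g') (at y)" using D_inv_has_derivative[OF x(1)] by (simp add: x)
  note d = smooth_on_has_derivative[OF smooth_Omega x(1)]
  have "frechet_derivative \<Omega> (at x) = (\<lambda>h. D \<Omega> x \<bullet> h)"
    using has_derivative_eq_pd(3)[OF d] by (rule ext)
  with d have \<Omega>': "(\<Omega> has_derivative (\<lambda>h. D \<Omega> x \<bullet> h)) (at (D_inv y))"
    by (simp add: x)
  have "((\<lambda>y. D_inv y \<bullet> y) has_derivative (\<lambda>h. D_inv y \<bullet> h + ?g' h \<bullet> y)) (at y)"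
    by (rule has_derivative_inner[OF g' has_derivative_ident])
  moreover have "((\<lambda>y. \<Omega> (D_inv y)) has_derivative (\<lambda>h. D \<Omega> x \<bullet> ?g' h)) (at y)"
    using diff_chain_at[OF g' \<Omega>'] by (simp add: o_def)
  ultimately have "((\<lambda>y. D_inv y \<bullet> y - \<Omega> (D_inv y)) has_derivative
      (\<lambda>h. D_inv y \<bullet> h + ?g' h \<bullet> y - D \<Omega> x \<bullet> ?g' h)) (at y)"
    by (rule has_derivative_diff)
  moreover have "(\<lambda>y. D_inv y \<bullet> y - \<Omega> (D_inv y)) = conjugate X \<Omega>"
    by (simp add: conjugate_def D_inv_def Let_def fun_eq_iff)
  ultimately have "(conjugate X \<Omega> has_derivative (\<lambda>h. D_inv y \<bullet> h)) (at y)"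
    by (simp add: x inner_commute)
  from has_derivative_eq_pd(1)[OF this] show ?thesis
    by (simp add: D_def vec_eq_iff inner_axis)
qed

text \<open>The density of the Riemannian volume with respect to Lebesgue measure in the \<open>x\<close>-chart.\<close>

definition J where "J x = sqrt (det (D2 \<Omega> x))"

lemma J_pos: "x \<in> X \<Longrightarrow> 0 < J x"
  using det_pos_if_pos_def[OF hessian_pos_def, of x] by (simp add: J_def)

text \<open>The powers \<open>1\<close> and \<open>- 1\<close> both occur in the divergence.\<close>

lemma smooth_on_J_powr: "smooth_on X (\<lambda>x. J x powr a)"
proof -
  have det: "smooth_on X (\<lambda>x. det (D2 \<Omega> x))" by (rule smooth_on_det[OF open_X D2_smooth])
  have pos: "0 < det (D2 \<Omega> x)" if "x \<in> X" for x
    using det_pos_if_pos_def[OF hessian_pos_def[OF that]] .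
  have "smooth_on X J"
    by (rule smooth_on_cong[OF smooth_on_powr[OF det pos, of "1 / 2"]])
       (auto simp: J_def intro!: powr_half_sqrt less_imp_le pos)
  then show ?thesis using J_pos by (rule smooth_on_powr)
qed

lemma smooth_on_J: "smooth_on X J"
  by (rule smooth_on_cong[OF smooth_on_J_powr[of 1]]) (use J_pos in \<open>simp add: powr_one less_imp_le\<close>)

lemma
  shows \<iota>_in [simp]: "\<iota> p \<in> X" and inv_\<iota> [simp]: "inv \<iota> (\<iota> p) = p"
    and \<iota>_inv [simp]: "x \<in> X \<Longrightarrow> \<iota> (inv \<iota> x) = x"
    and continuous_on_\<iota>: "continuous_on UNIV \<iota>" and continuous_on_inv_\<iota>: "continuous_on X (inv \<iota>)"
  using chart by (auto simp: homeomorphism_def)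

lemma continuous_on_comp_\<iota>: "continuous_on X f \<Longrightarrow> continuous_on UNIV (\<lambda>p. f (\<iota> p))"
  using continuous_on_compose2[OF _ continuous_on_\<iota>, of X f] by (simp add: image_subset_iff)

lemma inv_dual_chart: "y \<in> Y \<Longrightarrow> inv (dual_chart \<Omega> \<iota>) y = inv \<iota> (D_inv y)"
proof -
  assume y: "y \<in> Y"
  have "inj (dual_chart \<Omega> \<iota>)"
    unfolding dual_chart_def
    by (rule inj_on_inverseI[of _ "\<lambda>y. inv \<iota> (D_inv y)"]) simp
  moreover have "dual_chart \<Omega> \<iota> (inv \<iota> (D_inv y)) = y"
    using y by (simp add: dual_chart_def D_inv_in)
  ultimately show ?thesis by (metis inv_f_f)
qed

lemma dual_chart_in: "dual_chart \<Omega> \<iota> p \<in> Y" and D_inv_dual_chart: "D_inv (dual_chart \<Omega> \<iota> p) = \<iota> p"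
  by (simp_all add: dual_chart_def)

lemma continuous_on_dual_chart: "continuous_on UNIV (dual_chart \<Omega> \<iota>)"
  unfolding dual_chart_def o_def by (rule continuous_on_comp_\<iota>[OF continuous_on_D])

end


context bregman_manifold
begin

section \<open>Riemannian volume and square integrable fields\<close>

lemma sets_vol [measurable_cong]: "sets (vol X \<Omega> \<iota>) = sets borel"
  and space_vol [simp]: "space (vol X \<Omega> \<iota>) = UNIV"
  by (simp_all add: vol_def)

lemma X_borel [measurable]: "X \<in> sets borel"
  using open_X by simp

lemma sets_restrict_X: "sets (restrict_space lborel X) = sets (restrict_space borel X)"
  by (simp add: sets_restrict_space)

lemma measurable_continuous_on_X:
  fixes f :: "real^'d \<Rightarrow> 'b::topological_space"
  assumes "continuous_on X f"
  shows "f \<in> borel_measurable (restrict_space lborel X)"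
  using borel_measurable_continuous_on_restrict[OF assms]
    measurable_cong_sets[OF sets_restrict_X refl] by blast

lemma measurable_\<iota> [measurable]: "\<iota> \<in> borel_measurable borel"
  by (rule borel_measurable_continuous_onI[OF continuous_on_\<iota>])

lemma measurable_comp_\<iota>: "continuous_on X f \<Longrightarrow> (\<lambda>p. f (\<iota> p)) \<in> borel_measurable borel"
  by (rule borel_measurable_continuous_onI[OF continuous_on_comp_\<iota>])

lemma integral_vol:
  assumes f: "f \<in> borel_measurable borel"
  shows "(\<integral>p. f p \<partial>vol X \<Omega> \<iota>) = (\<integral>x. indicator X x * (J x * f (inv \<iota> x)) \<partial>lborel)"
proof -
  let ?M = "restrict_space lborel X"
  have inv: "inv \<iota> \<in> measurable ?M borel"
    by (rule measurable_continuous_on_X[OF continuous_on_inv_\<iota>])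
  have J: "J \<in> borel_measurable ?M"
    by (rule measurable_continuous_on_X[OF smooth_on_continuous[OF smooth_on_J]])
  have f': "(\<lambda>x. f (inv \<iota> x)) \<in> borel_measurable ?M"
    using measurable_compose[OF inv f] .
  have "(\<integral>p. f p \<partial>vol X \<Omega> \<iota>) = (\<integral>x. f (inv \<iota> x) \<partial>density ?M (\<lambda>x. ennreal (J x)))"
    unfolding vol_def J_def[symmetric] by (rule integral_distr) (use inv f in auto)
  also have "\<dots> = (\<integral>x. J x *\<^sub>R f (inv \<iota> x) \<partial>?M)"
    by (rule integral_density[OF f' J])
       (auto intro!: AE_I2 simp: space_restrict_space less_imp_le[OF J_pos])
  also have "\<dots> = (\<integral>x. indicator X x *\<^sub>R (J x *\<^sub>R f (inv \<iota> x)) \<partial>lborel)"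
    by (rule integral_restrict_space) simp
  finally show ?thesis by simp
qed

lemma integral_density_vol:
  assumes f: "f \<in> borel_measurable borel" and \<rho>: "\<rho> \<in> borel_measurable borel" "\<And>p. 0 < \<rho> p"
  shows "(\<integral>p. f p \<partial>density (vol X \<Omega> \<iota>) (\<lambda>p. ennreal (\<rho> p))) =
    (\<integral>x. indicator X x * (J x * \<rho> (inv \<iota> x) * f (inv \<iota> x)) \<partial>lborel)"
proof -
  have "(\<integral>p. f p \<partial>density (vol X \<Omega> \<iota>) (\<lambda>p. ennreal (\<rho> p))) = (\<integral>p. \<rho> p *\<^sub>R f p \<partial>vol X \<Omega> \<iota>)"
    by (rule integral_density)
       (use f \<rho> less_imp_le[OF \<rho>(2)] in \<open>auto simp: measurable_cong_sets[OF sets_vol refl]\<close>)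
  then show ?thesis using f \<rho>(1) by (subst (asm) integral_vol) (auto simp: mult_ac)
qed

text \<open>Null sets of the volume are null sets for Lebesgue measure in the \<open>x\<close>-chart, since \<open>J\<close> is positive.\<close>

lemma AE_vol:
  assumes ae: "AE p in vol X \<Omega> \<iota>. P p" and P: "{p. P p} \<in> sets borel"
  shows "AE x in lborel. x \<in> X \<longrightarrow> P (inv \<iota> x)"
proof -
  let ?M = "restrict_space lborel X"
  have inv: "inv \<iota> \<in> measurable (density ?M (\<lambda>x. ennreal (J x))) borel"
    using measurable_continuous_on_X[OF continuous_on_inv_\<iota>] by simp
  have J: "(\<lambda>x. ennreal (J x)) \<in> borel_measurable ?M"
    using measurable_continuous_on_X[OF smooth_on_continuous[OF smooth_on_J]] by measurable
  have "vol X \<Omega> \<iota> = distr (density ?M (\<lambda>x. ennreal (J x))) borel (inv \<iota>)"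
    unfolding vol_def J_def ..
  with ae have "AE p in distr (density ?M (\<lambda>x. ennreal (J x))) borel (inv \<iota>). P p"
    by metis
  moreover have "{p \<in> space borel. P p} \<in> sets borel" using P by simp
  ultimately have "AE x in density ?M (\<lambda>x. ennreal (J x)). P (inv \<iota> x)"
    using AE_distr_iff[OF inv] by blast
  then have "AE x in ?M. 0 < ennreal (J x) \<longrightarrow> P (inv \<iota> x)"
    by (simp add: AE_density[OF J])
  then have "AE x in lborel. x \<in> X \<longrightarrow> 0 < ennreal (J x) \<longrightarrow> P (inv \<iota> x)"
    by (subst (asm) AE_restrict_space_iff) auto
  then show ?thesis
    by (rule eventually_mono) (use J_pos in auto)
qed

lemma smooth_map_continuous: "smooth_map X \<iota> f \<Longrightarrow> continuous_on UNIV f"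
  using continuous_on_comp_\<iota>[OF smooth_on_continuous, of "f \<circ> inv \<iota>"] by (simp add: smooth_map_def)

lemma smooth_map_measurable: "smooth_map X \<iota> f \<Longrightarrow> f \<in> borel_measurable borel"
  by (rule borel_measurable_continuous_onI[OF smooth_map_continuous])

lemma metric_expand: "metric \<Omega> \<iota> p u w = (\<Sum>i\<in>UNIV. \<Sum>j\<in>UNIV. u $ i * (D2 \<Omega> (\<iota> p) $ i $ j * w $ j))"
  by (simp add: metric_def inner_vec_def matrix_vector_mult_def sum_distrib_left)

lemma metric_measurable:
  fixes u w :: "('m, 'd) vfield"
  assumes "u \<in> borel_measurable borel" "w \<in> borel_measurable borel"
  shows "(\<lambda>p. metric \<Omega> \<iota> p (u p) (w p)) \<in> borel_measurable borel"
proof -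
  have nth: "(\<lambda>x. x $ i) \<in> borel_measurable borel" for i :: 'd
    by (intro borel_measurable_continuous_onI continuous_intros)
  have [measurable]: "(\<lambda>p. u p $ i) \<in> borel_measurable borel"
    "(\<lambda>p. w p $ i) \<in> borel_measurable borel" for i
    using measurable_compose[OF assms(1) nth] measurable_compose[OF assms(2) nth] by auto
  have [measurable]: "(\<lambda>p. D2 \<Omega> (\<iota> p) $ i $ j) \<in> borel_measurable borel" for i j
    by (rule measurable_comp_\<iota>[OF smooth_on_continuous[OF D2_smooth]])
  show ?thesis unfolding metric_expand by measurable
qed

lemma metric_sym: "metric \<Omega> \<iota> p u w = metric \<Omega> \<iota> p w u"
  unfolding metric_def by (rule D2_self_adjoint) simp

lemma metric_pos: "u \<noteq> 0 \<Longrightarrow> 0 < metric \<Omega> \<iota> p u u"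
  unfolding metric_def by (rule hessian_pos_def) simp

lemma metric_nonneg: "0 \<le> metric \<Omega> \<iota> p u u"
  using metric_pos[of u p] by (cases "u = 0") (auto simp: metric_def)

lemma metric_diff:
  "metric \<Omega> \<iota> p (u - w) z = metric \<Omega> \<iota> p u z - metric \<Omega> \<iota> p w z"
  "metric \<Omega> \<iota> p z (u - w) = metric \<Omega> \<iota> p z u - metric \<Omega> \<iota> p z w"
  by (simp_all add: metric_def inner_diff_left inner_diff_right matrix_vector_mult_diff_distrib)

lemma metric_minus:
  "metric \<Omega> \<iota> p (- u) z = - metric \<Omega> \<iota> p u z" "metric \<Omega> \<iota> p z (- u) = - metric \<Omega> \<iota> p z u"
  using matrix_vector_mult_diff_distrib[of "D2 \<Omega> (\<iota> p)" 0 u] by (simp_all add: metric_def)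

text \<open>A crude form of the Cauchy-Schwarz inequality, from nonnegativity of the metric on \<open>u - w\<close> and on
  \<open>u + w\<close>; it makes products of square integrable fields integrable.\<close>

lemma abs_metric_le: "\<bar>metric \<Omega> \<iota> p u w\<bar> \<le> metric \<Omega> \<iota> p u u + metric \<Omega> \<iota> p w w"
proof -
  have "0 \<le> metric \<Omega> \<iota> p (u - w) (u - w)" "0 \<le> metric \<Omega> \<iota> p (u - (- w)) (u - (- w))"
    by (rule metric_nonneg)+
  moreover have "0 \<le> metric \<Omega> \<iota> p u u" "0 \<le> metric \<Omega> \<iota> p w w"
    by (rule metric_nonneg)+
  ultimately show ?thesis
    unfolding metric_diff metric_minus metric_sym[of p w u] by linarith
qed

lemma L2_inner_integrable:
  assumes \<rho>: "\<rho> \<in> borel_measurable borel" "\<And>p. 0 < \<rho> p"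
    and u: "L2_field X \<Omega> \<iota> \<rho> u" and w: "L2_field X \<Omega> \<iota> \<rho> w"
  shows "integrable (vol X \<Omega> \<iota>) (\<lambda>p. \<rho> p * metric \<Omega> \<iota> p (u p) (w p))"
proof (rule Bochner_Integration.integrable_bound)
  show "integrable (vol X \<Omega> \<iota>)
      (\<lambda>p. \<rho> p * metric \<Omega> \<iota> p (u p) (u p) + \<rho> p * metric \<Omega> \<iota> p (w p) (w p))"
    using u w by (auto simp: L2_field_def)
  have "(\<lambda>p. \<rho> p * metric \<Omega> \<iota> p (u p) (w p)) \<in> borel_measurable borel"
    using metric_measurable[of u w] \<rho>(1) u w by (auto simp: L2_field_def)
  then show "(\<lambda>p. \<rho> p * metric \<Omega> \<iota> p (u p) (w p)) \<in> borel_measurable (vol X \<Omega> \<iota>)"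
    by (simp add: measurable_cong_sets[OF sets_vol refl])
  have "\<bar>\<rho> p * metric \<Omega> \<iota> p (u p) (w p)\<bar>
      \<le> \<rho> p * (metric \<Omega> \<iota> p (u p) (u p) + metric \<Omega> \<iota> p (w p) (w p))" for p
    using \<rho>(2)[of p] abs_metric_le[of p "u p" "w p"] by (simp add: abs_mult)
  then show "AE p in vol X \<Omega> \<iota>. norm (\<rho> p * metric \<Omega> \<iota> p (u p) (w p))
      \<le> norm (\<rho> p * metric \<Omega> \<iota> p (u p) (u p) + \<rho> p * metric \<Omega> \<iota> p (w p) (w p))"
    by (intro AE_I2) (auto simp: distrib_left intro: order_trans[OF _ abs_ge_self])
qed

lemma L2_inner_diff:
  assumes "\<rho> \<in> borel_measurable borel" "\<And>p. 0 < \<rho> p"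
    and "L2_field X \<Omega> \<iota> \<rho> u" "L2_field X \<Omega> \<iota> \<rho> w" "L2_field X \<Omega> \<iota> \<rho> z"
  shows "L2_inner X \<Omega> \<iota> \<rho> (\<lambda>p. u p - w p) z = L2_inner X \<Omega> \<iota> \<rho> u z - L2_inner X \<Omega> \<iota> \<rho> w z"
  using L2_inner_integrable[OF assms(1,2,3,5)] L2_inner_integrable[OF assms(1,2,4,5)]
  by (simp add: L2_inner_def metric_diff right_diff_distrib)

lemma L2_inner_sym: "L2_inner X \<Omega> \<iota> \<rho> u w = L2_inner X \<Omega> \<iota> \<rho> w u"
  unfolding L2_inner_def by (simp add: metric_sym)

lemma smooth_density_pos:
  assumes "smooth_density X \<Omega> \<iota> \<rho>"
  shows "\<rho> \<in> borel_measurable borel" "0 < \<rho> p"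
  using assms smooth_map_measurable by (auto simp: smooth_density_def)

lemma L2_field_diff:
  assumes \<rho>: "\<rho> \<in> borel_measurable borel" "\<And>p. 0 < \<rho> p"
    and u: "L2_field X \<Omega> \<iota> \<rho> u" and w: "L2_field X \<Omega> \<iota> \<rho> w"
  shows "L2_field X \<Omega> \<iota> \<rho> (\<lambda>p. u p - w p)"
proof -
  have "integrable (vol X \<Omega> \<iota>) (\<lambda>p. \<rho> p * metric \<Omega> \<iota> p (u p) (u p) - \<rho> p * metric \<Omega> \<iota> p (u p) (w p)
      - (\<rho> p * metric \<Omega> \<iota> p (w p) (u p) - \<rho> p * metric \<Omega> \<iota> p (w p) (w p)))"
    by (intro Bochner_Integration.integrable_diff L2_inner_integrable[OF \<rho>] u w)
  then have "integrable (vol X \<Omega> \<iota>) (\<lambda>p. \<rho> p * metric \<Omega> \<iota> p (u p - w p) (u p - w p))"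
    by (simp add: metric_diff algebra_simps)
  then show ?thesis using u w by (auto simp: L2_field_def)
qed

text \<open>Equality in \<open>L\<^sup>2\<close> is equality almost everywhere, because the density is positive and the metric is
  definite; for smooth fields it is then equality everywhere.\<close>

lemma smooth_L2_eq_if_norm_diff_0:
  assumes \<rho>: "smooth_density X \<Omega> \<iota> \<rho>"
    and u: "smooth_map X \<iota> u" "L2_field X \<Omega> \<iota> \<rho> u"
    and w: "smooth_map X \<iota> w" "L2_field X \<Omega> \<iota> \<rho> w"
    and zero: "L2_inner X \<Omega> \<iota> \<rho> (\<lambda>p. u p - w p) (\<lambda>p. u p - w p) = 0"
  shows "u = w"
proof
  fix p
  note \<rho>' = smooth_density_pos[OF \<rho>]
  let ?q = "\<lambda>p. \<rho> p * metric \<Omega> \<iota> p (u p - w p) (u p - w p)"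
  have int: "integrable (vol X \<Omega> \<iota>) ?q"
    using L2_field_diff[OF \<rho>' u(2) w(2)] by (simp add: L2_field_def)
  then have "?q \<in> borel_measurable (vol X \<Omega> \<iota>)" by (rule borel_measurable_integrable)
  then have [measurable]: "?q \<in> borel_measurable borel"
    by (simp add: measurable_cong_sets[OF sets_vol refl])
  have "{p. ?q p = 0} = {p \<in> space borel. ?q p = 0}" by simp
  also have "\<dots> \<in> sets borel" by measurable
  finally have sets: "{p. ?q p = 0} \<in> sets borel" .
  have "AE p in vol X \<Omega> \<iota>. ?q p = 0"
    using zero integral_nonneg_eq_0_iff_AE[OF int] \<rho>'(2)
    by (simp add: L2_inner_def metric_nonneg less_imp_le)
  from AE_vol[OF this sets] have "AE x in lborel. x \<in> X \<longrightarrow> u (inv \<iota> x) - w (inv \<iota> x) = 0"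
  proof (rule eventually_mono, intro impI)
    fix x assume "x \<in> X \<longrightarrow> ?q (inv \<iota> x) = 0" "x \<in> X"
    then show "u (inv \<iota> x) - w (inv \<iota> x) = 0"
      using \<rho>'(2)[of "inv \<iota> x"] metric_pos[of "u (inv \<iota> x) - w (inv \<iota> x)" "inv \<iota> x"] by auto
  qed
  moreover have "continuous_on X (\<lambda>x. u (inv \<iota> x) - w (inv \<iota> x))"
    using u(1) w(1) smooth_on_continuous
    by (intro continuous_on_diff) (fastforce simp: smooth_map_def o_def)+
  ultimately have "u (inv \<iota> (\<iota> p)) - w (inv \<iota> (\<iota> p)) = 0"
    by (intro continuous_AE_eq_0[OF open_X]) auto
  then show "u p = w p" by simp
qed


section \<open>The projection and tangent vectors\<close>

text \<open>Both projections are orthogonal to the difference with the given field, which determines all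
  four inner products between them.\<close>

lemma is_projection_unique:
  assumes \<rho>: "smooth_density X \<Omega> \<iota> \<rho>" and v: "L2_field X \<Omega> \<iota> \<rho> v"
    and w: "is_projection X \<Omega> \<iota> \<rho> v w" and w': "is_projection X \<Omega> \<iota> \<rho> v w'"
  shows "w = w'"
proof -
  note \<rho>' = smooth_density_pos[OF \<rho>]
  let ?T = "tangent_space X \<Omega> \<iota> \<rho>" and ?L = "L2_inner X \<Omega> \<iota> \<rho>"
  have T: "w \<in> ?T" "w' \<in> ?T" and L2: "L2_field X \<Omega> \<iota> \<rho> w" "L2_field X \<Omega> \<iota> \<rho> w'"
    using w w' by (auto simp: is_projection_def tangent_space_def)
  have "?L w u = ?L v u" "?L w' u = ?L v u" if "u \<in> ?T" for u
    using w w' that L2_inner_diff[OF \<rho>' v L2(1), of u] L2_inner_diff[OF \<rho>' v L2(2), of u]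
    by (auto simp: is_projection_def tangent_space_def)
  then have "?L w w = ?L w' w" "?L w w' = ?L w' w'" using T by auto
  moreover have "?L (\<lambda>p. w p - w' p) (\<lambda>p. w p - w' p) = ?L w w - ?L w' w - (?L w w' - ?L w' w')"
    using L2_inner_diff[OF \<rho>' L2 L2(1)] L2_inner_diff[OF \<rho>' L2 L2(2)]
      L2_inner_diff[OF \<rho>' L2 L2_field_diff[OF \<rho>' L2]]
      L2_inner_sym[of \<rho> w "\<lambda>p. w p - w' p"] L2_inner_sym[of \<rho> w' "\<lambda>p. w p - w' p"]
    by simp
  ultimately show ?thesis
    using w w' L2 by (intro smooth_L2_eq_if_norm_diff_0[OF \<rho>]) (auto simp: is_projection_def)
qed

lemma smooth_map_uminus:
  "smooth_map X \<iota> f \<Longrightarrow> smooth_map X \<iota> (\<lambda>p. - f p)"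
  using smooth_on_linear[OF _ bounded_linear_minus[OF bounded_linear_ident], of X "f \<circ> inv \<iota>"]
  by (simp add: smooth_map_def o_def)

lemma grad_uminus:
  assumes "smooth_map X \<iota> \<phi>"
  shows "grad \<Omega> \<iota> (\<lambda>p. - \<phi> p) p = - grad \<Omega> \<iota> \<phi> p"
proof -
  have d: "(\<phi> \<circ> inv \<iota> has_derivative frechet_derivative (\<phi> \<circ> inv \<iota>) (at (\<iota> p))) (at (\<iota> p))"
    using assms by (intro smooth_on_has_derivative) (auto simp: smooth_map_def)
  have "pd i ((\<lambda>p. - \<phi> p) \<circ> inv \<iota>) (\<iota> p) = - pd i (\<phi> \<circ> inv \<iota>) (\<iota> p)" for i
    using has_derivative_eq_pd(1)[OF has_derivative_minus[OF d], of i] has_derivative_eq_pd(1)[OF d, of i]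
    by (simp add: o_def)
  then have "D ((\<lambda>p. - \<phi> p) \<circ> inv \<iota>) (\<iota> p) = - D (\<phi> \<circ> inv \<iota>) (\<iota> p)"
    by (simp add: D_def vec_eq_iff)
  then show ?thesis
    using matrix_vector_mult_diff_distrib[of "matrix_inv (D2 \<Omega> (\<iota> p))" 0 "D (\<phi> \<circ> inv \<iota>) (\<iota> p)"]
    by (simp add: grad_def)
qed

lemma L2_inner_uminus:
  "L2_inner X \<Omega> \<iota> \<rho> (\<lambda>p. - u p) w = - L2_inner X \<Omega> \<iota> \<rho> u w"
  "L2_inner X \<Omega> \<iota> \<rho> u (\<lambda>p. - w p) = - L2_inner X \<Omega> \<iota> \<rho> u w"
  by (simp_all add: L2_inner_def metric_minus)

text \<open>If \<open>grad \<phi>\<close> approximates \<open>u\<close>, then \<open>grad (- \<phi>)\<close> approximates \<open>- u\<close> with the same error.\<close>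

lemma tangent_space_uminus:
  assumes "u \<in> tangent_space X \<Omega> \<iota> \<rho>"
  shows "(\<lambda>p. - u p) \<in> tangent_space X \<Omega> \<iota> \<rho>"
proof -
  have "L2_field X \<Omega> \<iota> \<rho> (\<lambda>p. - u p)"
    using assms by (auto simp: tangent_space_def L2_field_def metric_minus)
  moreover have "\<exists>\<phi>. test_function X \<iota> \<phi> \<and>
      (let r = (\<lambda>p. - u p - grad \<Omega> \<iota> \<phi> p) in L2_inner X \<Omega> \<iota> \<rho> r r < \<epsilon>)" if "0 < \<epsilon>" for \<epsilon>
  proof -
    obtain \<phi> where \<phi>: "test_function X \<iota> \<phi>"
      and small: "L2_inner X \<Omega> \<iota> \<rho> (\<lambda>p. u p - grad \<Omega> \<iota> \<phi> p) (\<lambda>p. u p - grad \<Omega> \<iota> \<phi> p) < \<epsilon>"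
      using assms \<open>0 < \<epsilon>\<close> by (auto simp: tangent_space_def Let_def)
    have s: "smooth_map X \<iota> \<phi>" using \<phi> by (simp add: test_function_def)
    have "(\<lambda>p. - u p - grad \<Omega> \<iota> (\<lambda>p. - \<phi> p) p) = (\<lambda>p. - (u p - grad \<Omega> \<iota> \<phi> p))"
      by (simp add: grad_uminus[OF s])
    with small have "L2_inner X \<Omega> \<iota> \<rho> (\<lambda>p. - u p - grad \<Omega> \<iota> (\<lambda>p. - \<phi> p) p)
        (\<lambda>p. - u p - grad \<Omega> \<iota> (\<lambda>p. - \<phi> p) p) < \<epsilon>"
      by (simp only: L2_inner_uminus minus_minus)
    moreover have "test_function X \<iota> (\<lambda>p. - \<phi> p)"
      using \<phi> smooth_map_uminus[OF s] by (simp add: test_function_def)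
    ultimately show ?thesis unfolding Let_def by blast
  qed
  ultimately show ?thesis by (simp add: tangent_space_def)
qed

lemma is_projection_uminus:
  assumes "is_projection X \<Omega> \<iota> \<rho> v w"
  shows "is_projection X \<Omega> \<iota> \<rho> (\<lambda>p. - v p) (\<lambda>p. - w p)"
proof -
  have "(\<lambda>p. - v p - - w p) = (\<lambda>p. - (v p - w p))" by simp
  with assms show ?thesis
    unfolding is_projection_def
    by (simp only: L2_inner_uminus) (simp add: tangent_space_uminus smooth_map_uminus)
qed

text \<open>The choice operator in \<open>projection\<close> could select unrelated representatives for \<open>v\<close> and \<open>- v\<close>;
  uniqueness of the smooth representative excludes this.\<close>

lemma projection_uminus:
  assumes \<rho>: "smooth_density X \<Omega> \<iota> \<rho>" and v: "L2_field X \<Omega> \<iota> \<rho> v"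
  shows "projection X \<Omega> \<iota> \<rho> (\<lambda>p. - v p) = (\<lambda>p. - projection X \<Omega> \<iota> \<rho> v p)"
proof (cases "\<exists>w. is_projection X \<Omega> \<iota> \<rho> v w")
  case True
  let ?v' = "\<lambda>p. - v p"
  have v': "L2_field X \<Omega> \<iota> \<rho> ?v'" using v by (auto simp: L2_field_def metric_minus)
  have "is_projection X \<Omega> \<iota> \<rho> v (projection X \<Omega> \<iota> \<rho> v)"
    using True by (simp add: projection_def someI_ex)
  from is_projection_uminus[OF this]
  have p: "is_projection X \<Omega> \<iota> \<rho> ?v' (\<lambda>p. - projection X \<Omega> \<iota> \<rho> v p)" .
  then have "\<exists>w. is_projection X \<Omega> \<iota> \<rho> ?v' w" by blast
  then have "is_projection X \<Omega> \<iota> \<rho> ?v' (projection X \<Omega> \<iota> \<rho> ?v')"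
    by (simp add: projection_def someI_ex)
  then show ?thesis using p by (rule is_projection_unique[OF \<rho> v'])
next
  case False
  moreover have "\<not> (\<exists>w. is_projection X \<Omega> \<iota> \<rho> (\<lambda>p. - v p) w)"
    using False is_projection_uminus[of \<rho> "\<lambda>p. - v p"] by auto
  ultimately show ?thesis by (simp add: projection_def)
qed

lemma smooth_map_projection: "smooth_map X \<iota> (projection X \<Omega> \<iota> \<rho> v)"
proof (cases "\<exists>w. is_projection X \<Omega> \<iota> \<rho> v w")
  case True
  then have "is_projection X \<Omega> \<iota> \<rho> v (projection X \<Omega> \<iota> \<rho> v)"
    by (simp add: projection_def someI_ex)
  then show ?thesis by (simp add: is_projection_def)
next
  case False
  then show ?thesis
    by (simp add: projection_def smooth_map_def smooth_on_def open_X o_def Ck_on_const)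
qed

text \<open>The field under the sum in the coordinate formula of \<open>divergence\<close> for \<open>\<rho> v\<close>: the components of the
  current with respect to Lebesgue measure.\<close>

definition flux :: "('m \<Rightarrow> real) \<Rightarrow> ('m, 'd) vfield \<Rightarrow> 'd \<Rightarrow> real^'d \<Rightarrow> real" where
  "flux \<rho> w i x = J x * (\<rho> (inv \<iota> x) *\<^sub>R w (inv \<iota> x)) $ i"

lemma smooth_on_flux:
  assumes "smooth_map X \<iota> \<rho>" "smooth_map X \<iota> w"
  shows "smooth_on X (flux \<rho> w i)"
proof -
  have "smooth_on X (\<lambda>x. \<rho> (inv \<iota> x))" "smooth_on X (\<lambda>x. w (inv \<iota> x))"
    using assms by (simp_all add: smooth_map_def o_def)
  then show ?thesis
    unfolding flux_def vector_scaleR_component real_scaleR_def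
    by (intro smooth_on_mult smooth_on_J smooth_on_nth)
qed

lemma divergence_flux:
  "divergence \<Omega> \<iota> (\<lambda>q. \<rho> q *\<^sub>R w q) p = (\<Sum>i\<in>UNIV. pd i (flux \<rho> w i) (\<iota> p)) / J (\<iota> p)"
  by (simp add: divergence_def flux_def[abs_def] J_def)

lemma smooth_map_divergence:
  assumes "smooth_map X \<iota> \<rho>" "smooth_map X \<iota> w"
  shows "smooth_map X \<iota> (divergence \<Omega> \<iota> (\<lambda>q. \<rho> q *\<^sub>R w q))"
  unfolding smooth_map_def
proof (rule smooth_on_cong)
  show "smooth_on X (\<lambda>x. (\<Sum>i\<in>UNIV. pd i (flux \<rho> w i) x) * J x powr (- 1))"
    by (intro smooth_on_mult smooth_on_sum smooth_on_pd smooth_on_flux open_X smooth_on_J_powr assms)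
qed (simp add: divergence_flux powr_minus_divide less_imp_le[OF J_pos])

lemma divergence_uminus:
  assumes "smooth_map X \<iota> \<rho>" "smooth_map X \<iota> w"
  shows "divergence \<Omega> \<iota> (\<lambda>q. \<rho> q *\<^sub>R - w q) p = - divergence \<Omega> \<iota> (\<lambda>q. \<rho> q *\<^sub>R w q) p"
proof -
  have "pd i (flux \<rho> (\<lambda>q. - w q) i) (\<iota> p) = - pd i (flux \<rho> w i) (\<iota> p)" for i
  proof -
    have "flux \<rho> (\<lambda>q. - w q) i = (\<lambda>x. - flux \<rho> w i x)" by (simp add: flux_def[abs_def])
    moreover note d = smooth_on_has_derivative[OF smooth_on_flux[OF assms] \<iota>_in, of i p]
    ultimately show ?thesis
      using has_derivative_eq_pd(1)[OF has_derivative_minus[OF d], of i]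
        has_derivative_eq_pd(1)[OF d, of i] by simp
  qed
  then show ?thesis
    unfolding divergence_flux[of \<rho> w] divergence_flux[of \<rho> "\<lambda>q. - w q"] by (simp add: sum_negf)
qed

text \<open>A differentiable functional has a linear derivative on smooth directions only, so the divergence
  that defines the tangent vector has to be smooth.\<close>

lemma tangent_vector_uminus:
  assumes \<rho>: "smooth_density X \<Omega> \<iota> \<rho>" and v: "L2_field X \<Omega> \<iota> \<rho> v"
    and F: "differentiable_functional X \<iota> F \<rho>"
  shows "tangent_vector X \<Omega> \<iota> \<rho> (\<lambda>p. - v p) F = - tangent_vector X \<Omega> \<iota> \<rho> v F"
proof -
  have \<rho>s: "smooth_map X \<iota> \<rho>" using \<rho> by (simp add: smooth_density_def)
  define s where "s = divergence \<Omega> \<iota> (\<lambda>q. \<rho> q *\<^sub>R projection X \<Omega> \<iota> \<rho> v q)"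
  have s: "smooth_map X \<iota> s"
    unfolding s_def by (rule smooth_map_divergence[OF \<rho>s smooth_map_projection])
  have s': "divergence \<Omega> \<iota> (\<lambda>q. \<rho> q *\<^sub>R projection X \<Omega> \<iota> \<rho> (\<lambda>p. - v p) q) p = - s p" for p
    unfolding s_def projection_uminus[OF \<rho> v]
    by (rule divergence_uminus[OF \<rho>s smooth_map_projection])
  obtain L where L: "\<And>s. smooth_map X \<iota> s \<Longrightarrow>
        ((\<lambda>\<epsilon>. F (\<lambda>p. \<rho> p + \<epsilon> * s p)) has_real_derivative L s) (at 0)"
    and lin: "\<And>a b s r. smooth_map X \<iota> s \<Longrightarrow> smooth_map X \<iota> r \<Longrightarrow>
        L (\<lambda>p. a * s p + b * r p) = a * L s + b * L r"
    using F unfolding differentiable_functional_def by blast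
  have "tangent_vector X \<Omega> \<iota> \<rho> (\<lambda>p. - v p) F = L s"
    using DERIV_imp_deriv[OF L[OF s]] by (simp add: tangent_vector_def s')
  moreover have "tangent_vector X \<Omega> \<iota> \<rho> v F = L (\<lambda>p. - s p)"
    using DERIV_imp_deriv[OF L[OF smooth_map_uminus[OF s]]]
    by (simp add: tangent_vector_def s_def)
  moreover have "L (\<lambda>p. - s p) = - L s" using lin[OF s s, of "-1" 0] by simp
  ultimately show ?thesis by simp
qed

end


section \<open>Differentiation of integrals\<close>

text \<open>Differentiation under the integral sign, for derivatives within a convex set so that the end points
  of the time interval are included. The mean value theorem turns the bound on \<open>f'\<close> into a bound on the
  difference quotients, and dominated convergence applies.\<close>

lemma has_real_derivative_integral:
  fixes f :: "real \<Rightarrow> 'a \<Rightarrow> real"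
  assumes S: "convex S" "t \<in> S"
    and int: "\<And>s. s \<in> S \<Longrightarrow> integrable M (f s)"
    and der: "\<And>s x. s \<in> S \<Longrightarrow> x \<in> space M \<Longrightarrow>
      ((\<lambda>s. f s x) has_real_derivative f' s x) (at s within S)"
    and bound: "\<And>s x. s \<in> S \<Longrightarrow> x \<in> space M \<Longrightarrow> \<bar>f' s x\<bar> \<le> w x"
    and w: "integrable M w" and meas: "f' t \<in> borel_measurable M"
  shows "((\<lambda>s. \<integral>x. f s x \<partial>M) has_real_derivative (\<integral>x. f' t x \<partial>M)) (at t within S)"
  unfolding has_field_derivative_iff tendsto_at_iff_sequentially
proof (intro allI impI)
  fix u assume u: "\<forall>i. u i \<in> S - {t}" "u \<longlonglongrightarrow> t"
  have "(\<lambda>i. \<integral>x. (f (u i) x - f t x) / (u i - t) \<partial>M) \<longlonglongrightarrow> (\<integral>x. f' t x \<partial>M)"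
  proof (rule integral_dominated_convergence[where w = w])
    show "(\<lambda>x. (f (u i) x - f t x) / (u i - t)) \<in> borel_measurable M" for i
      using borel_measurable_integrable[OF int, of "u i"] borel_measurable_integrable[OF int[OF S(2)]] u(1)
      by auto
    show "AE x in M. (\<lambda>i. (f (u i) x - f t x) / (u i - t)) \<longlonglongrightarrow> f' t x"
    proof (rule AE_I2)
      fix x assume "x \<in> space M"
      from der[OF S(2) this] u show "(\<lambda>i. (f (u i) x - f t x) / (u i - t)) \<longlonglongrightarrow> f' t x"
        unfolding has_field_derivative_iff tendsto_at_iff_sequentially by (auto simp: o_def)
    qed
    show "AE x in M. norm ((f (u i) x - f t x) / (u i - t)) \<le> w x" for i
    proof (rule AE_I2)
      fix x assume x: "x \<in> space M"
      have "norm (f (u i) x - f t x) \<le> w x * norm (u i - t)"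
        by (rule field_differentiable_bound[OF S(1), where f = "\<lambda>s. f s x" and f' = "\<lambda>s. f' s x"])
           (use der bound x S(2) u(1) in auto)
      moreover have "0 < norm (u i - t)" using u(1) by auto
      ultimately show "norm ((f (u i) x - f t x) / (u i - t)) \<le> w x"
        by (simp add: divide_le_eq)
    qed
  qed (use w meas in auto)
  moreover have "(\<integral>x. (f (u i) x - f t x) / (u i - t) \<partial>M) =
      ((\<integral>x. f (u i) x \<partial>M) - (\<integral>x. f t x \<partial>M)) / (u i - t)" for i
    using int[of "u i"] int[OF S(2)] u(1) by simp
  ultimately show "((\<lambda>s. ((\<integral>x. f s x \<partial>M) - (\<integral>x. f t x \<partial>M)) / (s - t)) \<circ> u) \<longlonglongrightarrow> (\<integral>x. f' t x \<partial>M)"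
    by (simp only: o_def)
qed

lemma integrable_indicator_cball:
  fixes f :: "'a::euclidean_space \<Rightarrow> real"
  shows "continuous_on (cball a r) f \<Longrightarrow> integrable lborel (\<lambda>x. indicator (cball a r) x * f x)"
  using borel_integrable_compact[OF compact_cball, of a r f] by simp

text \<open>\<open>R\<close> is only smooth on \<open>S\<close>, but its product with the bump function, extended by zero, is
  continuously differentiable on the whole space; its derivative has integral zero.\<close>

lemma bump_integration_by_parts:
  fixes R :: "'a::euclidean_space \<Rightarrow> real"
  assumes R: "smooth_on S R" and r: "0 < r" "cball a r \<subseteq> S"
  shows "(\<integral>x. indicator (cball a r) x * (bump' a r x e * R x) \<partial>lborel) =
    - (\<integral>x. indicator (cball a r) x * (bump a r x * frechet_derivative R (at x) e) \<partial>lborel)"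
proof -
  let ?R' = "\<lambda>x e. frechet_derivative R (at x) e"
  have S: "open S" using R by (simp add: smooth_on_def)
  have contR: "continuous_on S R" by (rule smooth_on_continuous[OF R])
  have contR': "continuous_on S (\<lambda>x. ?R' x e)"
    using Ck_on_SucD(2)[OF smooth_on_Ck[OF R], of 0 e] by simp
  define h where "h x = indicator (cball a r) x * (bump a r x * R x)" for x
  define h' where "h' x k = indicator (cball a r) x * (bump' a r x k * R x + bump a r x * ?R' x k)"
    for x k
  have h: "h x = bump a r x * R x" for x
    using bump_outside[OF r(1), of x a] by (cases "x \<in> cball a r") (auto simp: h_def)
  have h': "h' x k = bump' a r x k * R x + bump a r x * ?R' x k" for x k
    using bump_outside[OF r(1), of x a k] by (cases "x \<in> cball a r") (auto simp: h'_def)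
  have out: "open (- cball a r)" by (simp add: open_Compl)
  have der: "(h has_derivative h' x) (at x)" for x
  proof (cases "x \<in> S")
    case True
    have "((\<lambda>x. bump a r x * R x) has_derivative (\<lambda>k. bump a r x * ?R' x k + bump' a r x k * R x)) (at x)"
      by (rule has_derivative_mult[OF bump_has_derivative smooth_on_has_derivative[OF R True]])
    then show ?thesis by (simp add: h h'[abs_def] h[abs_def] add.commute)
  next
    case False
    then have x: "x \<in> - cball a r" using r(2) by auto
    have "((\<lambda>x. 0) has_derivative h' x) (at x)"
      using x by (simp add: h'_def[abs_def])
    then show ?thesis
      by (rule has_derivative_transform_within_open[OF _ out x]) (auto simp: h_def)
  qed
  have "continuous_on (- cball a r) (\<lambda>x. h' x e) \<longleftrightarrow> continuous_on (- cball a r) (\<lambda>x. 0 :: real)"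
    by (rule continuous_on_cong) (auto simp: h'_def)
  then have "continuous_on (- cball a r) (\<lambda>x. h' x e)" by simp
  moreover have "continuous_on S (\<lambda>x. h' x e)"
    unfolding h' by (intro continuous_intros contR contR')
  ultimately have "continuous_on (S \<union> - cball a r) (\<lambda>x. h' x e)"
    by (intro continuous_on_open_Un S out)
  moreover have "S \<union> - cball a r = UNIV" using r(2) by auto
  ultimately have "(\<integral>x. h' x e \<partial>lborel) = 0"
    by (intro integral_derivative_eq_0[OF der, of e a r]) (auto simp: h_def)
  moreover have "(\<integral>x. h' x e \<partial>lborel) =
      (\<integral>x. indicator (cball a r) x * (bump' a r x e * R x) \<partial>lborel) +
      (\<integral>x. indicator (cball a r) x * (bump a r x * ?R' x e) \<partial>lborel)"
    unfolding h'_def distrib_left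
    by (intro Bochner_Integration.integral_add integrable_indicator_cball continuous_intros
        continuous_on_subset[OF contR r(2)] continuous_on_subset[OF contR' r(2)])
  ultimately show ?thesis by simp
qed

text \<open>Displacement maps are measurable only on the image of a chart. As the chart takes its values there,
  pushing forward through the restricted space is pushing forward by the composition.\<close>

lemma distr_restrict_distr:
  assumes c: "c \<in> measurable M borel" "\<And>p. p \<in> space M \<Longrightarrow> c p \<in> S" and S: "S \<in> sets borel"
    and T: "T \<in> measurable (restrict_space borel S) borel"
  shows "distr (restrict_space (distr M borel c) S) borel T = distr M borel (\<lambda>p. T (c p))"
    and "(\<lambda>p. T (c p)) \<in> measurable M borel"
proof -
  have c': "c \<in> measurable M (restrict_space borel S)"
    by (rule measurable_restrict_space2) (use c in auto)
  have "restrict_space (distr M borel c) S = distr M (restrict_space borel S) c"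
    by (rule restrict_distr) (use c S in auto)
  then show "distr (restrict_space (distr M borel c) S) borel T = distr M borel (\<lambda>p. T (c p))"
    using distr_distr[OF T c'] by (simp add: o_def)
  show "(\<lambda>p. T (c p)) \<in> measurable M borel" using measurable_compose[OF c' T] .
qed

lemma has_vector_derivative_comp:
  assumes "(c has_vector_derivative c') (at t within S)" "(f has_derivative f') (at (c t))"
  shows "((\<lambda>s. f (c s)) has_vector_derivative f' c') (at t within S)"
  using vector_derivative_diff_chain_within[OF assms(1) has_derivative_at_withinI[OF assms(2)]]
  by (simp add: o_def)

lemma has_vector_derivative_unique_01:
  assumes "t \<in> {0..1::real}" "(f has_vector_derivative a) (at t within {0..1})"
    "(f has_vector_derivative b) (at t within {0..1})"
  shows "a = b"
  using vector_derivative_unique_within_closed_interval[of 0 1 t f a b] assms by simp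


section \<open>Time-dependent fields in coordinates\<close>

context bregman_manifold
begin

text \<open>The extension \<open>G\<close> of a smooth family past the end points of the time interval is not unique, but
  its time derivative on \<open>{0..1} \<times> X\<close> is the derivative of the family within \<open>{0..1}\<close>.\<close>

lemma smooth_familyE:
  fixes f :: "real \<Rightarrow> 'm \<Rightarrow> 'b::real_normed_vector"
  assumes "smooth_family X \<iota> f"
  obtains U G where "open U" "{0..1} \<times> X \<subseteq> U" "smooth_on U G"
    "\<forall>t\<in>{0..1}. \<forall>x\<in>X. f t (inv \<iota> x) = G (t, x)"
    "\<forall>t\<in>{0..1}. \<forall>x\<in>X. time_derivative f t (inv \<iota> x) = frechet_derivative G (at (t, x)) (1, 0)"
proof -
  obtain U G where U: "{0..1} \<times> X \<subseteq> U" "smooth_on U G"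
    and f: "\<And>t p. t \<in> {0..1} \<Longrightarrow> f t p = G (t, \<iota> p)"
    using assms unfolding smooth_family_def by blast
  show ?thesis
  proof (rule that[OF _ U])
    show "open U" using U(2) by (simp add: smooth_on_def)
    show "\<forall>t\<in>{0..1}. \<forall>x\<in>X. f t (inv \<iota> x) = G (t, x)" using f by simp
    show "\<forall>t\<in>{0..1}. \<forall>x\<in>X. time_derivative f t (inv \<iota> x) = frechet_derivative G (at (t, x)) (1, 0)"
    proof (intro ballI)
    fix t x assume t: "t \<in> {0..1::real}" and x: "x \<in> X"
    have c: "((\<lambda>s. (s, x)) has_vector_derivative (1, 0)) (at t within {0..1})"
      by (auto simp: has_vector_derivative_def intro!: derivative_eq_intros)
    have "(G has_derivative frechet_derivative G (at (t, x))) (at (t, x))"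
      by (rule smooth_on_has_derivative[OF U(2)]) (use t x U(1) in auto)
    from has_vector_derivative_comp[OF c this]
    have "((\<lambda>s. f s (inv \<iota> x)) has_vector_derivative frechet_derivative G (at (t, x)) (1, 0))
        (at t within {0..1})"
      by (rule has_vector_derivative_transform[rotated 2]) (use t x f in auto)
    then show "time_derivative f t (inv \<iota> x) = frechet_derivative G (at (t, x)) (1, 0)"
      unfolding time_derivative_def using t
      by (intro vector_derivative_within) (auto simp: trivial_limit_within)
    qed
  qed
qed

lemma smooth_family_smooth_map:
  assumes "smooth_family X \<iota> f" "t \<in> {0..1}"
  shows "smooth_map X \<iota> (f t)"
proof -
  obtain U G where G: "open U" "{0..1} \<times> X \<subseteq> U" "smooth_on U G"
    "\<forall>t\<in>{0..1}. \<forall>x\<in>X. f t (inv \<iota> x) = G (t, x)"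
    "\<forall>t\<in>{0..1}. \<forall>x\<in>X. time_derivative f t (inv \<iota> x) = frechet_derivative G (at (t, x)) (1, 0)"
    by (rule smooth_familyE[OF assms(1)])
  have "smooth_on X (\<lambda>x. G (t, x))"
    by (rule smooth_on_slice[OF open_X _ G(3)]) (use G(2) assms(2) in auto)
  then show ?thesis
    unfolding smooth_map_def by (rule smooth_on_cong) (use G(4) assms(2) in auto)
qed

lemma smooth_family_continuous:
  assumes "smooth_family X \<iota> f"
  shows "continuous_on ({0..1} \<times> X) (\<lambda>z. f (fst z) (inv \<iota> (snd z)))"
    and "continuous_on ({0..1} \<times> X) (\<lambda>z. time_derivative f (fst z) (inv \<iota> (snd z)))"
proof -
  obtain U G where G: "open U" "{0..1} \<times> X \<subseteq> U" "smooth_on U G"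
    and eq: "\<forall>t\<in>{0..1}. \<forall>x\<in>X. f t (inv \<iota> x) = G (t, x)"
    "\<forall>t\<in>{0..1}. \<forall>x\<in>X. time_derivative f t (inv \<iota> x) = frechet_derivative G (at (t, x)) (1, 0)"
    by (rule smooth_familyE[OF assms])
  have "continuous_on ({0..1} \<times> X) G"
    using smooth_on_continuous[OF G(3)] G(2) by (rule continuous_on_subset)
  then show "continuous_on ({0..1} \<times> X) (\<lambda>z. f (fst z) (inv \<iota> (snd z)))"
    by (rule continuous_on_cong[THEN iffD1, rotated 2]) (use eq in auto)
  have "continuous_on U (\<lambda>z. frechet_derivative G (at z) (1, 0))"
    using Ck_on_SucD(2)[OF smooth_on_Ck[OF G(3)], of 0 "(1, 0)"] by simp
  then have "continuous_on ({0..1} \<times> X) (\<lambda>z. frechet_derivative G (at z) (1, 0))"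
    using G(2) by (rule continuous_on_subset)
  then show "continuous_on ({0..1} \<times> X) (\<lambda>z. time_derivative f (fst z) (inv \<iota> (snd z)))"
    by (rule continuous_on_cong[THEN iffD1, rotated 2]) (use eq in auto)
qed

lemma smooth_family_time_derivative_continuous:
  assumes "smooth_family X \<iota> f" "t \<in> {0..1}"
  shows "continuous_on X (\<lambda>x. time_derivative f t (inv \<iota> x))"
  by (rule continuous_on_compose2[OF smooth_family_continuous(2)[OF assms(1)],
        of X "\<lambda>x. (t, x)", simplified])
     (use assms(2) in \<open>auto intro!: continuous_intros\<close>)

text \<open>The material derivative of a time-dependent field along a moving point.\<close>

lemma smooth_family_along:
  assumes f: "smooth_family X \<iota> f" and t: "t \<in> {0..1}"
    and c: "(c has_vector_derivative c') (at t within {0..1})" "\<And>s. s \<in> {0..1} \<Longrightarrow> c s \<in> X"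
  shows "((\<lambda>s. f s (inv \<iota> (c s))) has_vector_derivative
      time_derivative f t (inv \<iota> (c t)) + frechet_derivative (\<lambda>x. f t (inv \<iota> x)) (at (c t)) c')
      (at t within {0..1})"
proof -
  obtain U G where "open U" and G: "{0..1} \<times> X \<subseteq> U" "smooth_on U G"
    and eq: "\<forall>t\<in>{0..1}. \<forall>x\<in>X. f t (inv \<iota> x) = G (t, x)"
    "\<forall>t\<in>{0..1}. \<forall>x\<in>X. time_derivative f t (inv \<iota> x) = frechet_derivative G (at (t, x)) (1, 0)"
    by (rule smooth_familyE[OF f])
  let ?G' = "frechet_derivative G (at (t, c t))"
  have ct: "c t \<in> X" using c(2) t by simp
  have G': "(G has_derivative ?G') (at (t, c t))"
    by (rule smooth_on_has_derivative[OF G(2)]) (use G(1) t ct in auto)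
  have "((\<lambda>s. (s, c s)) has_vector_derivative (1, c')) (at t within {0..1})"
    using c(1) by (auto simp: has_vector_derivative_def intro!: derivative_eq_intros)
  from has_vector_derivative_comp[OF this, of G ?G'] G'
  have "((\<lambda>s. G (s, c s)) has_vector_derivative ?G' (1, c')) (at t within {0..1})" by simp
  then have 1: "((\<lambda>s. f s (inv \<iota> (c s))) has_vector_derivative ?G' (1, c')) (at t within {0..1})"
    by (rule has_vector_derivative_transform[rotated 2]) (use t c(2) eq(1) in auto)
  have "((\<lambda>x. (t, x)) has_derivative (\<lambda>e. (0, e))) (at (c t))"
    by (auto intro!: derivative_eq_intros)
  from diff_chain_at[OF this, of G ?G'] G'
  have "((\<lambda>x. G (t, x)) has_derivative (\<lambda>e. ?G' (0, e))) (at (c t))" by (simp add: o_def)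
  then have "((\<lambda>x. f t (inv \<iota> x)) has_derivative (\<lambda>e. ?G' (0, e))) (at (c t))"
    by (rule has_derivative_transform_within_open[OF _ open_X ct]) (use eq(1) t in auto)
  then have 2: "frechet_derivative (\<lambda>x. f t (inv \<iota> x)) (at (c t)) c' = ?G' (0, c')"
    using frechet_derivative_at by metis
  have "?G' (1, c') = ?G' ((1, 0) + (0, c'))" by simp
  also have "\<dots> = ?G' (1, 0) + ?G' (0, c')"
    by (rule linear_add[OF has_derivative_linear[OF G']])
  finally show ?thesis using 1 eq(2)[rule_format, OF t ct] 2 by simp
qed

lemma smooth_family_time_derivative:
  assumes f: "smooth_family X \<iota> f" and t: "t \<in> {0..1}"
  shows "((\<lambda>s. f s p) has_vector_derivative time_derivative f t p) (at t within {0..1})"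
proof -
  have "smooth_on X (\<lambda>x. f t (inv \<iota> x))"
    using smooth_family_smooth_map[OF f t] by (simp add: smooth_map_def o_def)
  then have "linear (frechet_derivative (\<lambda>x. f t (inv \<iota> x)) (at (\<iota> p)))"
    by (intro has_derivative_linear[OF smooth_on_has_derivative]) auto
  then show ?thesis
    using smooth_family_along[OF f t, of "\<lambda>s. \<iota> p" 0] by (simp add: linear_0)
qed

end


section \<open>Densities transported by a flow\<close>

text \<open>\<open>\<gamma> t p\<close> is the position at time \<open>t\<close>, in the \<open>x\<close>-chart, of the particle that starts at \<open>p\<close>. All that is
  used of a displacement interpolation, besides straightness of its trajectories in one of the
  charts, is that particles follow \<open>v\<close> and carry \<open>\<mu> 0\<close> to \<open>\<mu> t\<close>.\<close>

locale transported_density = bregman_manifold X \<Omega> \<iota>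
  for X :: "(real^'d::finite) set" and \<Omega> and \<iota> :: "'m::topological_space \<Rightarrow> real^'d" +
  fixes \<mu> :: "real \<Rightarrow> 'm measure" and \<rho> :: "real \<Rightarrow> 'm \<Rightarrow> real"
    and v :: "real \<Rightarrow> ('m, 'd) vfield" and \<gamma> :: "real \<Rightarrow> 'm \<Rightarrow> real^'d"
  assumes density: "density_curve X \<Omega> \<iota> \<mu> \<rho>"
    and smooth_v: "smooth_family X \<iota> v"
    and \<gamma>_in: "t \<in> {0..1} \<Longrightarrow> \<gamma> t p \<in> X"
    and \<gamma>_deriv: "t \<in> {0..1} \<Longrightarrow>
      ((\<lambda>s. \<gamma> s p) has_vector_derivative v t (inv \<iota> (\<gamma> t p))) (at t within {0..1})"
    and \<gamma>_measurable: "t \<in> {0..1} \<Longrightarrow> \<gamma> t \<in> borel_measurable borel"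
    and \<gamma>_push: "t \<in> {0..1} \<Longrightarrow> distr (\<mu> t) borel \<iota> = distr (\<mu> 0) borel (\<gamma> t)"
begin

lemma smooth_\<rho>: "smooth_family X \<iota> \<rho>"
  and density_\<rho>: "t \<in> {0..1} \<Longrightarrow> smooth_density X \<Omega> \<iota> (\<rho> t)"
  and \<mu>_eq: "t \<in> {0..1} \<Longrightarrow> \<mu> t = density (vol X \<Omega> \<iota>) (\<lambda>p. ennreal (\<rho> t p))"
  using density by (auto simp: density_curve_def)

lemmas \<rho>_pos = smooth_density_pos[OF density_\<rho>]

lemma prob_\<mu>: "t \<in> {0..1} \<Longrightarrow> prob_space (\<mu> t)"
  using density_\<rho>[of t] by (simp add: \<mu>_eq smooth_density_def)

lemma sets_\<mu>: "t \<in> {0..1} \<Longrightarrow> sets (\<mu> t) = sets borel"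
  using sets_vol by (simp add: \<mu>_eq)

lemma measurable_\<mu>: "t \<in> {0..1} \<Longrightarrow> measurable (\<mu> t) N = measurable borel N"
  by (rule measurable_cong_sets[OF sets_\<mu> refl])

lemma integral_along:
  assumes t: "t \<in> {0..1}" and f: "f \<in> borel_measurable borel"
  shows "(\<integral>p. f (\<gamma> t p) \<partial>\<mu> 0) =
    (\<integral>x. indicator X x * (J x * \<rho> t (inv \<iota> x) * f x) \<partial>lborel)"
proof -
  have "(\<integral>p. f (\<gamma> t p) \<partial>\<mu> 0) = (\<integral>x. f x \<partial>distr (\<mu> 0) borel (\<gamma> t))"
    by (rule integral_distr[symmetric]) (use \<gamma>_measurable[OF t] f in \<open>auto simp: measurable_\<mu>\<close>)
  also have "\<dots> = (\<integral>x. f x \<partial>distr (\<mu> t) borel \<iota>)" by (simp add: \<gamma>_push[OF t])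
  also have "\<dots> = (\<integral>p. f (\<iota> p) \<partial>\<mu> t)"
    by (rule integral_distr) (use f t in \<open>auto simp: measurable_\<mu>\<close>)
  also have "\<dots> = (\<integral>x. indicator X x * (J x * \<rho> t (inv \<iota> x) * f (\<iota> (inv \<iota> x))) \<partial>lborel)"
    unfolding \<mu>_eq[OF t]
    by (rule integral_density_vol)
       (use measurable_compose[OF measurable_\<iota> f] \<rho>_pos[OF t] in auto)
  also have "\<dots> = (\<integral>x. indicator X x * (J x * \<rho> t (inv \<iota> x) * f x) \<partial>lborel)"
    by (intro Bochner_Integration.integral_cong refl) (auto simp: indicator_def)
  finally show ?thesis .
qed

lemma continuous_on_v: "t \<in> {0..1} \<Longrightarrow> continuous_on X (\<lambda>x. v t (inv \<iota> x))"
  using smooth_on_continuous smooth_family_smooth_map[OF smooth_v]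
  by (fastforce simp: smooth_map_def o_def)

lemma continuous_on_\<rho>: "t \<in> {0..1} \<Longrightarrow> continuous_on X (\<lambda>x. \<rho> t (inv \<iota> x))"
  using smooth_on_continuous smooth_family_smooth_map[OF smooth_\<rho>]
  by (fastforce simp: smooth_map_def o_def)

text \<open>The derivative of the integral of a bump function against \<open>\<mu> t\<close>, computed once through the
  density and once through the flow.\<close>

lemma bump_continuity_equation:
  assumes t: "t \<in> {0..1}" and r: "0 < r" "cball a r \<subseteq> X"
  shows "(\<integral>x. indicator (cball a r) x * (bump a r x * (J x * time_derivative \<rho> t (inv \<iota> x))) \<partial>lborel) =
    (\<integral>x. indicator (cball a r) x *
        (J x * \<rho> t (inv \<iota> x) * bump' a r x (v t (inv \<iota> x))) \<partial>lborel)" (is "?A = ?B")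
proof -
  let ?K = "cball a r"
  have K: "compact ({0..1::real} \<times> ?K)" by (intro compact_Times) auto
  have KX: "{0..1} \<times> ?K \<subseteq> {0..1} \<times> X" using r(2) by auto
  have J: "continuous_on ?K J"
    using smooth_on_continuous[OF smooth_on_J] r(2) by (rule continuous_on_subset)
  define f where "f s x = indicator ?K x * (bump a r x * (J x * \<rho> s (inv \<iota> x)))" for s x
  define f' where "f' s x = indicator ?K x * (bump a r x * (J x * time_derivative \<rho> s (inv \<iota> x)))"
    for s x
  have 1: "((\<lambda>s. \<integral>x. f s x \<partial>lborel) has_real_derivative (\<integral>x. f' t x \<partial>lborel)) (at t within {0..1})"
  proof -
    have "continuous_on ({0..1} \<times> ?K)
        (\<lambda>z. bump a r (snd z) * (J (snd z) * time_derivative \<rho> (fst z) (inv \<iota> (snd z))))"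
      by (intro continuous_intros continuous_on_subset[OF smooth_family_continuous(2)[OF smooth_\<rho>] KX]
          continuous_on_compose2[OF continuous_on_bump[of UNIV]] continuous_on_compose2[OF J]) auto
    from compact_imp_bounded[OF compact_continuous_image[OF this K]]
    obtain C where C: "0 < C" "\<And>s x. s \<in> {0..1} \<Longrightarrow> x \<in> ?K \<Longrightarrow>
        norm (bump a r x * (J x * time_derivative \<rho> s (inv \<iota> x))) \<le> C"
      by (force simp: bounded_pos)
    show ?thesis
    proof (rule has_real_derivative_integral[where w = "\<lambda>x. C * indicator ?K x"])
      show "integrable lborel (f s)" if "s \<in> {0..1}" for s
        unfolding f_def
        by (intro integrable_indicator_cball continuous_intros J
            continuous_on_subset[OF continuous_on_\<rho>[OF that] r(2)])
      show "((\<lambda>s. f s x) has_real_derivative f' s x) (at s within {0..1})" if "s \<in> {0..1}" for s x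
        unfolding f_def f'_def
        using smooth_family_time_derivative[OF smooth_\<rho> that, of "inv \<iota> x"]
        by (intro DERIV_cmult) (simp add: has_real_derivative_iff_has_vector_derivative)
      show "\<bar>f' s x\<bar> \<le> C * indicator ?K x" if "s \<in> {0..1}" for s x
        using C(2)[OF that, of x] by (cases "x \<in> ?K") (auto simp: f'_def)
      show "integrable lborel (\<lambda>x. C * indicator ?K x)"
        using emeasure_lborel_cball_finite[of a r]
        by (intro integrable_mult_right integrable_real_indicator) auto
      show "f' t \<in> borel_measurable lborel"
        unfolding f'_def
        by (intro borel_measurable_integrable integrable_indicator_cball continuous_intros J
            continuous_on_subset[OF smooth_family_time_derivative_continuous[OF smooth_\<rho> t] r(2)])
    qed (use t in auto)
  qed
  define \<psi> where "\<psi> x = indicator ?K x *\<^sub>R bump' a r x (v t (inv \<iota> x))" for x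
  have \<psi>: "\<psi> \<in> borel_measurable borel"
    unfolding \<psi>_def
    by (intro borel_measurable_continuous_on_indicator continuous_intros
        continuous_on_subset[OF continuous_on_v[OF t] r(2)]) auto
  have \<psi>_eq: "\<psi> x = bump' a r x (v t (inv \<iota> x))" for x
    using bump_outside[OF r(1), of x a] by (cases "x \<in> ?K") (auto simp: \<psi>_def)
  have bump_meas: "bump a r \<in> borel_measurable borel"
    by (intro borel_measurable_continuous_onI continuous_intros)
  have 2: "((\<lambda>s. \<integral>p. bump a r (\<gamma> s p) \<partial>\<mu> 0) has_real_derivative (\<integral>p. \<psi> (\<gamma> t p) \<partial>\<mu> 0))
      (at t within {0..1})"
  proof -
    have "continuous_on ({0..1} \<times> ?K) (\<lambda>z. bump' a r (snd z) (v (fst z) (inv \<iota> (snd z))))"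
      by (intro continuous_intros continuous_on_subset[OF smooth_family_continuous(1)[OF smooth_v] KX])
    from compact_imp_bounded[OF compact_continuous_image[OF this K]]
    obtain C where C: "0 < C" "\<And>s x. s \<in> {0..1} \<Longrightarrow> x \<in> ?K \<Longrightarrow> norm (bump' a r x (v s (inv \<iota> x))) \<le> C"
      by (force simp: bounded_pos)
    interpret \<mu>0: prob_space "\<mu> 0" by (rule prob_\<mu>) simp
    have "((\<lambda>s. \<integral>p. bump a r (\<gamma> s p) \<partial>\<mu> 0) has_real_derivative
        (\<integral>p. bump' a r (\<gamma> t p) (v t (inv \<iota> (\<gamma> t p))) \<partial>\<mu> 0)) (at t within {0..1})"
    proof (rule has_real_derivative_integral[where w = "\<lambda>p. C" and
          f' = "\<lambda>s p. bump' a r (\<gamma> s p) (v s (inv \<iota> (\<gamma> s p)))"])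
      show "integrable (\<mu> 0) (\<lambda>p. bump a r (\<gamma> s p))" if "s \<in> {0..1}" for s
      proof (rule \<mu>0.integrable_const_bound[where B = "(r\<^sup>2)\<^sup>2"])
        have "norm (bump a r x) \<le> (r\<^sup>2)\<^sup>2" for x
          unfolding bump_def real_norm_def abs_power2 by (intro power_mono) auto
        then show "AE p in \<mu> 0. norm (bump a r (\<gamma> s p)) \<le> (r\<^sup>2)\<^sup>2" by simp
        show "(\<lambda>p. bump a r (\<gamma> s p)) \<in> borel_measurable (\<mu> 0)"
          using measurable_compose[OF \<gamma>_measurable[OF that] bump_meas] by (simp add: measurable_\<mu>)
      qed
      show "((\<lambda>s. bump a r (\<gamma> s p)) has_real_derivative bump' a r (\<gamma> s p) (v s (inv \<iota> (\<gamma> s p))))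
          (at s within {0..1})" if "s \<in> {0..1}" for s p
        using has_vector_derivative_comp[OF \<gamma>_deriv[OF that] bump_has_derivative]
        by (simp add: has_real_derivative_iff_has_vector_derivative)
      show "\<bar>bump' a r (\<gamma> s p) (v s (inv \<iota> (\<gamma> s p)))\<bar> \<le> C" if "s \<in> {0..1}" for s p
        using C(1) C(2)[OF that, of "\<gamma> s p"] bump_outside[OF r(1), of "\<gamma> s p" a]
        by (cases "\<gamma> s p \<in> ?K") auto
      show "(\<lambda>p. bump' a r (\<gamma> t p) (v t (inv \<iota> (\<gamma> t p)))) \<in> borel_measurable (\<mu> 0)"
        using measurable_compose[OF \<gamma>_measurable[OF t] \<psi>] by (simp add: measurable_\<mu> \<psi>_eq)
    qed (use t in auto)
    then show ?thesis by (simp add: \<psi>_eq)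
  qed
  have same: "(\<integral>p. bump a r (\<gamma> s p) \<partial>\<mu> 0) = (\<integral>x. f s x \<partial>lborel)" if "s \<in> {0..1}" for s
    unfolding integral_along[OF that bump_meas]
  proof (intro Bochner_Integration.integral_cong refl)
    fix x
    show "indicator X x * (J x * \<rho> s (inv \<iota> x) * bump a r x) = f s x"
      using bump_outside[OF r(1), of x a] r(2)
      by (cases "x \<in> ?K") (auto simp: f_def indicator_def)
  qed
  have "((\<lambda>s. \<integral>p. bump a r (\<gamma> s p) \<partial>\<mu> 0) has_vector_derivative (\<integral>x. f' t x \<partial>lborel)) (at t within {0..1})"
    using 1[unfolded has_real_derivative_iff_has_vector_derivative]
    by (rule has_vector_derivative_transform[rotated 2]) (use same t in auto)
  then have "(\<integral>x. f' t x \<partial>lborel) = (\<integral>p. \<psi> (\<gamma> t p) \<partial>\<mu> 0)"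
    using 2[unfolded has_real_derivative_iff_has_vector_derivative]
    by (rule has_vector_derivative_unique_01[OF t])
  also have "\<dots> = ?B"
    unfolding integral_along[OF t \<psi>]
  proof (intro Bochner_Integration.integral_cong refl)
    fix x
    show "indicator X x * (J x * \<rho> t (inv \<iota> x) * \<psi> x) =
        indicator ?K x * (J x * \<rho> t (inv \<iota> x) * bump' a r x (v t (inv \<iota> x)))"
      using r(2) by (cases "x \<in> ?K") (auto simp: \<psi>_def indicator_def)
  qed
  finally show ?thesis unfolding f'_def .
qed

text \<open>Integration by parts, component by component, makes the two derivatives of
  \<open>bump_continuity_equation\<close> integrals against the same bump function.\<close>

lemma continuity_equation:
  assumes t: "t \<in> {0..1}" and x: "x \<in> X"
  shows "J x * time_derivative \<rho> t (inv \<iota> x) + (\<Sum>i\<in>UNIV. pd i (flux (\<rho> t) (v t) i) x) = 0"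
proof (rule eq_0_if_bump_integrals_eq_0[OF open_X _ x])
  let ?R = "\<lambda>i. flux (\<rho> t) (v t) i"
  have R: "smooth_on X (?R i)" for i
    by (intro smooth_on_flux smooth_family_smooth_map smooth_\<rho> smooth_v t)
  have c1: "continuous_on X (\<lambda>x. J x * time_derivative \<rho> t (inv \<iota> x))"
    by (intro continuous_intros smooth_on_continuous[OF smooth_on_J]
        smooth_family_time_derivative_continuous smooth_\<rho> t)
  have c2: "continuous_on X (pd i (?R i))" for i
    by (intro smooth_on_continuous smooth_on_pd R)
  show "continuous_on X (\<lambda>x. J x * time_derivative \<rho> t (inv \<iota> x) + (\<Sum>i\<in>UNIV. pd i (?R i) x))"
    by (intro continuous_on_add continuous_on_sum c1 c2)
  fix r assume r: "0 < r" "cball x r \<subseteq> X"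
  let ?K = "cball x r"
  let ?I = "\<lambda>f. \<integral>y. indicator ?K y * f y \<partial>lborel"
  have i1: "integrable lborel (\<lambda>y. indicator ?K y * (bump x r y * (J y * time_derivative \<rho> t (inv \<iota> y))))"
    by (intro integrable_indicator_cball continuous_on_mult continuous_on_bump
        continuous_on_subset[OF c1 r(2)])
  have i2: "integrable lborel (\<lambda>y. indicator ?K y * (bump x r y * pd i (?R i) y))" for i
    by (intro integrable_indicator_cball continuous_on_mult continuous_on_bump
        continuous_on_subset[OF c2 r(2)])
  have i3: "integrable lborel (\<lambda>y. indicator ?K y * (bump' x r y (axis i 1) * ?R i y))" for i
    by (intro integrable_indicator_cball continuous_on_mult continuous_on_bump' continuous_intros
        continuous_on_subset[OF smooth_on_continuous[OF R] r(2)])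
  have "(\<integral>y. bump x r y * (J y * time_derivative \<rho> t (inv \<iota> y) + (\<Sum>i\<in>UNIV. pd i (?R i) y)) \<partial>lborel)
      = (\<integral>y. indicator ?K y * (bump x r y * (J y * time_derivative \<rho> t (inv \<iota> y))) +
          (\<Sum>i\<in>UNIV. indicator ?K y * (bump x r y * pd i (?R i) y)) \<partial>lborel)"
  proof (intro Bochner_Integration.integral_cong refl)
    fix y
    show "bump x r y * (J y * time_derivative \<rho> t (inv \<iota> y) + (\<Sum>i\<in>UNIV. pd i (?R i) y)) =
        indicator ?K y * (bump x r y * (J y * time_derivative \<rho> t (inv \<iota> y))) +
          (\<Sum>i\<in>UNIV. indicator ?K y * (bump x r y * pd i (?R i) y))"
      using bump_outside[OF r(1), of y x]
      by (cases "y \<in> ?K") (auto simp: distrib_left sum_distrib_left)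
  qed
  also have "\<dots> = ?I (\<lambda>y. bump x r y * (J y * time_derivative \<rho> t (inv \<iota> y))) +
      (\<Sum>i\<in>UNIV. ?I (\<lambda>y. bump x r y * pd i (?R i) y))"
  proof -
    have "(\<integral>y. (\<Sum>i\<in>UNIV. indicator ?K y * (bump x r y * pd i (?R i) y)) \<partial>lborel) =
        (\<Sum>i\<in>UNIV. ?I (\<lambda>y. bump x r y * pd i (?R i) y))"
      by (rule Bochner_Integration.integral_sum) (rule i2)
    then show ?thesis
      by (simp only: Bochner_Integration.integral_add[OF i1 Bochner_Integration.integrable_sum[OF i2]])
  qed
  also have "?I (\<lambda>y. bump x r y * (J y * time_derivative \<rho> t (inv \<iota> y))) =
      ?I (\<lambda>y. J y * \<rho> t (inv \<iota> y) * bump' x r y (v t (inv \<iota> y)))"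
    by (rule bump_continuity_equation[OF t r])
  also have "\<dots> = (\<integral>y. (\<Sum>i\<in>UNIV. indicator ?K y * (bump' x r y (axis i 1) * ?R i y)) \<partial>lborel)"
    by (simp add: bump'_def flux_def inner_vec_def[of _ "v t _"] inner_axis sum_distrib_left sum_negf mult_ac)
  also have "\<dots> = (\<Sum>i\<in>UNIV. ?I (\<lambda>y. bump' x r y (axis i 1) * ?R i y))"
    by (rule Bochner_Integration.integral_sum) (rule i3)
  also have "\<dots> = (\<Sum>i\<in>UNIV. - ?I (\<lambda>y. bump x r y * pd i (?R i) y))"
    unfolding pd_def by (intro sum.cong refl bump_integration_by_parts[OF R r])
  finally show "(\<integral>y. bump x r y * (J y * time_derivative \<rho> t (inv \<iota> y) +
      (\<Sum>i\<in>UNIV. pd i (?R i) y)) \<partial>lborel) = 0"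
    by (simp add: sum_negf)
qed

lemma has_velocity: "has_velocity \<Omega> \<iota> \<rho> v"
  unfolding has_velocity_def
proof (intro ballI allI)
  fix t :: real and p assume t: "t \<in> {0..1}"
  have "time_derivative \<rho> t p = - divergence \<Omega> \<iota> (\<lambda>q. \<rho> t q *\<^sub>R v t q) p"
    using continuity_equation[OF t \<iota>_in, of p] J_pos[OF \<iota>_in, of p]
    by (simp add: divergence_flux field_simps)
  then show "((\<lambda>s. \<rho> s p) has_real_derivative - divergence \<Omega> \<iota> (\<lambda>q. \<rho> t q *\<^sub>R v t q) p) (at t within {0..1})"
    using smooth_family_time_derivative[OF smooth_\<rho> t, of p]
    by (simp add: has_real_derivative_iff_has_vector_derivative)
qed

text \<open>The points reached by the flow need not fill \<open>X\<close>, but they are dense: the density at time \<open>t\<close> is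
  positive, so every ball in \<open>X\<close> has positive mass, and this mass is transported from somewhere.\<close>

lemma eq_0_if_eq_0_along:
  fixes E :: "real^'d \<Rightarrow> 'b::real_normed_vector"
  assumes t: "t \<in> {0..1}" and E: "continuous_on X E" "\<And>p. E (\<gamma> t p) = 0" and x: "x \<in> X"
  shows "E x = 0"
proof (rule ccontr)
  assume "E x \<noteq> 0"
  have "open (X \<inter> E -` (- {0}))"
    by (intro continuous_open_preimage E open_X) auto
  moreover have "x \<in> X \<inter> E -` (- {0})" using x \<open>E x \<noteq> 0\<close> by simp
  ultimately obtain r where r: "0 < r" "ball x r \<subseteq> X \<inter> E -` (- {0})" by (rule openE)
  have "\<gamma> t p \<notin> ball x r" for p
    using r(2) E(2)[of p] by auto
  then have empty: "\<gamma> t -` ball x r = {}" by auto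
  have \<rho>t: "(\<lambda>p. ennreal (\<rho> t p)) \<in> borel_measurable (vol X \<Omega> \<iota>)"
    using \<rho>_pos(1)[OF t] by (simp add: measurable_cong_sets[OF sets_vol refl])
  have "emeasure (\<mu> t) (\<iota> -` ball x r \<inter> space (\<mu> t)) = emeasure (distr (\<mu> t) borel \<iota>) (ball x r)"
    by (rule emeasure_distr[symmetric]) (use t in \<open>auto simp: measurable_\<mu>\<close>)
  also have "\<dots> = emeasure (distr (\<mu> 0) borel (\<gamma> t)) (ball x r)" by (simp add: \<gamma>_push[OF t])
  also have "\<dots> = emeasure (\<mu> 0) (\<gamma> t -` ball x r \<inter> space (\<mu> 0))"
    by (rule emeasure_distr) (use \<gamma>_measurable[OF t] in \<open>auto simp: measurable_\<mu>\<close>)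
  also have "\<dots> = 0" by (simp add: empty)
  finally have "emeasure (\<mu> t) {p \<in> space (\<mu> t). \<not> \<iota> p \<notin> ball x r} = 0"
    by (simp add: vimage_def Int_def conj_commute)
  moreover have m: "{p. \<iota> p \<in> ball x r} \<in> sets borel"
    using measurable_sets[OF measurable_\<iota>, of "ball x r"] by (simp add: vimage_def)
  then have sets: "{p \<in> space (\<mu> t). \<not> \<iota> p \<notin> ball x r} \<in> sets (\<mu> t)"
    using sets_eq_imp_space_eq[OF sets_\<mu>[OF t]] by (simp add: sets_\<mu>[OF t])
  ultimately have "AE p in \<mu> t. \<iota> p \<notin> ball x r"
    using AE_iff_measurable[OF sets refl] by blast
  then have "AE p in vol X \<Omega> \<iota>. \<iota> p \<notin> ball x r"
    unfolding \<mu>_eq[OF t] AE_density[OF \<rho>t] using \<rho>_pos(2)[OF t] by simp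
  moreover have "{p. \<iota> p \<notin> ball x r} \<in> sets borel"
    using borel_comp[OF m] by (simp add: Collect_neg_eq)
  ultimately have ae: "AE y in lborel. y \<in> X \<longrightarrow> \<iota> (inv \<iota> y) \<notin> ball x r"
    by (rule AE_vol)
  obtain y where "y \<in> ball x r" "y \<in> X \<longrightarrow> \<iota> (inv \<iota> y) \<notin> ball x r"
    by (rule AE_lborel_ball_nonempty[OF ae r(1)])
  then show False using r(2) by auto
qed

end


section \<open>Accelerations\<close>

text \<open>In the chart in which the Christoffel symbols of the connection vanish, the covariant
  derivative is the directional derivative.\<close>

lemma chart_connection_eq_derivative:
  fixes w :: "('m, 'd::finite) vfield"
  assumes "((\<lambda>z. w (inv c z)) has_derivative w') (at (c p))"
  shows "chart_connection c v w p = w' (v p)"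
proof -
  have "((\<lambda>z. w (inv c z) $ k) has_derivative (\<lambda>h. w' h $ k)) (at (c p))" for k
    using bounded_linear.has_derivative[OF bounded_linear_vec_nth assms] .
  from has_derivative_eq_pd(2)[OF this] show ?thesis
    by (simp add: chart_connection_def vec_eq_iff)
qed

context bregman_manifold
begin

lemma smooth_map_has_derivative:
  assumes "smooth_map X \<iota> w" "x \<in> X"
  shows "((\<lambda>x. w (inv \<iota> x)) has_derivative frechet_derivative (\<lambda>x. w (inv \<iota> x)) (at x)) (at x)"
  using smooth_on_has_derivative[of X "\<lambda>x. w (inv \<iota> x)" x] assms by (simp add: smooth_map_def o_def)

lemma primal_nabla_eq:
  assumes "smooth_map X \<iota> w"
  shows "primal_nabla \<iota> v w p = frechet_derivative (\<lambda>x. w (inv \<iota> x)) (at (\<iota> p)) (v p)"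
  unfolding primal_nabla_def
  by (rule chart_connection_eq_derivative[OF smooth_map_has_derivative[OF assms \<iota>_in]])

lemma smooth_on_to_dual_nth:
  assumes "smooth_map X \<iota> w"
  shows "smooth_on X (\<lambda>x. (D2 \<Omega> x *v w (inv \<iota> x)) $ i)"
proof -
  have "smooth_on X (\<lambda>x. w (inv \<iota> x))" using assms by (simp add: smooth_map_def o_def)
  then show ?thesis
    unfolding matrix_vector_mult_def vec_lambda_beta
    by (intro smooth_on_sum open_X smooth_on_mult D2_smooth smooth_on_nth)
qed

lemma D2_mult_has_derivative:
  assumes c: "(c has_derivative c') (at z within S)" "c z \<in> X"
    and u: "(u has_derivative u') (at z within S)"
  shows "((\<lambda>z. D2 \<Omega> (c z) *v u z) has_derivative (\<lambda>h. D2 \<Omega> (c z) *v u' h +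
    (\<chi> i. \<Sum>j\<in>UNIV. frechet_derivative (\<lambda>x. D2 \<Omega> x $ i $ j) (at (c z)) (c' h) * u z $ j)))
    (at z within S)"
proof (rule has_derivative_vecI)
  fix i
  have A: "((\<lambda>z. D2 \<Omega> (c z) $ i $ j) has_derivative
      (\<lambda>h. frechet_derivative (\<lambda>x. D2 \<Omega> x $ i $ j) (at (c z)) (c' h))) (at z within S)" for j
    by (rule has_derivative_compose[OF c(1) smooth_on_has_derivative[OF D2_smooth c(2)]])
  have U: "((\<lambda>z. u z $ j) has_derivative (\<lambda>h. u' h $ j)) (at z within S)" for j
    by (rule bounded_linear.has_derivative[OF bounded_linear_vec_nth u])
  have "((\<lambda>z. \<Sum>j\<in>UNIV. D2 \<Omega> (c z) $ i $ j * u z $ j) has_derivative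
      (\<lambda>h. \<Sum>j\<in>UNIV. D2 \<Omega> (c z) $ i $ j * u' h $ j +
        frechet_derivative (\<lambda>x. D2 \<Omega> x $ i $ j) (at (c z)) (c' h) * u z $ j)) (at z within S)"
    by (rule has_derivative_sum) (rule has_derivative_mult[OF A U])
  then show "((\<lambda>z. (D2 \<Omega> (c z) *v u z) $ i) has_derivative (\<lambda>h. (D2 \<Omega> (c z) *v u' h +
    (\<chi> i. \<Sum>j\<in>UNIV. frechet_derivative (\<lambda>x. D2 \<Omega> x $ i $ j) (at (c z)) (c' h) * u z $ j)) $ i))
      (at z within S)"
    by (simp add: matrix_vector_mult_def sum.distrib)
qed

text \<open>The same third derivatives of \<open>\<Omega>\<close> appear here and in \<open>D2_mult_has_derivative\<close> along a curve; they are
  never computed, since in \<open>dual_acceleration_0\<close> they only have to agree.\<close>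

lemma to_dual_has_derivative:
  assumes w: "smooth_map X \<iota> w" and x: "x \<in> X"
  shows "((\<lambda>x. D2 \<Omega> x *v w (inv \<iota> x)) has_derivative
    (\<lambda>h. D2 \<Omega> x *v frechet_derivative (\<lambda>x. w (inv \<iota> x)) (at x) h +
    (\<chi> i. \<Sum>j\<in>UNIV. frechet_derivative (\<lambda>x. D2 \<Omega> x $ i $ j) (at x) h * w (inv \<iota> x) $ j))) (at x)"
  using D2_mult_has_derivative[OF has_derivative_ident _ smooth_map_has_derivative[OF w x]] x by simp

text \<open>Lowering the index with the metric turns components for the \<open>x\<close>-frame into components for the
  \<open>y\<close>-frame. The change of chart contributes the inverse Hessian, which cancels against the Hessian in
  the direction of differentiation, so the covariant derivative is computed in the \<open>x\<close>-chart.\<close>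

lemma dual_nabla_eq:
  assumes w: "smooth_map X \<iota> w"
  shows "D2 \<Omega> (\<iota> p) *v dual_nabla \<Omega> \<iota> v w p =
    frechet_derivative (\<lambda>x. D2 \<Omega> x *v w (inv \<iota> x)) (at (\<iota> p)) (v p)"
proof -
  let ?c = "dual_chart \<Omega> \<iota>"
  let ?W = "\<lambda>x. D2 \<Omega> x *v w (inv \<iota> x)"
  let ?W' = "frechet_derivative ?W (at (\<iota> p))"
  have W: "(?W has_derivative ?W') (at (\<iota> p))"
    using differentiableI[OF to_dual_has_derivative[OF w \<iota>_in]] by (simp only: frechet_derivative_works)
  have cp: "?c p = D \<Omega> (\<iota> p)" by (simp add: dual_chart_def)
  have "((\<lambda>z. ?W (D_inv z)) has_derivative (\<lambda>h. ?W' (matrix_inv (D2 \<Omega> (\<iota> p)) *v h))) (at (?c p))"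
    using diff_chain_at[OF D_inv_has_derivative[OF \<iota>_in], of ?W ?W' p] W by (simp add: cp o_def)
  then have "((\<lambda>z. to_dual \<Omega> \<iota> w (inv ?c z)) has_derivative
      (\<lambda>h. ?W' (matrix_inv (D2 \<Omega> (\<iota> p)) *v h))) (at (?c p))"
    by (rule has_derivative_transform_within_open[OF _ open_Y dual_chart_in])
       (simp add: inv_dual_chart to_dual_def D_inv_in)
  then have "chart_connection ?c (to_dual \<Omega> \<iota> v) (to_dual \<Omega> \<iota> w) p =
      ?W' (matrix_inv (D2 \<Omega> (\<iota> p)) *v to_dual \<Omega> \<iota> v p)"
    by (rule chart_connection_eq_derivative)
  also have "\<dots> = ?W' (v p)" by (simp add: to_dual_def D2_inv)
  finally show ?thesis by (simp add: dual_nabla_def from_dual_def D2_inv)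
qed

end

context transported_density
begin

lemma smooth_vt: "t \<in> {0..1} \<Longrightarrow> smooth_map X \<iota> (v t)"
  by (rule smooth_family_smooth_map[OF smooth_v])

text \<open>\<open>k p\<close> is the constant velocity of the particle that starts at \<open>p\<close>; \<open>E\<close> is its acceleration, which is
  zero where a particle passes and continuous everywhere.\<close>

lemma primal_acceleration_0:
  assumes straight: "\<And>p s. s \<in> {0..1} \<Longrightarrow> v s (inv \<iota> (\<gamma> s p)) = k p" and t: "t \<in> {0..1}"
  shows "primal_nabla \<iota> (v t) (v t) = (\<lambda>p. - time_derivative v t p)"
proof
  fix p
  let ?V = "\<lambda>x. v t (inv \<iota> x)"
  have V: "(?V has_derivative frechet_derivative ?V (at x)) (at x)" if "x \<in> X" for x
    by (rule smooth_map_has_derivative[OF smooth_vt[OF t] that])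
  define E where "E x = time_derivative v t (inv \<iota> x) + frechet_derivative ?V (at x) (?V x)" for x
  have "E (\<iota> p) = 0"
  proof (rule eq_0_if_eq_0_along[OF t, where E = E])
    have sV: "smooth_on X ?V" using smooth_vt[OF t] by (simp add: smooth_map_def o_def)
    have F: "frechet_derivative ?V (at x) h = (\<Sum>i\<in>UNIV. h $ i *\<^sub>R frechet_derivative ?V (at x) (axis i 1))"
      if "x \<in> X" for x h
    proof -
      note lin = has_derivative_linear[OF V[OF that]]
      have "frechet_derivative ?V (at x) h = frechet_derivative ?V (at x) (\<Sum>i\<in>UNIV. (h $ i) *\<^sub>R axis i 1)"
        using basis_expansion[of h] by (simp add: scalar_mult_eq_scaleR)
      then show ?thesis by (simp add: linear_sum[OF lin] linear_scale[OF lin])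
    qed
    have "continuous_on X (\<lambda>x. frechet_derivative ?V (at x) (axis i 1))" for i
      using Ck_on_SucD(2)[OF smooth_on_Ck[OF sV], of 0] by simp
    then have "continuous_on X (\<lambda>x. time_derivative v t (inv \<iota> x) +
        (\<Sum>i\<in>UNIV. ?V x $ i *\<^sub>R frechet_derivative ?V (at x) (axis i 1)))"
      by (intro continuous_intros smooth_family_time_derivative_continuous smooth_v t
          continuous_on_component continuous_on_v)
    then show "continuous_on X E"
      by (rule continuous_on_cong[THEN iffD1, rotated 2]) (use F in \<open>auto simp: E_def\<close>)
    fix q
    have "((\<lambda>s. v s (inv \<iota> (\<gamma> s q))) has_vector_derivative E (\<gamma> t q)) (at t within {0..1})"
      unfolding E_def by (rule smooth_family_along[OF smooth_v t \<gamma>_deriv[OF t] \<gamma>_in])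
    moreover have "((\<lambda>s. v s (inv \<iota> (\<gamma> s q))) has_vector_derivative 0) (at t within {0..1})"
      by (rule has_vector_derivative_transform[OF t _ has_vector_derivative_const[of "k q"]])
         (use straight in auto)
    ultimately show "E (\<gamma> t q) = 0" by (rule has_vector_derivative_unique_01[OF t])
  qed simp
  then show "primal_nabla \<iota> (v t) (v t) p = - time_derivative v t p"
    by (simp add: primal_nabla_eq[OF smooth_vt[OF t]] E_def eq_neg_iff_add_eq_0 add.commute)
qed

text \<open>The same argument for velocities that are constant in the \<open>y\<close>-frame. There the acceleration of a
  particle contains derivatives of the Hessian, but these are also produced by the directional
  derivative of the lowered field, so that the equation is again one about \<open>v\<close> at time \<open>t\<close> only.\<close>

lemma dual_acceleration_0:
  assumes straight: "\<And>p s. s \<in> {0..1} \<Longrightarrow> D2 \<Omega> (\<gamma> s p) *v v s (inv \<iota> (\<gamma> s p)) = k p"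
    and t: "t \<in> {0..1}"
  shows "dual_nabla \<Omega> \<iota> (v t) (v t) = (\<lambda>p. - time_derivative v t p)"
proof
  fix p
  let ?V = "\<lambda>x. v t (inv \<iota> x)" and ?W = "\<lambda>x. D2 \<Omega> x *v v t (inv \<iota> x)"
  note W = to_dual_has_derivative[OF smooth_vt[OF t]]
  have W': "(?W has_derivative frechet_derivative ?W (at x)) (at x)" if "x \<in> X" for x
    using differentiableI[OF W[OF that]] by (simp only: frechet_derivative_works)
  define E where "E x = D2 \<Omega> x *v time_derivative v t (inv \<iota> x) + frechet_derivative ?W (at x) (?V x)" for x
  have "E (\<iota> p) = 0"
  proof (rule eq_0_if_eq_0_along[OF t, where E = E])
    have comp: "E x $ i = (\<Sum>j\<in>UNIV. D2 \<Omega> x $ i $ j * time_derivative v t (inv \<iota> x) $ j) +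
        (\<Sum>j\<in>UNIV. ?V x $ j * pd j (\<lambda>x. ?W x $ i) x)" if "x \<in> X" for x i
      using has_derivative_eq_pd(2)[OF bounded_linear.has_derivative[OF bounded_linear_vec_nth W'[OF that]]]
      by (simp add: E_def matrix_vector_mult_def)
    have "continuous_on X (\<lambda>x. (\<Sum>j\<in>UNIV. D2 \<Omega> x $ i $ j * time_derivative v t (inv \<iota> x) $ j) +
        (\<Sum>j\<in>UNIV. ?V x $ j * pd j (\<lambda>x. ?W x $ i) x))" for i
      by (intro continuous_on_add continuous_on_sum continuous_on_mult continuous_on_component
          smooth_on_continuous[OF D2_smooth] smooth_family_time_derivative_continuous smooth_v t
          continuous_on_v smooth_on_continuous[OF smooth_on_pd[OF smooth_on_to_dual_nth[OF smooth_vt[OF t]]]])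
    then have "continuous_on X (\<lambda>x. \<chi> i. (\<Sum>j\<in>UNIV. D2 \<Omega> x $ i $ j * time_derivative v t (inv \<iota> x) $ j) +
        (\<Sum>j\<in>UNIV. ?V x $ j * pd j (\<lambda>x. ?W x $ i) x))"
      by (rule continuous_on_vec_lambda)
    then show "continuous_on X E"
      by (rule continuous_on_cong[THEN iffD1, rotated 2]) (use comp in \<open>auto simp: vec_eq_iff\<close>)
    fix q
    let ?x = "\<gamma> t q"
    have x: "?x \<in> X" by (rule \<gamma>_in[OF t])
    let ?u' = "time_derivative v t (inv \<iota> ?x) + frechet_derivative ?V (at ?x) (?V ?x)"
    let ?A = "\<lambda>h. \<chi> i. \<Sum>j\<in>UNIV. frechet_derivative (\<lambda>x. D2 \<Omega> x $ i $ j) (at ?x) h * ?V ?x $ j"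
    have u: "((\<lambda>s. v s (inv \<iota> (\<gamma> s q))) has_derivative (\<lambda>h. h *\<^sub>R ?u')) (at t within {0..1})"
      using smooth_family_along[OF smooth_v t \<gamma>_deriv[OF t] \<gamma>_in] by (simp add: has_vector_derivative_def)
    have "D2 \<Omega> ?x *v (h *\<^sub>R ?u') + ?A (h *\<^sub>R ?V ?x) = h *\<^sub>R (D2 \<Omega> ?x *v ?u' + ?A (?V ?x))" for h
    proof -
      have "?A (h *\<^sub>R ?V ?x) = h *\<^sub>R ?A (?V ?x)"
        using linear_scale[OF has_derivative_linear[OF smooth_on_has_derivative[OF D2_smooth x]]]
        by (simp add: vec_eq_iff sum_distrib_left mult.assoc)
      then show ?thesis by (simp only: matrix_vector_mult_scaleR matrix_vector_right_distrib scaleR_add_right)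
    qed
    moreover have "((\<lambda>s. D2 \<Omega> (\<gamma> s q) *v v s (inv \<iota> (\<gamma> s q))) has_derivative
        (\<lambda>h. D2 \<Omega> ?x *v (h *\<^sub>R ?u') + ?A (h *\<^sub>R ?V ?x))) (at t within {0..1})"
      using \<gamma>_deriv[OF t] by (intro D2_mult_has_derivative u x) (simp add: has_vector_derivative_def)
    ultimately have "((\<lambda>s. D2 \<Omega> (\<gamma> s q) *v v s (inv \<iota> (\<gamma> s q))) has_vector_derivative
        D2 \<Omega> ?x *v ?u' + ?A (?V ?x)) (at t within {0..1})"
      by (simp only: has_vector_derivative_def)
    moreover have "((\<lambda>s. D2 \<Omega> (\<gamma> s q) *v v s (inv \<iota> (\<gamma> s q))) has_vector_derivative 0) (at t within {0..1})"
      by (rule has_vector_derivative_transform[OF t _ has_vector_derivative_const[of "k q"]])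
         (use straight in auto)
    ultimately have "D2 \<Omega> ?x *v ?u' + ?A (?V ?x) = 0"
      by (rule has_vector_derivative_unique_01[OF t])
    moreover have "frechet_derivative ?W (at ?x) (?V ?x) =
        D2 \<Omega> ?x *v frechet_derivative ?V (at ?x) (?V ?x) + ?A (?V ?x)"
      using fun_cong[OF frechet_derivative_at[OF W[OF x]], of "?V ?x"] by simp
    ultimately show "E ?x = 0"
      by (simp add: E_def matrix_vector_right_distrib add.assoc)
  qed simp
  then have "D2 \<Omega> (\<iota> p) *v (time_derivative v t p + dual_nabla \<Omega> \<iota> (v t) (v t) p) = 0"
    by (simp add: E_def dual_nabla_eq[OF smooth_vt[OF t]] matrix_vector_right_distrib)
  then have "time_derivative v t p + dual_nabla \<Omega> \<iota> (v t) (v t) p = 0"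
    using D2_inv(2)[OF \<iota>_in, of p] by (metis matrix_vector_mult_0_right)
  then show "dual_nabla \<Omega> \<iota> (v t) (v t) p = - time_derivative v t p"
    by (simp add: eq_neg_iff_add_eq_0 add.commute)
qed

lemma primal_parallel_transport_if:
  assumes "field_along X \<Omega> \<iota> \<rho> v"
    and "\<And>t. t \<in> {0..1} \<Longrightarrow> primal_nabla \<iota> (v t) (v t) = (\<lambda>p. - time_derivative v t p)"
  shows "primal_parallel_transport X \<Omega> \<iota> \<rho> v v"
  using assms tangent_vector_uminus[OF density_\<rho>]
  by (simp add: primal_parallel_transport_def primal_connection_def field_along_def)

lemma dual_parallel_transport_if:
  assumes "field_along X \<Omega> \<iota> \<rho> v"
    and "\<And>t. t \<in> {0..1} \<Longrightarrow> dual_nabla \<Omega> \<iota> (v t) (v t) = (\<lambda>p. - time_derivative v t p)"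
  shows "dual_parallel_transport X \<Omega> \<iota> \<rho> v v"
  using assms tangent_vector_uminus[OF density_\<rho>]
  by (simp add: dual_parallel_transport_def dual_connection_def field_along_def)

end


section \<open>Displacement interpolations\<close>

context bregman_manifold
begin

lemma segment_has_vector_derivative:
  fixes a b :: "'b::real_normed_vector"
  shows "((\<lambda>s. (1 - s) *\<^sub>R a + s *\<^sub>R b) has_vector_derivative b - a) (at t within S)"
  by (auto simp: has_vector_derivative_def algebra_simps intro!: derivative_eq_intros)

lemma density_curve_measurable:
  assumes "density_curve X \<Omega> \<iota> \<mu> \<rho>" "t \<in> {0..1}"
  shows "measurable (\<mu> t) N = measurable borel N" "space (\<mu> t) = UNIV"
  using assms sets_vol measurable_cong_sets[of "\<mu> t" borel N N] by (auto simp: density_curve_def)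

text \<open>The derivative of the segment is \<open>D h y - D \<Omega>\<^sup>* y\<close> at all times. At time \<open>0\<close> it is also \<open>v 0\<close> at the
  starting point, which shows that \<open>D h\<close> is continuous.\<close>

lemma primal_transport:
  assumes \<rho>: "density_curve X \<Omega> \<iota> \<mu> \<rho>" and v: "smooth_family X \<iota> v"
    and h: "primal_displacement_interpolation X \<Omega> \<iota> h \<mu>"
    and vel: "primal_displacement_velocity X \<Omega> \<iota> h v"
  defines "\<gamma> \<equiv> \<lambda>t p. primal_displacement X \<Omega> h t (dual_chart \<Omega> \<iota> p)"
  shows "transported_density X \<Omega> \<iota> \<mu> \<rho> v \<gamma>"
    and "t \<in> {0..1} \<Longrightarrow> v t (inv \<iota> (\<gamma> t p)) = D h (dual_chart \<Omega> \<iota> p) - \<iota> p"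
proof -
  let ?T = "primal_displacement X \<Omega> h"
  have T: "?T t y = (1 - t) *\<^sub>R D_inv y + t *\<^sub>R D h y" if "y \<in> Y" for t y
    by (simp add: primal_displacement_def D_conjugate[OF that])
  have Dh: "D h y \<in> X" if "y \<in> Y" for y
    using h that by (auto simp: primal_displacement_interpolation_def displacement_potential_def)
  have in_X: "?T t y \<in> X" if "t \<in> {0..1}" "y \<in> Y" for t y
    using convexD_alt[OF convex_X D_inv_in[OF that(2)] Dh[OF that(2)], of t] that by (simp add: T)
  have deriv: "((\<lambda>s. ?T s y) has_vector_derivative v t (inv \<iota> (?T t y))) (at t within {0..1})"
    if "t \<in> {0..1}" "y \<in> Y" for t y
  proof -
    have "((\<lambda>s. \<iota> (inv \<iota> (?T s y))) has_vector_derivative v t (inv \<iota> (?T t y))) (at t within {0..1})"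
      using vel that by (auto simp: primal_displacement_velocity_def integral_curve_def)
    then show ?thesis
      by (rule has_vector_derivative_transform[rotated 2]) (use that in_X in auto)
  qed
  have const: "v t (inv \<iota> (?T t y)) = D h y - D_inv y" if "t \<in> {0..1}" "y \<in> Y" for t y
  proof (rule has_vector_derivative_unique_01[OF that(1) deriv[OF that]])
    show "((\<lambda>s. ?T s y) has_vector_derivative D h y - D_inv y) (at t within {0..1})"
      using segment_has_vector_derivative[of "D_inv y" "D h y" t] by (simp add: T[OF that(2)])
  qed
  have Dh_eq: "D h y = D_inv y + v 0 (inv \<iota> (D_inv y))" if "y \<in> Y" for y
    using const[of 0 y] that by (simp add: T)
  have v0: "continuous_on X (\<lambda>x. v 0 (inv \<iota> x))"
    using smooth_family_smooth_map[OF v, of 0] by (auto simp: smooth_map_def o_def intro: smooth_on_continuous)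
  have "continuous_on Y (\<lambda>y. (1 - t) *\<^sub>R D_inv y + t *\<^sub>R (D_inv y + v 0 (inv \<iota> (D_inv y))))" for t
    by (intro continuous_intros continuous_on_D_inv continuous_on_compose2[OF v0 continuous_on_D_inv]) auto
  then have "continuous_on Y (?T t)" for t
    by (rule continuous_on_cong[THEN iffD1, rotated 2]) (auto simp: T Dh_eq)
  then have T_meas: "?T t \<in> measurable (restrict_space borel Y) borel" for t
    by (rule borel_measurable_continuous_on_restrict)
  have Y: "Y \<in> sets borel" using open_Y by simp
  have c: "dual_chart \<Omega> \<iota> \<in> measurable (\<mu> 0) borel"
    using borel_measurable_continuous_onI[OF continuous_on_dual_chart]
    by (simp add: density_curve_measurable[OF \<rho>])
  note push = distr_restrict_distr[OF c dual_chart_in Y T_meas]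
  show "transported_density X \<Omega> \<iota> \<mu> \<rho> v \<gamma>"
  proof unfold_locales
    show "distr (\<mu> t) borel \<iota> = distr (\<mu> 0) borel (\<gamma> t)" if "t \<in> {0..1}" for t
      using h that push(1)[of t] by (simp add: primal_displacement_interpolation_def \<gamma>_def)
    show "\<gamma> t \<in> borel_measurable borel" for t
      using push(2)[of t] by (simp add: density_curve_measurable[OF \<rho>] \<gamma>_def)
  qed (use \<rho> v in_X deriv dual_chart_in in \<open>auto simp: \<gamma>_def\<close>)
  show "v t (inv \<iota> (\<gamma> t p)) = D h (dual_chart \<Omega> \<iota> p) - \<iota> p" if "t \<in> {0..1}"
    using const[OF that dual_chart_in] by (simp add: \<gamma>_def D_inv_dual_chart)
qed

text \<open>In the \<open>x\<close>-chart the trajectories are not straight; their images under \<open>D \<Omega>\<close> are. Applying \<open>D \<Omega>\<close> to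
  the velocity gives the constant \<open>D f x - D \<Omega> x\<close>, and at time \<open>0\<close> the continuity of \<open>D f\<close>. The push-forward
  is stated for the \<open>y\<close>-chart and is transferred to the \<open>x\<close>-chart by applying the inverse of \<open>D \<Omega>\<close>.\<close>

lemma dual_transport:
  assumes \<rho>: "density_curve X \<Omega> \<iota> \<mu> \<rho>" and v: "smooth_family X \<iota> v"
    and f: "dual_displacement_interpolation X \<Omega> \<iota> f \<mu>"
    and vel: "dual_displacement_velocity X \<Omega> \<iota> f v"
  defines "\<gamma> \<equiv> \<lambda>t p. D_inv (dual_displacement \<Omega> f t (\<iota> p))"
  shows "transported_density X \<Omega> \<iota> \<mu> \<rho> v \<gamma>"
    and "t \<in> {0..1} \<Longrightarrow> D2 \<Omega> (\<gamma> t p) *v v t (inv \<iota> (\<gamma> t p)) = D f (\<iota> p) - D \<Omega> (\<iota> p)"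
proof -
  let ?T = "dual_displacement \<Omega> f"
  have Df: "D f x \<in> Y" if "x \<in> X" for x
    using f that unfolding dual_displacement_interpolation_def displacement_potential_def by blast
  have in_Y: "?T t x \<in> Y" if "t \<in> {0..1}" "x \<in> X" for t x
    using convexD_alt[OF convex_Y _ Df[OF that(2)], of "D \<Omega> x" t] that
    by (simp add: dual_displacement_def)
  have deriv: "((\<lambda>s. D_inv (?T s x)) has_vector_derivative v t (inv \<iota> (D_inv (?T t x)))) (at t within {0..1})"
    if "t \<in> {0..1}" "x \<in> X" for t x
  proof -
    let ?c = "\<lambda>t. inv (dual_chart \<Omega> \<iota>) (?T t x)"
    have c: "?c s = inv \<iota> (D_inv (?T s x))" if "s \<in> {0..1}" for s
      using in_Y[OF that \<open>x \<in> X\<close>] by (rule inv_dual_chart)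
    have "((\<lambda>s. \<iota> (?c s)) has_vector_derivative v t (?c t)) (at t within {0..1})"
      using vel that by (auto simp: dual_displacement_velocity_def integral_curve_def)
    then have "((\<lambda>s. D_inv (?T s x)) has_vector_derivative v t (?c t)) (at t within {0..1})"
      by (rule has_vector_derivative_transform[rotated 2]) (use that in_Y D_inv_in c in auto)
    then show ?thesis by (simp add: c[OF that(1)])
  qed
  have const: "D2 \<Omega> (D_inv (?T t x)) *v v t (inv \<iota> (D_inv (?T t x))) = D f x - D \<Omega> x"
    if "t \<in> {0..1}" "x \<in> X" for t x
  proof (rule has_vector_derivative_unique_01[OF that(1)])
    show "((\<lambda>s. D \<Omega> (D_inv (?T s x))) has_vector_derivative D2 \<Omega> (D_inv (?T t x)) *v v t (inv \<iota> (D_inv (?T t x))))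
        (at t within {0..1})"
      by (rule has_vector_derivative_comp[OF deriv[OF that] D_has_derivative[OF D_inv_in[OF in_Y[OF that]]]])
    have "((\<lambda>s. ?T s x) has_vector_derivative D f x - D \<Omega> x) (at t within {0..1})"
      unfolding dual_displacement_def by (rule segment_has_vector_derivative)
    then show "((\<lambda>s. D \<Omega> (D_inv (?T s x))) has_vector_derivative D f x - D \<Omega> x) (at t within {0..1})"
      by (rule has_vector_derivative_transform[rotated 2]) (use that in_Y in auto)
  qed
  have Df_eq: "D f x = D \<Omega> x + D2 \<Omega> x *v v 0 (inv \<iota> x)" if "x \<in> X" for x
    using const[of 0 x] that by (simp add: dual_displacement_def)
  have v0: "continuous_on X (\<lambda>x. v 0 (inv \<iota> x))"
    using smooth_family_smooth_map[OF v, of 0] by (auto simp: smooth_map_def o_def intro: smooth_on_continuous)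
  have "continuous_on X (\<lambda>x. (1 - t) *\<^sub>R D \<Omega> x + t *\<^sub>R (D \<Omega> x + D2 \<Omega> x *v v 0 (inv \<iota> x)))" for t
    unfolding matrix_vector_mult_def
    by (intro continuous_intros continuous_on_D v0 smooth_on_continuous[OF D2_smooth])
  then have "continuous_on X (?T t)" for t
    by (rule continuous_on_cong[THEN iffD1, rotated 2]) (auto simp: dual_displacement_def Df_eq)
  then have T_meas: "?T t \<in> measurable (restrict_space borel X) borel" for t
    by (rule borel_measurable_continuous_on_restrict)
  have \<iota>_meas: "\<iota> \<in> measurable (\<mu> 0) borel" by (simp add: density_curve_measurable[OF \<rho>])
  note pushT = distr_restrict_distr[OF \<iota>_meas \<iota>_in X_borel T_meas]
  have Y: "Y \<in> sets borel" using open_Y by simp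
  have D_inv_meas: "D_inv \<in> measurable (restrict_space borel Y) borel"
    by (rule borel_measurable_continuous_on_restrict[OF continuous_on_D_inv])
  show "transported_density X \<Omega> \<iota> \<mu> \<rho> v \<gamma>"
  proof unfold_locales
    fix t :: real assume t: "t \<in> {0..1}"
    have c: "dual_chart \<Omega> \<iota> \<in> measurable (\<mu> t) borel"
      using borel_measurable_continuous_onI[OF continuous_on_dual_chart]
      by (simp add: density_curve_measurable[OF \<rho> t])
    note push_inv = distr_restrict_distr[OF pushT(2)[of t] in_Y[OF t \<iota>_in] Y D_inv_meas]
    have "distr (\<mu> t) borel (dual_chart \<Omega> \<iota>) = distr (\<mu> 0) borel (\<lambda>p. ?T t (\<iota> p))"
      using f t pushT(1)[of t] by (simp add: dual_displacement_interpolation_def)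
    then show "distr (\<mu> t) borel \<iota> = distr (\<mu> 0) borel (\<gamma> t)"
      using distr_restrict_distr(1)[OF c dual_chart_in Y D_inv_meas] push_inv(1)
      by (simp add: D_inv_dual_chart \<gamma>_def)
    show "\<gamma> t \<in> borel_measurable borel"
      using push_inv(2) by (simp add: density_curve_measurable[OF \<rho>] \<gamma>_def)
  qed (use \<rho> v in_Y D_inv_in deriv in \<open>auto simp: \<gamma>_def\<close>)
  show "D2 \<Omega> (\<gamma> t p) *v v t (inv \<iota> (\<gamma> t p)) = D f (\<iota> p) - D \<Omega> (\<iota> p)" if "t \<in> {0..1}"
    using const[OF that \<iota>_in] by (simp add: \<gamma>_def)
qed

end

theorem theorem4p11:
  fixes X :: "(real^'d::finite) set"
    and \<Omega> :: "real^'d \<Rightarrow> real"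
    and \<iota> :: "'m::topological_space \<Rightarrow> real^'d"
    and \<mu> :: "real \<Rightarrow> 'm measure"
    and \<rho> :: "real \<Rightarrow> 'm \<Rightarrow> real"
    and v :: "real \<Rightarrow> ('m, 'd) vfield"
  assumes "bregman_manifold X \<Omega> \<iota>"
    and "density_curve X \<Omega> \<iota> \<mu> \<rho>"
    and "field_along X \<Omega> \<iota> \<rho> v"
  shows "((\<exists>h. primal_displacement_interpolation X \<Omega> \<iota> h \<mu> \<and>
               primal_displacement_velocity X \<Omega> \<iota> h v) \<longrightarrow>
            has_velocity \<Omega> \<iota> \<rho> v \<and> primal_parallel_transport X \<Omega> \<iota> \<rho> v v) \<and>
         ((\<exists>f. dual_displacement_interpolation X \<Omega> \<iota> f \<mu> \<and>
               dual_displacement_velocity X \<Omega> \<iota> f v) \<longrightarrow>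
            has_velocity \<Omega> \<iota> \<rho> v \<and> dual_parallel_transport X \<Omega> \<iota> \<rho> v v)"
proof (intro conjI impI; elim exE conjE)
  interpret bregman_manifold X \<Omega> \<iota> by fact
  have v: "smooth_family X \<iota> v" using assms(3) by (simp add: field_along_def)
  {
    fix h
    assume h: "primal_displacement_interpolation X \<Omega> \<iota> h \<mu>"
      and vel: "primal_displacement_velocity X \<Omega> \<iota> h v"
    note transport = primal_transport[OF assms(2) v h vel]
    interpret transported_density X \<Omega> \<iota> \<mu> \<rho> v
      "\<lambda>t p. primal_displacement X \<Omega> h t (dual_chart \<Omega> \<iota> p)" by (rule transport(1))
    show "has_velocity \<Omega> \<iota> \<rho> v" by (rule has_velocity)
    show "primal_parallel_transport X \<Omega> \<iota> \<rho> v v"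
      using primal_acceleration_0[OF transport(2)] by (rule primal_parallel_transport_if[OF assms(3)])
  next
    fix f
    assume f: "dual_displacement_interpolation X \<Omega> \<iota> f \<mu>"
      and vel: "dual_displacement_velocity X \<Omega> \<iota> f v"
    note transport = dual_transport[OF assms(2) v f vel]
    interpret transported_density X \<Omega> \<iota> \<mu> \<rho> v "\<lambda>t p. D_inv (dual_displacement \<Omega> f t (\<iota> p))"
      by (rule transport(1))
    show "has_velocity \<Omega> \<iota> \<rho> v" by (rule has_velocity)
    show "dual_parallel_transport X \<Omega> \<iota> \<rho> v v"
      using dual_acceleration_0[OF transport(2)] by (rule dual_parallel_transport_if[OF assms(3)])
  }
qed

end
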